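(* Let $\alpha\in(0,1)$ and define $T_\alpha:(0,1]\to(0,1]$ by $T_\alpha(x)=x(1+2^\alpha x^\alpha)$ if $x\in(0,1/2]$ and $T_\alpha(x)=2x-1$ if $x\in(1/2,1]$. Let $\mu$ be the unique $T_\alpha$-invariant probability measure on $(0,1]$ that is absolutely continuous with respect to Lebesgue measure. Let $\{B_n\}_{n\ge 1}$ be a sequence of intervals such that $\sum_{n=1}^\infty\mu(B_n)=\infty$ and $B_n\subset(d,1]$ for all $n$ and some $d>0$. Put $A_n=\{x\in(0,1]: T_\alpha^n x\in B_n\}$, $S_n=\sum_{k=1}^n\mathbb{I}(A_k)$ and $E_n=\sum_{k=1}^n\mu(A_k)$. Then $\{B_n\}$ is a strong Borel--Cantelli sequence with respect to $T_\alpha$ and $\mu$, i.e. $$\frac{S_n}{E_n}\to 1\quad\mu\text{-almost surely as } n\to\infty.$$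
   Context: It is known that $T_\alpha$ preserves a unique probability measure $\mu$ that is absolutely continuous with respect to Lebesgue measure. The probability space is $(0,1]$ with the $\sigma$-field of Lebesgue measurable subsets and the measure $\mu$. $T_\alpha^n$ is the $n$-fold iterate of $T_\alpha$, and $\mathbb{I}(A)$ denotes the indicator of $A$. *)

theory Defs
  imports "HOL-Probability.Probability"
begin

(* Only the values on {0<..1} matter; outside this interval the function is junk. *)
definition intermittent_map :: "real \<Rightarrow> real \<Rightarrow> real" where
  "intermittent_map \<alpha> x =
     (if x \<le> 1/2 then x * (1 + 2 powr \<alpha> * x powr \<alpha>) else 2 * x - 1)"

definition invariant_under :: "'a measure \<Rightarrow> ('a \<Rightarrow> 'a) \<Rightarrow> bool" where
  "invariant_under M T \<longleftrightarrow> T \<in> measurable M M \<and> distr M M T = M"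

(* Absolutely continuous invariant probability measures on (0,1], on the sigma-field of
   Lebesgue (not only Borel) measurable subsets. *)
definition acip :: "(real \<Rightarrow> real) \<Rightarrow> real measure \<Rightarrow> bool" where
  "acip T M \<longleftrightarrow>
     prob_space M \<and>
     sets M = sets (lebesgue_on {0<..1}) \<and>
     absolutely_continuous (lebesgue_on {0<..1}) M \<and>
     invariant_under M T"

definition hit_event :: "'a measure \<Rightarrow> ('a \<Rightarrow> 'a) \<Rightarrow> (nat \<Rightarrow> 'a set) \<Rightarrow> nat \<Rightarrow> 'a set" where
  "hit_event M T B n = {x \<in> space M. (T ^^ n) x \<in> B n}"

definition hit_count ::
    "'a measure \<Rightarrow> ('a \<Rightarrow> 'a) \<Rightarrow> (nat \<Rightarrow> 'a set) \<Rightarrow> nat \<Rightarrow> 'a \<Rightarrow> real" where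
  "hit_count M T B n x = (\<Sum>k=1..n. indicator (hit_event M T B k) x)"

definition expected_hits ::
    "'a measure \<Rightarrow> ('a \<Rightarrow> 'a) \<Rightarrow> (nat \<Rightarrow> 'a set) \<Rightarrow> nat \<Rightarrow> real" where
  "expected_hits M T B n = (\<Sum>k=1..n. measure M (hit_event M T B k))"

(* Sequences are indexed by n \<ge> 1; the value B 0 is never used. *)
definition strong_borel_cantelli ::
    "'a measure \<Rightarrow> ('a \<Rightarrow> 'a) \<Rightarrow> (nat \<Rightarrow> 'a set) \<Rightarrow> bool" where
  "strong_borel_cantelli M T B \<longleftrightarrow>
     (AE x in M. (\<lambda>n. hit_count M T B n x / expected_hits M T B n) \<longlonglongrightarrow> 1)"

end

theory Submission
  imports Defs
begin

text \<open>
  A finite measure \<open>\<nu>\<close> on \<open>(0,1]\<close> is represented by its distribution function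
  \<open>F s = \<nu> (0, s]\<close>; if \<open>\<phi>\<close> is the inverse of the left branch, its image under the map has the
  distribution function \<open>F (\<phi> s) + F ((1 + s) / 2) - F (1/2)\<close>. As \<open>\<phi>\<close> is concave, this operation
  preserves concave distribution functions, that is, decreasing densities.

  For a decreasing density, after \<open>N\<close> steps a fixed fraction of the mass outside
  \<open>(0, \<phi>\<^sup>N 1]\<close> is spread over a multiple of Lebesgue measure. Two decreasing densities of the same
  mass can therefore be coupled at a geometric rate, up to the mass that they keep near \<open>0\<close>, which is
  controlled by the tails of the summable sequence \<open>\<phi>\<^sup>n 1 = O(n\<^sup>-\<^sup>1\<^sup>/\<^sup>\<alpha>)\<close>. In particular the
  given invariant measure is the limit of the images of Lebesgue measure, so its density is decreasing
  and bounded away from \<open>0\<close>.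

  The image under \<open>n/2\<close> steps of \<open>\<mu>\<close> restricted to an interval \<open>B \<subseteq> (d,1]\<close> is a decreasing density
  (full cylinders) plus two boundary pieces of mass \<open>O(\<phi>\<^sup>n\<^sup>/\<^sup>2 1)\<close>. Coupling the decreasing part
  with \<open>\<mu>\<close> bounds the covariance of two hits at distance \<open>n\<close> by
  \<open>\<mu>(B') (\<mu>(B) a\<^sub>n + c\<^sub>n)\<close> with \<open>a\<^sub>n\<close> polynomially small and \<open>c\<^sub>n\<close> summable, hence the
  variance of \<open>S\<^sub>n\<close> by \<open>E\<^sub>n\<^sup>2\<^sup>-\<^sup>\<theta>\<close> for some \<open>\<theta> > 0\<close>, which suffices for the strong law.
\<close>

subsection \<open>Concave distribution functions\<close>

text \<open>Domination of one density by another is monotonicity of the difference of the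
  distribution functions, so positivity, comparison and removal of a common part are all statements
  about \<open>mono_on\<close>, free of almost-everywhere densities. Two obstacles shape the
  estimates. The measures of the \<open>B n\<close> may be arbitrarily small, so E_n cannot be
  compared with n, and every error term has to carry the measure of the later interval as a factor.
  This is what \<open>d\<close> provides: on [d, 1] a decreasing density is at most its mass divided
  by \<open>d\<close>, while the density of \<mu> is bounded below. Moreover the coupling rate
  \<open>n powr -\<kappa>\<close> is not summable. It is enough for the part that carries the
  measures of both intervals, because lags beyond sqrt E_n then gain a power of E_n. Only the
  boundary pieces, which lack the factor of the earlier interval, need a summable bound; they get it
  from the orbit of 1 under the inverse branch, and this is where \<alpha> < 1 enters.\<close>

definition concave_cdf :: "(real \<Rightarrow> real) \<Rightarrow> bool" where
  "concave_cdf F \<longleftrightarrow> F 0 = 0 \<and> mono_on {0..1} F \<and> concave_on {0..1} F"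

text \<open>Cleared of denominators, so that coinciding points need no side condition.\<close>

lemma concave_on_chord:
  fixes F :: "real \<Rightarrow> real"
  assumes F: "concave_on {0..1} F" and "0 \<le> u" "u \<le> p" "p \<le> z" "z \<le> 1"
  shows "(z - p) * F u + (p - u) * F z \<le> (z - u) * F p"
proof (cases "u = z")
  case False
  then have uz: "u < z"
    using assms by simp
  define t where "t = (p - u) / (z - u)"
  have tz: "(z - u) * t = p - u"
    using uz by (simp add: t_def)
  then have t: "p = (1 - t) * u + t * z" "0 \<le> t" "t \<le> 1"
    using assms uz by (simp add: algebra_simps, simp_all add: t_def)
  have "(1 - t) * F u + t * F z \<le> F ((1 - t) *\<^sub>R u + t *\<^sub>R z)"
    using assms uz t by (intro concave_onD[OF F]) auto
  then have "(1 - t) * F u + t * F z \<le> F p"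
    using t by simp
  then have "(z - u) * ((1 - t) * F u + t * F z) \<le> (z - u) * F p"
    using uz by (intro mult_left_mono) auto
  moreover have "(z - u) * ((1 - t) * F u + t * F z) = (z - u - (z - u) * t) * F u + ((z - u) * t) * F z"
    by (simp add: algebra_simps)
  then have "(z - u) * ((1 - t) * F u + t * F z) = (z - p) * F u + (p - u) * F z"
    by (simp add: tz)
  ultimately show ?thesis
    by simp
qed (use assms in auto)

text \<open>Both slopes are compared with the slope over [u, z], so [u, v] and [w, z] may
  overlap.\<close>

lemma concave_on_increments:
  fixes F :: "real \<Rightarrow> real"
  assumes F: "concave_on {0..1} F" and uz: "0 \<le> u" "u \<le> v" "u \<le> w" "v \<le> z" "w \<le> z" "z \<le> 1"
  shows "(v - u) * (F z - F w) \<le> (z - w) * (F v - F u)"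
proof (cases "u = z")
  case False
  then have pos: "0 < z - u"
    using uz by simp
  have "(v - u) * ((z - u) * (F z - F w)) \<le> (v - u) * ((z - w) * (F z - F u))"
    using uz concave_on_chord[OF F, of u w z]
    by (intro mult_left_mono) (auto simp: algebra_simps)
  also have "\<dots> = (z - w) * ((v - u) * (F z - F u))"
    by simp
  also have "\<dots> \<le> (z - w) * ((z - u) * (F v - F u))"
    using uz concave_on_chord[OF F, of u v z]
    by (intro mult_left_mono) (auto simp: algebra_simps)
  finally have "(z - u) * ((v - u) * (F z - F w)) \<le> (z - u) * ((z - w) * (F v - F u))"
    by (simp add: mult.left_commute)
  with pos show ?thesis
    by (simp only: mult_le_cancel_left_pos)
qed (use uz in auto)

lemma concave_cdfD:
  assumes "concave_cdf F"
  shows "F 0 = 0" "concave_on {0..1} F"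
    and concave_cdf_mono: "0 \<le> u \<Longrightarrow> u \<le> v \<Longrightarrow> v \<le> 1 \<Longrightarrow> F u \<le> F v"
  using assms by (auto simp: concave_cdf_def intro: mono_onD[of "{0..1}" F])

lemma concave_cdf_nonneg: "concave_cdf F \<Longrightarrow> 0 \<le> u \<Longrightarrow> u \<le> 1 \<Longrightarrow> 0 \<le> F u"
  using concave_cdf_mono[of F 0 u] concave_cdfD(1)[of F] by simp

text \<open>A decreasing density at u is at most its mean over (0, u]. Away from 0 a bound on the
  total mass is thus a bound on the density.\<close>

lemma concave_cdf_increment_le:
  assumes F: "concave_cdf F" and "0 < d" "d \<le> u" "u \<le> v" "v \<le> 1"
  shows "F v - F u \<le> (v - u) / d * F 1"
proof -
  have "u * (F v - F u) \<le> (v - u) * F u"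
    using concave_on_increments[OF concave_cdfD(2)[OF F], of 0 u u v] concave_cdfD(1)[OF F] assms
    by simp
  also have "\<dots> \<le> (v - u) * F 1"
    using assms concave_cdf_mono[OF F, of u 1] by (intro mult_left_mono) auto
  finally have *: "u * (F v - F u) \<le> (v - u) * F 1" .
  have "d * (F v - F u) \<le> u * (F v - F u)"
    using assms concave_cdf_mono[OF F, of u v] by (intro mult_right_mono) auto
  with * have "d * (F v - F u) \<le> (v - u) * F 1"
    by simp
  then show ?thesis
    using assms by (simp add: field_simps)
qed

lemma concave_cdf_zero: "concave_cdf (\<lambda>s. 0)"
  by (auto simp: concave_cdf_def concave_on_const intro: mono_onI)

lemma concave_cdf_ident: "concave_cdf (\<lambda>s. s)"
  by (auto simp: concave_cdf_def concave_on_ident intro: mono_onI)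

lemma concave_cdf_add:
  "concave_cdf F \<Longrightarrow> concave_cdf G \<Longrightarrow> concave_cdf (\<lambda>s. F s + G s)"
  by (auto simp: concave_cdf_def intro!: mono_onI add_mono concave_on_add dest: mono_onD)

lemma concave_cdf_cmult: "concave_cdf F \<Longrightarrow> 0 \<le> k \<Longrightarrow> concave_cdf (\<lambda>s. k * F s)"
  by (auto simp: concave_cdf_def intro!: mono_onI mult_left_mono dest: mono_onD)

lemma concave_cdf_min:
  assumes "concave_cdf F" "concave_cdf G"
  shows "concave_cdf (\<lambda>s. min (F s) (G s))"
proof -
  have "concave_on {0..1} (\<lambda>s. min (F s) (G s))"
  proof
    fix t x y :: real
    assume t: "t > 0" "t < 1" "x \<in> {0..1}" "y \<in> {0..1}"
    have "(1 - t) * min (F x) (G x) + t * min (F y) (G y) \<le> (1 - t) * F x + t * F y"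
      using t by (intro add_mono mult_left_mono) auto
    also have "\<dots> \<le> F ((1 - t) *\<^sub>R x + t *\<^sub>R y)"
      using t by (intro concave_onD[OF concave_cdfD(2)] assms) auto
    finally have 1: "(1 - t) * min (F x) (G x) + t * min (F y) (G y) \<le> F ((1 - t) *\<^sub>R x + t *\<^sub>R y)" .
    have "(1 - t) * min (F x) (G x) + t * min (F y) (G y) \<le> (1 - t) * G x + t * G y"
      using t by (intro add_mono mult_left_mono) auto
    also have "\<dots> \<le> G ((1 - t) *\<^sub>R x + t *\<^sub>R y)"
      using t by (intro concave_onD[OF concave_cdfD(2)] assms) auto
    finally show "(1 - t) * min (F x) (G x) + t * min (F y) (G y)
        \<le> min (F ((1 - t) *\<^sub>R x + t *\<^sub>R y)) (G ((1 - t) *\<^sub>R x + t *\<^sub>R y))"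
      using 1 by simp
  qed simp
  moreover have "mono_on {0..1} (\<lambda>s. min (F s) (G s))"
    using assms by (auto simp: concave_cdf_def intro!: mono_onI min.mono dest: mono_onD)
  ultimately show ?thesis
    using assms by (simp add: concave_cdf_def)
qed

text \<open>Hypothesis \<open>m\<close> says that the density is at least \<open>k\<close>, so a
  nonnegative decreasing density remains after the removal of \<open>k\<close> times Lebesgue
  measure.\<close>

lemma concave_cdf_minus_linear:
  assumes F: "concave_cdf F" and m: "mono_on {0..1} (\<lambda>s. F s - k * s)"
  shows "concave_cdf (\<lambda>s. F s - k * s)"
proof -
  have "concave_on {0..1} (\<lambda>s. F s - k * s)"
    using concave_cdfD(2)[OF F] unfolding concave_on_iff by (auto simp: algebra_simps)
  then show ?thesis
    using F m by (simp add: concave_cdf_def)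
qed

lemma concave_cdf_limit:
  assumes F: "\<And>n. concave_cdf (F n)" and lim: "\<And>s. s \<in> {0..1} \<Longrightarrow> (\<lambda>n. F n s) \<longlonglongrightarrow> G s"
  shows "concave_cdf G"
proof -
  have "G 0 = 0"
    using lim[of 0] concave_cdfD(1)[OF F] by (simp add: LIMSEQ_const_iff)
  moreover have "mono_on {0..1} G"
  proof (rule mono_onI)
    fix r s :: real
    assume "r \<in> {0..1}" "s \<in> {0..1}" "r \<le> s"
    then show "G r \<le> G s"
      by (intro LIMSEQ_le[OF lim lim]) (auto intro!: concave_cdf_mono[OF F])
  qed
  moreover have "concave_on {0..1} G"
  proof
    fix t x y :: real
    assume t: "t > 0" "t < 1" "x \<in> {0..1}" "y \<in> {0..1}"
    have xy: "(1 - t) *\<^sub>R x + t *\<^sub>R y \<in> {0..1}"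
      by (rule convexD[OF convex_real_interval(5)]) (use t in auto)
    have "(\<lambda>n. (1 - t) * F n x + t * F n y) \<longlonglongrightarrow> (1 - t) * G x + t * G y"
      by (intro tendsto_intros lim t)
    then show "(1 - t) * G x + t * G y \<le> G ((1 - t) *\<^sub>R x + t *\<^sub>R y)"
      by (rule LIMSEQ_le[OF _ lim[OF xy]])
         (use t in \<open>auto intro!: concave_onD[OF concave_cdfD(2)[OF F], simplified]\<close>)
  qed simp
  ultimately show ?thesis
    by (simp add: concave_cdf_def)
qed

subsection \<open>Action of a two-branch map on distribution functions\<close>

text \<open>The data of the coupling argument. The right branch is fixed as x -> 2x - 1.
  \<open>phi_expand\<close> records that the left branch has slope at most 3, and
  \<open>orbit_decay\<close> with p > 1 describes the neutral fixed point; p will be 1 /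
  \<alpha>.\<close>

locale concave_branch =
  fixes \<phi> :: "real \<Rightarrow> real" and C p :: real
  assumes phi_0 [simp]: "\<phi> 0 = 0"
    and phi_1 [simp]: "\<phi> 1 = 1/2"
    and phi_concave: "concave_on {0..1} \<phi>"
    and phi_onto: "\<And>y. 0 \<le> y \<Longrightarrow> y \<le> 1/2 \<Longrightarrow> \<exists>s\<in>{0..1}. \<phi> s = y"
    and phi_expand: "\<And>u v. 0 \<le> u \<Longrightarrow> u \<le> v \<Longrightarrow> v \<le> 1 \<Longrightarrow> (v - u) / 3 \<le> \<phi> v - \<phi> u"
    and p_gt_1: "1 < p"
    and orbit_decay: "\<And>n. n \<ge> 1 \<Longrightarrow> (\<phi> ^^ n) 1 \<le> C * real n powr -p"
begin

text \<open>The right end of the leftmost n-cylinder: n applications of the left branch map (0,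
  \<open>orbit n\<close>] onto (0, 1].\<close>

definition orbit :: "nat \<Rightarrow> real" where
  "orbit n = (\<phi> ^^ n) 1"

definition orbit_tail :: "nat \<Rightarrow> real" where
  "orbit_tail N = (\<Sum>j. orbit (N + j))"

definition push :: "(real \<Rightarrow> real) \<Rightarrow> real \<Rightarrow> real" where
  "push F s = F (\<phi> s) + (F ((1 + s) / 2) - F (1/2))"

lemma phi_mono: "0 \<le> u \<Longrightarrow> u \<le> v \<Longrightarrow> v \<le> 1 \<Longrightarrow> \<phi> u \<le> \<phi> v"
  using phi_expand[of u v] by simp

lemma phi_range: "0 \<le> s \<Longrightarrow> s \<le> 1 \<Longrightarrow> 0 \<le> \<phi> s \<and> \<phi> s \<le> 1/2"
  using phi_mono[of 0 s] phi_mono[of s 1] by simp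

lemma half_le_phi: "0 \<le> s \<Longrightarrow> s \<le> 1 \<Longrightarrow> s / 2 \<le> \<phi> s"
  using concave_on_chord[OF phi_concave, of 0 s 1] by simp

lemma phi_iter_range: "0 \<le> s \<Longrightarrow> s \<le> 1 \<Longrightarrow> 0 \<le> (\<phi> ^^ n) s \<and> (\<phi> ^^ n) s \<le> 1"
proof (induction n)
  case (Suc n)
  then show ?case
    using phi_range[of "(\<phi> ^^ n) s"] by simp
qed simp

lemma phi_iter_mono:
  "0 \<le> u \<Longrightarrow> u \<le> v \<Longrightarrow> v \<le> 1 \<Longrightarrow> (\<phi> ^^ n) u \<le> (\<phi> ^^ n) v"
proof (induction n)
  case (Suc n)
  then show ?case
    using phi_iter_range[of u n] phi_iter_range[of v n] by (auto intro!: phi_mono)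
qed simp

lemma phi_iter_expand:
  "0 \<le> u \<Longrightarrow> u \<le> v \<Longrightarrow> v \<le> 1 \<Longrightarrow> (v - u) / 3 ^ n \<le> (\<phi> ^^ n) v - (\<phi> ^^ n) u"
proof (induction n)
  case (Suc n)
  have "(v - u) / 3 ^ Suc n = (v - u) / 3 ^ n / 3"
    by simp
  also have "\<dots> \<le> ((\<phi> ^^ n) v - (\<phi> ^^ n) u) / 3"
    using Suc by (intro divide_right_mono) auto
  also have "\<dots> \<le> (\<phi> ^^ Suc n) v - (\<phi> ^^ Suc n) u"
    using Suc phi_iter_range[of u n] phi_iter_range[of v n] phi_iter_mono[of u v n]
    using phi_expand[of "(\<phi> ^^ n) u" "(\<phi> ^^ n) v"] by simp
  finally show ?case .
qed simp

section \<open>The orbit of 1 and its tails\<close>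

lemma phi_iter_orbit: "(\<phi> ^^ m) (orbit n) = orbit (n + m)"
  by (simp add: orbit_def funpow_add add.commute[of n])

lemma orbit_0 [simp]: "orbit 0 = 1"
  by (simp add: orbit_def)

lemma orbit_Suc: "orbit (Suc n) = \<phi> (orbit n)"
  by (simp add: orbit_def)

lemma orbit_nonneg [simp]: "0 \<le> orbit n" and orbit_le_1 [simp]: "orbit n \<le> 1"
  using phi_iter_range[of 1 n] by (auto simp: orbit_def)

lemma orbit_decseq: "m \<le> n \<Longrightarrow> orbit n \<le> orbit m"
  using phi_iter_mono[of "orbit (n - m)" 1 m] phi_iter_orbit[of m "n - m"] phi_iter_orbit[of m 0]
  by simp

lemma summable_orbit: "summable orbit"
proof (rule summable_comparison_test_ev)
  show "eventually (\<lambda>n. norm (orbit n) \<le> C * real n powr -p) sequentially"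
    using eventually_ge_at_top[of "1::nat"]
    by eventually_elim (use orbit_decay orbit_nonneg in \<open>simp add: orbit_def\<close>)
  show "summable (\<lambda>n. C * real n powr -p)"
    using p_gt_1 by (intro summable_mult) (simp add: summable_real_powr_iff)
qed

lemma summable_orbit_shift: "summable (\<lambda>j. orbit (N + j))"
  using summable_ignore_initial_segment[OF summable_orbit, of N] by (simp add: add.commute)

lemma sum_orbit_le_tail: "(\<Sum>j<m. orbit (N + j)) \<le> orbit_tail N"
  unfolding orbit_tail_def by (rule sum_le_suminf[OF summable_orbit_shift]) auto

lemma orbit_tail_nonneg: "0 \<le> orbit_tail N"
  unfolding orbit_tail_def by (rule suminf_nonneg[OF summable_orbit_shift]) simp

text \<open>The exponent p is split into (p - 1) / 2, whose power of N + j is estimated by that of N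
  and pulled out, and \<open>r\<close> > 1, which keeps the series convergent. Half of the exponent
  p - 1 is given away, but any positive power suffices.\<close>

lemma orbit_tail_bound:
  "\<exists>K\<ge>0. \<forall>N\<ge>1. orbit_tail N \<le> K * real N powr - ((p - 1) / 2)"
proof -
  define r where "r = (p + 1) / 2"
  have r: "1 < r" and pr: "-p = - ((p - 1) / 2) + (- r)"
    using p_gt_1 by (auto simp: r_def field_simps)
  have C: "0 \<le> C"
    using orbit_decay[of 1] orbit_nonneg[of 1] by (simp add: orbit_def)
  have sm: "summable (\<lambda>n. real n powr - r)"
    using r by (simp add: summable_real_powr_iff)
  define K where "K = C * (\<Sum>n. real n powr - r)"
  have "0 \<le> K"
    unfolding K_def using C sm by (intro mult_nonneg_nonneg suminf_nonneg) auto
  moreover have "orbit_tail N \<le> K * real N powr - ((p - 1) / 2)" if N: "N \<ge> 1" for N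
  proof -
    have sN: "summable (\<lambda>j. real (N + j) powr - r)"
      using summable_ignore_initial_segment[OF sm, of N] by (simp add: add.commute)
    have "orbit (N + j) \<le> C * real N powr - ((p - 1) / 2) * real (N + j) powr - r" for j
    proof -
      have "orbit (N + j) \<le> C * real (N + j) powr - p"
        using orbit_decay[of "N + j"] N by (simp add: orbit_def)
      also have "\<dots> = C * (real (N + j) powr - ((p - 1) / 2) * real (N + j) powr - r)"
        unfolding pr by (simp only: powr_add)
      also have "\<dots> \<le> C * (real N powr - ((p - 1) / 2) * real (N + j) powr - r)"
        using N C p_gt_1 by (intro mult_left_mono mult_right_mono powr_mono2') auto
      finally show ?thesis
        by (simp add: mult.assoc)
    qed
    then have "orbit_tail N \<le> (\<Sum>j. C * real N powr - ((p - 1) / 2) * real (N + j) powr - r)"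
      unfolding orbit_tail_def
      by (intro suminf_le summable_orbit_shift summable_mult sN)
    also have "\<dots> = C * real N powr - ((p - 1) / 2) * (\<Sum>j. real (N + j) powr - r)"
      by (rule suminf_mult[OF sN])
    also have "\<dots> \<le> C * real N powr - ((p - 1) / 2) * (\<Sum>n. real n powr - r)"
    proof (intro mult_left_mono)
      have "(\<Sum>j. real (j + N) powr - r) = (\<Sum>n. real n powr - r) - (\<Sum>n<N. real n powr - r)"
        by (rule suminf_minus_initial_segment[OF sm])
      then show "(\<Sum>j. real (N + j) powr - r) \<le> (\<Sum>n. real n powr - r)"
        using sum_nonneg[of "{..<N}" "\<lambda>n. real n powr - r"] by (simp add: add.commute)
    qed (use C in auto)
    finally show ?thesis
      by (simp add: K_def mult_ac)
  qed
  ultimately show ?thesis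
    by blast
qed

lemma orbit_tail_tendsto_0: "orbit_tail \<longlonglongrightarrow> 0"
proof -
  obtain K where K: "\<forall>N\<ge>1. orbit_tail N \<le> K * real N powr - ((p - 1) / 2)"
    using orbit_tail_bound by blast
  have "(\<lambda>N. K * real N powr - ((p - 1) / 2)) \<longlonglongrightarrow> K * 0"
    using p_gt_1
    by (intro tendsto_mult tendsto_const tendsto_neg_powr filterlim_real_sequentially) auto
  then show ?thesis
    using K orbit_tail_nonneg
    by (intro tendsto_sandwich[where f = "\<lambda>N. 0" and g = orbit_tail
          and h = "\<lambda>N. K * real N powr - ((p - 1) / 2)"])
       (auto simp: eventually_sequentially)
qed

section \<open>Linearity, mass and positivity of the operator\<close>

lemma push_add: "push (\<lambda>s. F s + G s) = (\<lambda>s. push F s + push G s)"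
  by (auto simp: push_def)

lemma push_diff: "push (\<lambda>s. F s - G s) = (\<lambda>s. push F s - push G s)"
  by (auto simp: push_def)

lemma push_cmult: "push (\<lambda>s. k * F s) = (\<lambda>s. k * push F s)"
  by (auto simp: push_def algebra_simps)

lemma push_iter_add: "(push ^^ n) (\<lambda>s. F s + G s) = (\<lambda>s. (push ^^ n) F s + (push ^^ n) G s)"
  by (induction n) (simp_all add: push_add)

lemma push_iter_diff: "(push ^^ n) (\<lambda>s. F s - G s) = (\<lambda>s. (push ^^ n) F s - (push ^^ n) G s)"
  by (induction n) (simp_all add: push_diff)

lemma push_iter_cmult: "(push ^^ n) (\<lambda>s. k * F s) = (\<lambda>s. k * (push ^^ n) F s)"
  by (induction n) (simp_all add: push_cmult)

lemma push_iter_0: "F 0 = 0 \<Longrightarrow> (push ^^ n) F 0 = 0"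
  by (induction n) (simp_all add: push_def)

lemma push_iter_1: "(push ^^ n) F 1 = F 1"
  by (induction n) (simp_all add: push_def)

lemma push_cong: "(\<And>s. s \<in> {0..1} \<Longrightarrow> F s = G s) \<Longrightarrow> s \<in> {0..1} \<Longrightarrow> push F s = push G s"
  using phi_range[of s] by (auto simp: push_def)

lemma mono_on_left:
  fixes F :: "real \<Rightarrow> real"
  shows "mono_on {0..1} F \<Longrightarrow> mono_on {0..1} (\<lambda>s. F (\<phi> s))"
proof (rule mono_onI)
  fix r s :: real
  assume "mono_on {0..1} F" "r \<in> {0..1}" "s \<in> {0..1}" "r \<le> s"
  then show "F (\<phi> r) \<le> F (\<phi> s)"
    using phi_range[of r] phi_range[of s] phi_mono[of r s] by (auto intro: mono_onD[of "{0..1}" F])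
qed

lemma mono_on_right:
  fixes F :: "real \<Rightarrow> real"
  shows "mono_on {0..1} F \<Longrightarrow> mono_on {0..1} (\<lambda>s. F ((1 + s) / 2) - F (1/2))"
  by (rule mono_onI) (auto intro: mono_onD[of "{0..1}" F])

lemma mono_on_add_real:
  fixes F G :: "real \<Rightarrow> real"
  shows "mono_on A F \<Longrightarrow> mono_on A G \<Longrightarrow> mono_on A (\<lambda>s. F s + G s)"
  by (rule mono_onI, rule add_mono) (auto dest: mono_onD)

text \<open>Positivity of the transfer operator. Applied to a difference of distribution functions
  it says that domination of densities survives every step; most comparisons below use it in this
  form.\<close>

lemma mono_on_push: "mono_on {0..1} F \<Longrightarrow> mono_on {0..1} (push F)"
  unfolding push_def by (intro mono_on_add_real mono_on_left mono_on_right)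

lemma mono_on_push_iter: "mono_on {0..1} F \<Longrightarrow> mono_on {0..1} ((push ^^ n) F)"
  by (induction n) (simp_all add: mono_on_push)

lemma concave_cdf_left:
  assumes F: "concave_cdf F"
  shows "concave_cdf (\<lambda>s. F (\<phi> s))"
proof -
  have "concave_on {0..1} (\<lambda>s. F (\<phi> s))"
  proof
    fix t x y :: real
    assume t: "t > 0" "t < 1" "x \<in> {0..1}" "y \<in> {0..1}"
    have xy: "(1 - t) *\<^sub>R x + t *\<^sub>R y \<in> {0..1}"
      by (rule convexD[OF convex_real_interval(5)]) (use t in auto)
    have pxy: "(1 - t) *\<^sub>R \<phi> x + t *\<^sub>R \<phi> y \<in> {0..1}"
      by (rule convexD[OF convex_real_interval(5)]) (use t phi_range[of x] phi_range[of y] in auto)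
    have "(1 - t) * F (\<phi> x) + t * F (\<phi> y) \<le> F ((1 - t) *\<^sub>R \<phi> x + t *\<^sub>R \<phi> y)"
      using t phi_range[of x] phi_range[of y]
      by (intro concave_onD[OF concave_cdfD(2)[OF F]]) auto
    also have "\<dots> \<le> F (\<phi> ((1 - t) *\<^sub>R x + t *\<^sub>R y))"
      using t xy pxy phi_range[of "(1 - t) *\<^sub>R x + t *\<^sub>R y"] concave_onD[OF phi_concave, of t x y]
      by (intro concave_cdf_mono[OF F]) auto
    finally show "(1 - t) * F (\<phi> x) + t * F (\<phi> y) \<le> F (\<phi> ((1 - t) *\<^sub>R x + t *\<^sub>R y))" .
  qed simp
  then show ?thesis
    using F mono_on_left by (simp add: concave_cdf_def)
qed

lemma concave_cdf_right:
  assumes F: "concave_cdf F"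
  shows "concave_cdf (\<lambda>s. F ((1 + s) / 2) - F (1/2))"
proof -
  have "concave_on {0..1} (\<lambda>s. F ((1 + s) / 2) - F (1/2))"
  proof
    fix t x y :: real
    assume t: "t > 0" "t < 1" "x \<in> {0..1}" "y \<in> {0..1}"
    have "(1 - t) * F ((1 + x) / 2) + t * F ((1 + y) / 2)
        \<le> F ((1 - t) *\<^sub>R ((1 + x) / 2) + t *\<^sub>R ((1 + y) / 2))"
      using t by (intro concave_onD[OF concave_cdfD(2)[OF F]]) auto
    also have "(1 - t) *\<^sub>R ((1 + x) / 2) + t *\<^sub>R ((1 + y) / 2) = (1 + ((1 - t) *\<^sub>R x + t *\<^sub>R y)) / 2"
      by (simp add: field_simps)
    finally show "(1 - t) * (F ((1 + x) / 2) - F (1/2)) + t * (F ((1 + y) / 2) - F (1/2))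
        \<le> F ((1 + ((1 - t) *\<^sub>R x + t *\<^sub>R y)) / 2) - F (1/2)"
      by (simp add: algebra_simps)
  qed simp
  then show ?thesis
    using F mono_on_right by (simp add: concave_cdf_def)
qed

lemma concave_cdf_push: "concave_cdf F \<Longrightarrow> concave_cdf (push F)"
  unfolding push_def by (intro concave_cdf_add concave_cdf_left concave_cdf_right)

lemma concave_cdf_push_iter: "concave_cdf F \<Longrightarrow> concave_cdf ((push ^^ n) F)"
  by (induction n) (simp_all add: concave_cdf_push)

text \<open>Unrolling by the last visit to the right branch: the density entering through it at step
  j is at most \<open>K j\<close>, and from then on only the left branch acts. Mass that never
  visits it comes from (0, \<open>(\<phi> ^^ m) s\<close>].\<close>

lemma push_iter_le:
  assumes F: "\<And>j s. j < m \<Longrightarrow> 0 \<le> s \<Longrightarrow> s \<le> 1 \<Longrightarrow>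
      (push ^^ j) F ((1 + s) / 2) - (push ^^ j) F (1/2) \<le> K j * s"
    and s: "0 \<le> s" "s \<le> 1"
  shows "(push ^^ m) F s \<le> F ((\<phi> ^^ m) s) + (\<Sum>j<m. K (m - Suc j) * (\<phi> ^^ j) s)"
  using F s
proof (induction m arbitrary: s)
  case (Suc m)
  have "(push ^^ Suc m) F s
      = (push ^^ m) F (\<phi> s) + ((push ^^ m) F ((1 + s) / 2) - (push ^^ m) F (1/2))"
    by (simp add: push_def)
  also have "\<dots> \<le> (F ((\<phi> ^^ m) (\<phi> s)) + (\<Sum>j<m. K (m - Suc j) * (\<phi> ^^ j) (\<phi> s))) + K m * s"
    using Suc.prems phi_range[of s] by (intro add_mono Suc.IH) auto
  also have "\<dots> = F ((\<phi> ^^ Suc m) s) + (\<Sum>j<Suc m. K (Suc m - Suc j) * (\<phi> ^^ j) s)"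
    by (subst sum.lessThan_Suc_shift) (simp add: funpow_swap1)
  finally show ?case .
qed simp

text \<open>The density on (1/2, 1] is at most twice the mass, and the right branch of slope 2
  halves it.\<close>

lemma concave_cdf_right_half:
  assumes F: "concave_cdf F" and "0 \<le> s" "s \<le> 1"
  shows "F ((1 + s) / 2) - F (1/2) \<le> F 1 * s"
  using concave_cdf_increment_le[OF F, of "1/2" "1/2" "(1 + s) / 2"] assms
  by (simp add: field_simps)

text \<open>Each step injects a density at most 1, and the injected parts shrink along the orbit.
  The bound is uniform in m: since the orbit is summable, no mass escapes to the neutral fixed
  point.\<close>

lemma push_iter_ident_le_tail: "(push ^^ m) (\<lambda>s. s) (orbit N) \<le> orbit_tail N"
proof -
  have "(push ^^ m) (\<lambda>s. s) (orbit N) \<le> (\<phi> ^^ m) (orbit N) + (\<Sum>j<m. 1 * (\<phi> ^^ j) (orbit N))"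
    using concave_cdf_right_half[OF concave_cdf_push_iter[OF concave_cdf_ident]]
    by (intro push_iter_le) (auto simp: push_iter_1)
  also have "\<dots> = (\<Sum>j<Suc m. orbit (N + j))"
    by (simp add: phi_iter_orbit)
  also have "\<dots> \<le> orbit_tail N"
    by (rule sum_orbit_le_tail)
  finally show ?thesis .
qed

text \<open>Of all inverse branches of the n-th iterate only the leftmost is kept; the others
  contribute a positive measure.\<close>

lemma mono_on_push_iter_minus_left:
  "mono_on {0..1} F \<Longrightarrow> mono_on {0..1} (\<lambda>s. (push ^^ n) F s - F ((\<phi> ^^ n) s))"
proof (induction n arbitrary: F)
  case 0
  then show ?case
    by (auto intro: mono_onI)
next
  case (Suc n)
  have eq: "(push ^^ Suc n) F s - F ((\<phi> ^^ Suc n) s)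
    = ((push ^^ n) (push F) s - push F ((\<phi> ^^ n) s))
      + (F ((1 + (\<phi> ^^ n) s) / 2) - F (1/2))" for s
    by (simp add: push_def funpow_swap1)
  have "mono_on {0..1} (\<lambda>s. F ((1 + (\<phi> ^^ n) s) / 2) - F (1/2))"
  proof (rule mono_onI)
    fix r s :: real
    assume "r \<in> {0..1}" "s \<in> {0..1}" "r \<le> s"
    then show "F ((1 + (\<phi> ^^ n) r) / 2) - F (1/2) \<le> F ((1 + (\<phi> ^^ n) s) / 2) - F (1/2)"
      using phi_iter_range[of r n] phi_iter_range[of s n] phi_iter_mono[of r s n]
      by (auto intro: mono_onD[OF Suc.prems])
  qed
  then show ?case
    unfolding eq by (intro mono_on_add_real Suc.IH mono_on_push Suc.prems)
qed

text \<open>If \<open>orbit_tail N < 1/2\<close>, every image of Lebesgue measure has at least half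
  of its mass outside (0, \<open>orbit N\<close>], hence by concavity a density at least 1/2 on (0,
  \<open>orbit N\<close>]. Then N left branches spread this over (0, 1] with a loss of at most the
  factor 3 ^ N, whence \<open>c\<close>.\<close>

lemma ex_lower_slope:
  "\<exists>c>0. c \<le> 1 \<and> (\<forall>n. mono_on {0..1} (\<lambda>s. (push ^^ n) (\<lambda>s. s) s - c * s))"
proof -
  have "eventually (\<lambda>N. orbit_tail N < 1/2) sequentially"
    by (rule order_tendstoD(2)[OF orbit_tail_tendsto_0]) simp
  then obtain N where N: "orbit_tail N < 1/2"
    using eventually_happens by force
  define c :: real where "c = 1 / (2 * 3 ^ N)"
  have "(1::real) \<le> 3 ^ N"
    by simp
  then have "(1::real) \<le> 2 * 3 ^ N"
    by linarith
  then have c: "0 < c" "c \<le> 1"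
    by (auto simp: c_def)
  \<comment> \<open>Of m + k steps the last k are followed along the leftmost branch only. The case
    k = n covers short times, k = N the others.\<close>
  have left: "mono_on {0..1} (\<lambda>s. (push ^^ (m + k)) (\<lambda>s. s) s - k' * s)"
    if k': "\<And>u v. 0 \<le> u \<Longrightarrow> u \<le> v \<Longrightarrow> v \<le> 1 \<Longrightarrow>
      k' * (v - u) \<le> (push ^^ m) (\<lambda>s. s) ((\<phi> ^^ k) v) - (push ^^ m) (\<lambda>s. s) ((\<phi> ^^ k) u)" for m k k'
  proof -
    have "mono_on {0..1} (\<lambda>s. (push ^^ k) ((push ^^ m) (\<lambda>s. s)) s - (push ^^ m) (\<lambda>s. s) ((\<phi> ^^ k) s))"
      by (intro mono_on_push_iter_minus_left mono_on_push_iter) (auto intro: mono_onI)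
    moreover have "mono_on {0..1} (\<lambda>s. (push ^^ m) (\<lambda>s. s) ((\<phi> ^^ k) s) - k' * s)"
    proof (rule mono_onI)
      fix r s :: real
      assume "r \<in> {0..1}" "s \<in> {0..1}" "r \<le> s"
      then show "(push ^^ m) (\<lambda>s. s) ((\<phi> ^^ k) r) - k' * r \<le> (push ^^ m) (\<lambda>s. s) ((\<phi> ^^ k) s) - k' * s"
        using k'[of r s] by (simp add: algebra_simps)
    qed
    ultimately have "mono_on {0..1} (\<lambda>s. ((push ^^ k) ((push ^^ m) (\<lambda>s. s)) s - (push ^^ m) (\<lambda>s. s) ((\<phi> ^^ k) s))
        + ((push ^^ m) (\<lambda>s. s) ((\<phi> ^^ k) s) - k' * s))"
      by (rule mono_on_add_real)
    then show ?thesis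
      by (simp add: funpow_add add.commute[of m])
  qed
  have "mono_on {0..1} (\<lambda>s. (push ^^ n) (\<lambda>s. s) s - c * s)" for n
  proof (cases "n \<le> N")
    case True
    have "c * (v - u) \<le> (\<phi> ^^ n) v - (\<phi> ^^ n) u" if "0 \<le> u" "u \<le> v" "v \<le> 1" for u v
    proof -
      have "(3::real) ^ n \<le> 2 * 3 ^ N"
        using power_increasing[OF True, of "3::real"] zero_le_power[of "3::real" N] by linarith
      then have "c \<le> 1 / 3 ^ n"
        unfolding c_def by (intro divide_left_mono) auto
      then have "c * (v - u) \<le> 1 / 3 ^ n * (v - u)"
        using that by (intro mult_right_mono) auto
      with phi_iter_expand[OF that, of n] show ?thesis
        by simp
    qed
    then show ?thesis
      using left[of c 0 n] by simp
  next
    case False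
    define m where "m = n - N"
    define F where "F = (push ^^ m) (\<lambda>s. s)"
    have F: "concave_cdf F" "F 1 = 1" "F (orbit N) \<le> 1/2"
      using push_iter_ident_le_tail[of m N] N
      by (auto simp: F_def push_iter_1 intro: concave_cdf_push_iter concave_cdf_ident)
    have "c * (v - u) \<le> F ((\<phi> ^^ N) v) - F ((\<phi> ^^ N) u)" if uv: "0 \<le> u" "u \<le> v" "v \<le> 1" for u v
    proof -
      define u' v' where "u' = (\<phi> ^^ N) u" and "v' = (\<phi> ^^ N) v"
      have uv': "0 \<le> u'" "u' \<le> v'" "v' \<le> orbit N"
        using uv phi_iter_range[of u N] phi_iter_mono[of u v N] phi_iter_mono[of v 1 N]
        by (auto simp: u'_def v'_def orbit_def)
      have "(v' - u') * (F 1 - F (orbit N)) \<le> (1 - orbit N) * (F v' - F u')"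
        using uv' order_trans[OF uv'(3) orbit_le_1] by (intro concave_on_increments concave_cdfD(2) F(1)) auto
      also have "\<dots> \<le> 1 * (F v' - F u')"
        using uv' order_trans[OF uv'(3) orbit_le_1] concave_cdf_mono[OF F(1), of u' v']
        by (intro mult_right_mono) auto
      finally have "(v' - u') * (1/2) \<le> F v' - F u'"
        using F mult_left_mono[of "1/2" "F 1 - F (orbit N)" "v' - u'"] uv' by simp
      moreover have "c * (v - u) \<le> (v' - u') * (1/2)"
        using phi_iter_expand[OF uv, of N] by (simp add: c_def u'_def v'_def field_simps)
      ultimately show ?thesis
        by (simp add: u'_def v'_def)
    qed
    then show ?thesis
      using left[of c m N] False by (simp add: F_def m_def)
  qed
  with c show ?thesis
    by blast
qed

subsection \<open>Coupling\<close>

definition lower_slope :: real where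
  "lower_slope = (SOME c. 0 < c \<and> c \<le> 1 \<and> (\<forall>n. mono_on {0..1} (\<lambda>s. (push ^^ n) (\<lambda>s. s) s - c * s)))"

lemma lower_slope:
  "0 < lower_slope" "lower_slope \<le> 1"
  "mono_on {0..1} (\<lambda>s. (push ^^ n) (\<lambda>s. s) s - lower_slope * s)"
  using someI_ex[OF ex_lower_slope] unfolding lower_slope_def by blast+

lemma mono_on_slope_le:
  fixes F :: "real \<Rightarrow> real"
  assumes F: "mono_on {0..1} (\<lambda>s. F s - k * s)" and "l \<le> k"
  shows "mono_on {0..1} (\<lambda>s. F s - l * s)"
proof (rule mono_onI)
  fix r s :: real
  assume rs: "r \<in> {0..1}" "s \<in> {0..1}" "r \<le> s"
  have "l * (s - r) \<le> k * (s - r)"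
    using rs assms by (intro mult_right_mono) auto
  then show "F r - l * r \<le> F s - l * s"
    using mono_onD[OF F rs] by (simp add: algebra_simps)
qed

lemma mono_on_cmult_real:
  fixes F :: "real \<Rightarrow> real"
  shows "0 \<le> k \<Longrightarrow> mono_on A F \<Longrightarrow> mono_on A (\<lambda>s. k * F s)"
  by (rule mono_onI, rule mult_left_mono) (auto dest: mono_onD)

(* The term (3/2) * sigma is what makes the induction close: one application of the left branch
   turns the mass on (1/2, 1] into a lower slope of the left part. *)
lemma mono_on_push_iter_lower_slope:
  assumes "concave_cdf F" "mono_on {0..1} (\<lambda>s. F s - \<sigma> * s)" "0 \<le> \<sigma>"
  shows "mono_on {0..1} (\<lambda>s. (push ^^ N) F s
    - lower_slope / 3 * (3/2 * \<sigma> + (F 1 - F (orbit N))) * s)"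
  using assms
proof (induction N arbitrary: F \<sigma>)
  case 0
  have "lower_slope / 3 * (3/2 * \<sigma>) \<le> \<sigma>"
    using lower_slope(1,2) 0(3) mult_right_mono[of lower_slope 1 \<sigma>] by simp
  from mono_on_slope_le[OF 0(2) this] show ?case
    by simp
next
  case (Suc N)
  note F = Suc.prems(1)
  define F1 F2 where "F1 = (\<lambda>s. F (\<phi> s))" and "F2 = (\<lambda>s. F ((1 + s) / 2) - F (1/2))"
  have F1: "concave_cdf F1"
    unfolding F1_def by (rule concave_cdf_left[OF F])
  \<comment> \<open>The density on (0, 1/2] is at least its mean 2 * (F 1 - F (1/2)) on (1/2, 1],
    and the left branch divides a density by at most 3.\<close>
  define \<sigma>1 where "\<sigma>1 = 2/3 * (F 1 - F (1/2))"
  have \<sigma>1: "0 \<le> \<sigma>1"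
    using concave_cdf_mono[OF F, of "1/2" 1] by (simp add: \<sigma>1_def)
  have "mono_on {0..1} (\<lambda>s. F1 s - \<sigma>1 * s)"
  proof (rule mono_onI)
    fix r s :: real
    assume rs: "r \<in> {0..1}" "s \<in> {0..1}" "r \<le> s"
    have trans: "A \<le> Z" if "Y \<le> (1 - 1/2) * Z" "X \<le> Y" "A = 2 * X" for A X Y Z :: real
      using that by simp
    have "(\<phi> s - \<phi> r) * (F 1 - F (1/2)) \<le> (1 - 1/2) * (F (\<phi> s) - F (\<phi> r))"
      using rs phi_range[of r] phi_range[of s] phi_mono[of r s]
      by (intro concave_on_increments[OF concave_cdfD(2)[OF F]]) auto
    moreover have "(s - r) / 3 * (F 1 - F (1/2)) \<le> (\<phi> s - \<phi> r) * (F 1 - F (1/2))"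
      using rs phi_expand[of r s] concave_cdf_mono[OF F, of "1/2" 1] by (intro mult_right_mono) auto
    moreover have "\<sigma>1 * (s - r) = 2 * ((s - r) / 3 * (F 1 - F (1/2)))"
      by (simp add: \<sigma>1_def)
    ultimately have "\<sigma>1 * (s - r) \<le> F1 s - F1 r"
      unfolding F1_def by (rule trans)
    then show "F1 r - \<sigma>1 * r \<le> F1 s - \<sigma>1 * s"
      by (simp add: algebra_simps)
  qed
  note left = Suc.IH[OF F1 this \<sigma>1]
  \<comment> \<open>\<open>3/2 * \<sigma>1\<close> is exactly the mass on (1/2, 1], which is what
    \<open>F1\<close> lacks.\<close>
  have "3/2 * \<sigma>1 + (F1 1 - F1 (orbit N)) = F 1 - F (orbit (Suc N))"
    by (simp add: \<sigma>1_def F1_def orbit_Suc field_simps)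
  with left have left: "mono_on {0..1} (\<lambda>s. (push ^^ N) F1 s - lower_slope / 3 * (F 1 - F (orbit (Suc N))) * s)"
    by (simp only:)
  \<comment> \<open>The right part dominates \<sigma> / 2 times Lebesgue measure, whose images keep
    the slope \<open>lower_slope\<close>. This yields the summand
    \<open>lower_slope / 3 * (3/2 * \<sigma>)\<close>.\<close>
  have "mono_on {0..1} (\<lambda>s. F2 s - \<sigma> / 2 * s)"
  proof (rule mono_onI)
    fix r s :: real
    assume rs: "r \<in> {0..1}" "s \<in> {0..1}" "r \<le> s"
    then show "F2 r - \<sigma> / 2 * r \<le> F2 s - \<sigma> / 2 * s"
      using mono_onD[OF Suc.prems(2), of "(1 + r) / 2" "(1 + s) / 2"]
      by (simp add: F2_def field_simps)
  qed
  from mono_on_push_iter[OF this, of N]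
  have "mono_on {0..1} (\<lambda>s. (push ^^ N) F2 s - \<sigma> / 2 * (push ^^ N) (\<lambda>s. s) s)"
    by (subst (asm) push_iter_diff, subst (asm) push_iter_cmult)
  moreover have "mono_on {0..1} (\<lambda>s. \<sigma> / 2 * ((push ^^ N) (\<lambda>s. s) s - lower_slope * s))"
    using Suc.prems(3) by (intro mono_on_cmult_real lower_slope(3)) auto
  ultimately have "mono_on {0..1} (\<lambda>s. ((push ^^ N) F2 s - \<sigma> / 2 * (push ^^ N) (\<lambda>s. s) s)
      + \<sigma> / 2 * ((push ^^ N) (\<lambda>s. s) s - lower_slope * s))"
    by (rule mono_on_add_real)
  then have "mono_on {0..1} (\<lambda>s. (push ^^ N) F2 s - \<sigma> / 2 * lower_slope * s)"
    by (simp add: algebra_simps)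
  from mono_on_add_real[OF left this]
  have "mono_on {0..1} (\<lambda>s. (push ^^ N) F1 s + (push ^^ N) F2 s
      - lower_slope / 3 * (3/2 * \<sigma> + (F 1 - F (orbit (Suc N)))) * s)"
    by (simp add: algebra_simps)
  moreover have "push F = (\<lambda>s. F1 s + F2 s)"
    by (simp add: push_def F1_def F2_def fun_eq_iff)
  then have "(push ^^ Suc N) F = (\<lambda>s. (push ^^ N) F1 s + (push ^^ N) F2 s)"
    by (simp only: funpow_Suc_right o_apply push_iter_add)
  ultimately show ?case
    by simp
qed

text \<open>The case \<sigma> = 0 of the preceding bound; 1/6 is 1/3 times the half of the mass that
  lies outside (0, \<open>orbit N\<close>].\<close>

lemma concave_cdf_coupling_step:
  assumes F: "concave_cdf F" and "F (orbit N) \<le> F 1 / 2"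
  shows "concave_cdf (\<lambda>s. (push ^^ N) F s - lower_slope / 6 * F 1 * s)"
proof (rule concave_cdf_minus_linear[OF concave_cdf_push_iter[OF F]])
  have "mono_on {0..1} (\<lambda>s. F s - 0 * s)"
    using F by (simp add: concave_cdf_def)
  from mono_on_push_iter_lower_slope[OF F this, of N]
  have *: "mono_on {0..1} (\<lambda>s. (push ^^ N) F s - lower_slope / 3 * (F 1 - F (orbit N)) * s)"
    by simp
  have "lower_slope / 3 * (F 1 / 2) \<le> lower_slope / 3 * (F 1 - F (orbit N))"
    using assms lower_slope(1) by (intro mult_left_mono) auto
  then show "mono_on {0..1} (\<lambda>s. (push ^^ N) F s - lower_slope / 6 * F 1 * s)"
    by (intro mono_on_slope_le[OF *]) simp
qed

text \<open>The share of the mass that stays unmatched in one round of N steps.\<close>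

definition contraction :: real where
  "contraction = 1 - lower_slope / 6"

lemma contraction: "0 < contraction" "contraction < 1"
  using lower_slope(1,2) by (auto simp: contraction_def)

(* As long as less than half of the remaining mass sits in (0, orbit N], a fixed fraction of it
   can be matched after N steps. *)
lemma coupling_aux:
  assumes F: "concave_cdf F" and G: "concave_cdf G" and FG: "F 1 = G 1"
    and tails: "\<And>j. (push ^^ j) F (orbit N) \<le> \<tau>" "\<And>j. (push ^^ j) G (orbit N) \<le> \<tau>"
  shows "\<exists>R Q. concave_cdf R \<and> concave_cdf Q \<and> R 1 = Q 1 \<and> R 1 \<le> max (2 * \<tau>) (contraction ^ t * F 1)
    \<and> (\<forall>s. (push ^^ (t * N)) F s - R s = (push ^^ (t * N)) G s - Q s)
    \<and> mono_on {0..1} (\<lambda>s. (push ^^ (t * N)) F s - R s)"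
proof (induction t)
  case 0
  show ?case
    by (rule exI[of _ F], rule exI[of _ G]) (use F G FG in \<open>auto intro: mono_onI\<close>)
next
  case (Suc t)
  then obtain R Q where R: "concave_cdf R" and Q: "concave_cdf Q" and RQ1: "R 1 = Q 1"
    and R1: "R 1 \<le> max (2 * \<tau>) (contraction ^ t * F 1)"
    and RQ: "\<And>s. (push ^^ (t * N)) F s - R s = (push ^^ (t * N)) G s - Q s"
    and m: "mono_on {0..1} (\<lambda>s. (push ^^ (t * N)) F s - R s)"
    by blast
  have pushF: "(push ^^ (Suc t * N)) F s = (push ^^ N) ((push ^^ (t * N)) F) s" for F s
    by (simp add: funpow_add)
  have eq: "(push ^^ (Suc t * N)) F s - (push ^^ N) R s = (push ^^ (Suc t * N)) G s - (push ^^ N) Q s" for s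
  proof -
    have "(push ^^ N) (\<lambda>s. (push ^^ (t * N)) F s - R s) s = (push ^^ N) (\<lambda>s. (push ^^ (t * N)) G s - Q s) s"
      by (simp only: RQ)
    then show ?thesis
      by (simp only: push_iter_diff pushF)
  qed
  have mono': "mono_on {0..1} (\<lambda>s. (push ^^ (Suc t * N)) F s - (push ^^ N) R s)"
    using mono_on_push_iter[OF m, of N] by (simp only: push_iter_diff pushF)
  show ?case
  proof (cases "R 1 \<le> 2 * \<tau>")
    \<comment> \<open>A remainder of mass at most 2 * \<tau> is only transported, not matched
      further.\<close>
    case True
    show ?thesis
      by (rule exI[of _ "(push ^^ N) R"], rule exI[of _ "(push ^^ N) Q"])
         (use True eq mono' RQ1 in \<open>simp add: concave_cdf_push_iter R Q push_iter_1\<close>)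
  next
    case False
    \<comment> \<open>The masses of \<open>R\<close> and \<open>Q\<close> agree, so the same
      multiple of Lebesgue measure is removed from both and their difference is unchanged.\<close>
    define k where "k = lower_slope / 6 * R 1"
    \<comment> \<open>The matched part is positive, so the remainder inherits the tail bound \<tau>
      from the image of \<open>F\<close>. As R 1 > 2 * \<tau>, less than half of it lies in (0,
      \<open>orbit N\<close>].\<close>
    have R_le: "R s \<le> (push ^^ (t * N)) F s" if "s \<in> {0..1}" for s
      using mono_onD[OF m, of 0 s] that concave_cdfD(1)[OF R] push_iter_0[of F "t * N"] concave_cdfD(1)[OF F]
      by auto
    have "R (orbit N) \<le> R 1 / 2"
      using R_le[of "orbit N"] tails(1)[of "t * N"] False by simp
    from concave_cdf_coupling_step[OF R this]
    have R': "concave_cdf (\<lambda>s. (push ^^ N) R s - k * s)"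
      by (simp add: k_def)
    have "Q (orbit N) \<le> Q 1 / 2"
      using R_le[of "orbit N"] RQ[of "orbit N"] tails(2)[of "t * N"] False RQ1 by simp
    from concave_cdf_coupling_step[OF Q this]
    have Q': "concave_cdf (\<lambda>s. (push ^^ N) Q s - k * s)"
      by (simp add: k_def RQ1)
    have "R 1 \<le> contraction ^ t * F 1"
      using R1 False by linarith
    then have "contraction * R 1 \<le> contraction * (contraction ^ t * F 1)"
      using contraction by (intro mult_left_mono) auto
    then have mass: "(push ^^ N) R 1 - k * 1 \<le> contraction ^ Suc t * F 1"
      by (simp add: push_iter_1 k_def contraction_def algebra_simps)
    have "k \<ge> 0"
      using concave_cdf_nonneg[OF R, of 1] lower_slope(1) by (simp add: k_def)
    then have "mono_on {0..1} (\<lambda>s. k * s)"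
      by (intro mono_on_cmult_real) (auto intro: mono_onI)
    from mono_on_add_real[OF mono' this]
    have "mono_on {0..1} (\<lambda>s. (push ^^ (Suc t * N)) F s - ((push ^^ N) R s - k * s))"
      by (simp add: algebra_simps)
    then show ?thesis
      using R' Q' mass eq RQ1
      by (intro exI[of _ "\<lambda>s. (push ^^ N) R s - k * s"] exI[of _ "\<lambda>s. (push ^^ N) Q s - k * s"])
         (simp add: push_iter_1 algebra_simps del: power_Suc)
  qed
qed

text \<open>After t rounds of N steps the remainders are transported through the remaining n - t * N
  steps, which changes neither their concavity nor their mass.\<close>

lemma coupling:
  assumes F: "concave_cdf F" and G: "concave_cdf G" and FG: "F 1 = G 1"
    and tails: "\<And>j. (push ^^ j) F (orbit N) \<le> \<tau>" "\<And>j. (push ^^ j) G (orbit N) \<le> \<tau>"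
    and n: "t * N \<le> n"
  shows "\<exists>R Q. concave_cdf R \<and> concave_cdf Q
    \<and> R 1 \<le> max (2 * \<tau>) (contraction ^ t * F 1) \<and> Q 1 \<le> max (2 * \<tau>) (contraction ^ t * F 1)
    \<and> (\<forall>s. (push ^^ n) F s - (push ^^ n) G s = R s - Q s)"
proof -
  from coupling_aux[OF F G FG tails, where t = t]
  obtain R Q where R: "concave_cdf R" and Q: "concave_cdf Q" and RQ1: "R 1 = Q 1"
    and R1: "R 1 \<le> max (2 * \<tau>) (contraction ^ t * F 1)"
    and RQ: "\<And>s. (push ^^ (t * N)) F s - R s = (push ^^ (t * N)) G s - Q s"
    by blast
  define l where "l = n - t * N"
  have pushF: "(push ^^ n) F = (push ^^ l) ((push ^^ (t * N)) F)" for F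
    using n by (simp add: l_def flip: funpow_add[THEN fun_cong, unfolded o_def])
  have "(push ^^ l) (\<lambda>s. (push ^^ (t * N)) F s - R s) s = (push ^^ l) (\<lambda>s. (push ^^ (t * N)) G s - Q s) s" for s
    by (simp only: RQ)
  then have "(push ^^ n) F s - (push ^^ n) G s = (push ^^ l) R s - (push ^^ l) Q s" for s
    unfolding push_iter_diff pushF by (simp add: algebra_simps)
  then show ?thesis
    using R1 RQ1
    by (intro exI[of _ "(push ^^ l) R"] exI[of _ "(push ^^ l) Q"])
       (simp add: concave_cdf_push_iter R Q push_iter_1)
qed

subsection \<open>Images of intervals\<close>

text \<open>The image under m steps of a density at most \<open>H\<close> on one m-cylinder. The
  bound is the one for the leftmost cylinder and serves for all of them; at s = 1 it gives the mass
  bound \<open>H * orbit m\<close>.\<close>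

definition short_cdf :: "real \<Rightarrow> nat \<Rightarrow> (real \<Rightarrow> real) \<Rightarrow> bool" where
  "short_cdf H m E \<longleftrightarrow> concave_cdf E \<and> (\<forall>s\<in>{0..1}. E s \<le> H * (\<phi> ^^ m) s)"

lemma short_cdf_left:
  assumes E: "short_cdf H m E"
  shows "short_cdf H (Suc m) (\<lambda>s. E (\<phi> s))"
proof -
  have "E (\<phi> s) \<le> H * (\<phi> ^^ Suc m) s" if "s \<in> {0..1}" for s
    using E phi_range[of s] that by (auto simp: short_cdf_def funpow_swap1)
  then show ?thesis
    using E concave_cdf_left by (auto simp: short_cdf_def)
qed

text \<open>By concavity the increment of \<open>E\<close> over (1/2, (1 + s) / 2] is at most that
  over (0, s / 2], and s / 2 \<le> \<phi> s. So the right branch obeys the bound of the left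
  one.\<close>

lemma short_cdf_right:
  assumes E: "short_cdf H m E" and H: "0 \<le> H"
  shows "short_cdf H (Suc m) (\<lambda>s. E ((1 + s) / 2) - E (1/2))"
proof -
  have cE: "concave_cdf E"
    using E by (simp add: short_cdf_def)
  have "E ((1 + s) / 2) - E (1/2) \<le> H * (\<phi> ^^ Suc m) s" if s: "s \<in> {0..1}" for s
  proof (cases "s = 0")
    case True
    then show ?thesis
      using H phi_iter_range[of 0 "Suc m"] by simp
  next
    case False
    have "s / 2 * (E ((1 + s) / 2) - E (1/2)) \<le> s / 2 * (E (s / 2) - E 0)"
      using concave_on_increments[OF concave_cdfD(2)[OF cE], of 0 "s/2" "1/2" "(1 + s) / 2"] s
      by (simp add: field_simps)
    then have "E ((1 + s) / 2) - E (1/2) \<le> E (s / 2)"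
      using False s concave_cdfD(1)[OF cE] by (simp add: mult_le_cancel_left)
    also have "\<dots> \<le> H * (\<phi> ^^ m) (s / 2)"
      using E s by (auto simp: short_cdf_def)
    also have "\<dots> \<le> H * (\<phi> ^^ m) (\<phi> s)"
      using H s half_le_phi[of s] phi_range[of s] by (intro mult_left_mono phi_iter_mono) auto
    finally show ?thesis
      by (simp add: funpow_swap1)
  qed
  then show ?thesis
    using E concave_cdf_right by (auto simp: short_cdf_def)
qed

lemma phi_max: "s \<in> {0..1} \<Longrightarrow> t \<in> {0..1} \<Longrightarrow> max (\<phi> s) (\<phi> t) = \<phi> (max s t)"
  and phi_min: "s \<in> {0..1} \<Longrightarrow> t \<in> {0..1} \<Longrightarrow> min (\<phi> s) (\<phi> t) = \<phi> (min s t)"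
  using phi_mono[of s t] phi_mono[of t s] by (auto simp: max_def min_def)

text \<open>The measure of \<open>E\<close> cut to (a, 1]. The branch domain containing the cut
  point yields a new cut piece; the other one is either covered in full, which gives
  \<open>D\<close>, or missed.\<close>

lemma push_upper_part:
  assumes E: "short_cdf H m E" and H: "0 \<le> H" and a: "a \<in> {0..1}"
  shows "\<exists>E' D. \<exists>a'\<in>{0..1}. short_cdf H (Suc m) E' \<and> concave_cdf D
    \<and> (\<forall>s\<in>{0..1}. push (\<lambda>s. E (max s a) - E a) s = (E' (max s a') - E' a') + D s)"
proof (cases "a \<le> 1/2")
  case True
  then obtain a' where a': "a' \<in> {0..1}" "\<phi> a' = a"
    using phi_onto[of a] a by auto
  have "push (\<lambda>s. E (max s a) - E a) s
      = (E (\<phi> (max s a')) - E (\<phi> a')) + (E ((1 + s) / 2) - E (1/2))" if "s \<in> {0..1}" for s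
    using that True a' phi_max[of s a'] by (simp add: push_def max_absorb1)
  moreover have "concave_cdf (\<lambda>s. E ((1 + s) / 2) - E (1/2))"
    using E by (intro concave_cdf_right) (simp add: short_cdf_def)
  ultimately show ?thesis
    using short_cdf_left[OF E] a'(1)
    by (intro exI[of _ "\<lambda>s. E (\<phi> s)"] exI[of _ "\<lambda>s. E ((1 + s) / 2) - E (1/2)"] bexI[of _ a']) auto
next
  case False
  have "push (\<lambda>s. E (max s a) - E a) s
      = ((E ((1 + max s (2 * a - 1)) / 2) - E (1/2)) - (E ((1 + (2 * a - 1)) / 2) - E (1/2))) + 0"
    if "s \<in> {0..1}" for s
    using that False phi_range[of s] by (auto simp: push_def max_def field_simps)
  then show ?thesis
    using short_cdf_right[OF E H] a False concave_cdf_zero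
    by (intro exI[of _ "\<lambda>s. E ((1 + s) / 2) - E (1/2)"] exI[of _ "\<lambda>s. 0"] bexI[of _ "2 * a - 1"]) auto
qed

text \<open>The same dichotomy for the measure of \<open>E\<close> cut to (0, b].\<close>

lemma push_lower_part:
  assumes E: "short_cdf H m E" and H: "0 \<le> H" and b: "b \<in> {0..1}"
  shows "\<exists>E' D. \<exists>b'\<in>{0..1}. short_cdf H (Suc m) E' \<and> concave_cdf D
    \<and> (\<forall>s\<in>{0..1}. push (\<lambda>s. E (min s b)) s = D s + E' (min s b'))"
proof (cases "b \<le> 1/2")
  case True
  then obtain b' where b': "b' \<in> {0..1}" "\<phi> b' = b"
    using phi_onto[of b] b by auto
  have "push (\<lambda>s. E (min s b)) s = 0 + E (\<phi> (min s b'))" if "s \<in> {0..1}" for s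
    using that True b' phi_min[of s b'] by (simp add: push_def min_absorb2)
  then show ?thesis
    using short_cdf_left[OF E] b'(1) concave_cdf_zero
    by (intro exI[of _ "\<lambda>s. E (\<phi> s)"] exI[of _ "\<lambda>s. 0"] bexI[of _ b']) auto
next
  case False
  have "push (\<lambda>s. E (min s b)) s = E (\<phi> s) + (E ((1 + min s (2 * b - 1)) / 2) - E (1/2))"
    if "s \<in> {0..1}" for s
    using that False phi_range[of s] by (auto simp: push_def min_def field_simps)
  moreover have "concave_cdf (\<lambda>s. E (\<phi> s))"
    using E by (intro concave_cdf_left) (simp add: short_cdf_def)
  ultimately show ?thesis
    using short_cdf_right[OF E H] b False
    by (intro exI[of _ "\<lambda>s. E ((1 + s) / 2) - E (1/2)"] exI[of _ "\<lambda>s. E (\<phi> s)"] bexI[of _ "2 * b - 1"]) auto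
qed

text \<open>Both ends of the interval still lie in one m-cylinder: \<open>P\<close> is the measure
  of \<open>E\<close> restricted to (a, b].\<close>

definition single_piece :: "real \<Rightarrow> nat \<Rightarrow> (real \<Rightarrow> real) \<Rightarrow> bool" where
  "single_piece H m P \<longleftrightarrow> (\<exists>E a b. short_cdf H m E \<and> 0 \<le> a \<and> a \<le> b \<and> b \<le> 1
    \<and> (\<forall>s\<in>{0..1}. P s = E (min (max s a) b) - E a))"

text \<open>The ends lie in different m-cylinders: \<open>E1\<close> and \<open>E2\<close> come from
  the cylinders of the left and the right end, \<open>D\<close> from the full cylinders in
  between.\<close>

definition split_piece :: "real \<Rightarrow> nat \<Rightarrow> (real \<Rightarrow> real) \<Rightarrow> bool" where
  "split_piece H m P \<longleftrightarrow> (\<exists>E1 E2 D. \<exists>a\<in>{0..1}. \<exists>b\<in>{0..1}.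
    short_cdf H m E1 \<and> short_cdf H m E2 \<and> concave_cdf D
    \<and> (\<forall>s\<in>{0..1}. P s = (E1 (max s a) - E1 a) + D s + E2 (min s b)))"

text \<open>The piece splits exactly when 1/2 lies strictly between its ends; at that moment no full
  cylinder has appeared yet, so \<open>D\<close> is 0.\<close>

lemma push_single_piece:
  assumes P: "single_piece H m P" and H: "0 \<le> H"
  shows "single_piece H (Suc m) (push P) \<or> split_piece H (Suc m) (push P)"
proof -
  obtain E a b where E: "short_cdf H m E" and ab: "0 \<le> a" "a \<le> b" "b \<le> 1"
    and P: "\<And>s. s \<in> {0..1} \<Longrightarrow> P s = E (min (max s a) b) - E a"
    using P unfolding single_piece_def by blast
  have pushP: "push P s = push (\<lambda>s. E (min (max s a) b) - E a) s" if "s \<in> {0..1}" for s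
    using P that by (rule push_cong)
  consider "b \<le> 1/2" | "1/2 \<le> a" | "a < 1/2" "1/2 < b"
    by linarith
  then show ?thesis
  proof cases
    case 1
    obtain a' b' where a': "a' \<in> {0..1}" "\<phi> a' = a" and b': "b' \<in> {0..1}" "\<phi> b' = b"
      using phi_onto[of a] phi_onto[of b] ab 1 by fastforce
    \<comment> \<open>The maximum gives a' \<le> B at once, and \<phi> B = max a b = b.\<close>
    define B where "B = max a' b'"
    have B: "B \<in> {0..1}" "\<phi> B = b" "a' \<le> B"
      using a' b' ab phi_max[of a' b'] by (auto simp: B_def max_def split: if_splits)
    have "push P s = E (\<phi> (min (max s a') B)) - E (\<phi> a')" if s: "s \<in> {0..1}" for s
    proof -
      have "\<phi> (min (max s a') B) = min (max (\<phi> s) a) b"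
        using phi_min[of "max s a'" B] phi_max[of s a'] s a' B by simp
      moreover have "min (max ((1 + s) / 2) a) b = b" "min (max (1/2) a) b = b"
        using s 1 ab by auto
      ultimately show ?thesis
        using pushP[OF s] a' by (simp add: push_def)
    qed
    then have "single_piece H (Suc m) (push P)"
      unfolding single_piece_def using short_cdf_left[OF E] a'(1) B
      by (intro exI[of _ "\<lambda>s. E (\<phi> s)"] exI[of _ a'] exI[of _ B]) auto
    then show ?thesis ..
  next
    case 2
    define E' where "E' = (\<lambda>s. E ((1 + s) / 2) - E (1/2))"
    have "push P s = E' (min (max s (2 * a - 1)) (2 * b - 1)) - E' (2 * a - 1)" if s: "s \<in> {0..1}" for s
      unfolding pushP[OF s] using s 2 ab phi_range[of s]
      by (auto simp: push_def E'_def min_def max_def field_simps)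
    moreover have "short_cdf H (Suc m) E'"
      unfolding E'_def by (rule short_cdf_right[OF E H])
    ultimately have "single_piece H (Suc m) (push P)"
      unfolding single_piece_def using 2 ab
      by (intro exI[of _ E'] exI[of _ "2 * a - 1"] exI[of _ "2 * b - 1"]) auto
    then show ?thesis ..
  next
    case 3
    obtain a' where a': "a' \<in> {0..1}" "\<phi> a' = a"
      using phi_onto[of a] ab 3 by auto
    define E1 E2 where "E1 = (\<lambda>s. E (\<phi> s))" and "E2 = (\<lambda>s. E ((1 + s) / 2) - E (1/2))"
    have "push P s = (E1 (max s a') - E1 a') + 0 + E2 (min s (2 * b - 1))" if s: "s \<in> {0..1}" for s
    proof -
      have 1: "\<phi> (max s a') = max (\<phi> s) a"
        using phi_max[of s a'] s a' by simp
      have 2: "min (max (\<phi> s) a) b = max (\<phi> s) a"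
        using 3 ab phi_range[of s] s by auto
      have 4: "min (max ((1 + s) / 2) a) b = (1 + min s (2 * b - 1)) / 2" "min (max (1/2) a) b = 1/2"
        using 3 s by (auto simp: min_def max_def field_simps)
      show ?thesis
        unfolding pushP[OF s] unfolding push_def E1_def E2_def by (simp only: 1 2 4 a'(2))
    qed
    moreover have "short_cdf H (Suc m) E1" "short_cdf H (Suc m) E2"
      unfolding E1_def E2_def by (rule short_cdf_left[OF E], rule short_cdf_right[OF E H])
    ultimately have "split_piece H (Suc m) (push P)"
      unfolding split_piece_def using a'(1) 3 ab concave_cdf_zero
      by (intro exI[of _ E1] exI[of _ E2] exI[of _ "\<lambda>s. 0"] bexI[of _ a'] bexI[of _ "2 * b - 1"]) auto
    then show ?thesis ..
  qed
qed

lemma push_split_piece: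
  assumes P: "split_piece H m P" and H: "0 \<le> H"
  shows "split_piece H (Suc m) (push P)"
proof -
  obtain E1 E2 D a b where ab: "a \<in> {0..1}" "b \<in> {0..1}"
    and E: "short_cdf H m E1" "short_cdf H m E2" and D: "concave_cdf D"
    and P: "\<And>s. s \<in> {0..1} \<Longrightarrow> P s = (E1 (max s a) - E1 a) + D s + E2 (min s b)"
    using P unfolding split_piece_def by blast
  obtain E1' D1 a' where 1: "a' \<in> {0..1}" "short_cdf H (Suc m) E1'" "concave_cdf D1"
    "\<And>s. s \<in> {0..1} \<Longrightarrow> push (\<lambda>s. E1 (max s a) - E1 a) s = (E1' (max s a') - E1' a') + D1 s"
    using push_upper_part[OF E(1) H ab(1)] by blast
  obtain E2' D2 b' where 2: "b' \<in> {0..1}" "short_cdf H (Suc m) E2'" "concave_cdf D2"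
    "\<And>s. s \<in> {0..1} \<Longrightarrow> push (\<lambda>s. E2 (min s b)) s = D2 s + E2' (min s b')"
    using push_lower_part[OF E(2) H ab(2)] by blast
  have "push P s = (E1' (max s a') - E1' a') + (D1 s + push D s + D2 s) + E2' (min s b')"
    if s: "s \<in> {0..1}" for s
  proof -
    have "push P s = push (\<lambda>s. (E1 (max s a) - E1 a) + D s + E2 (min s b)) s"
      using P s by (rule push_cong)
    then show ?thesis
      using 1(4)[OF s] 2(4)[OF s] by (simp add: push_add)
  qed
  moreover have "concave_cdf (\<lambda>s. D1 s + push D s + D2 s)"
    by (intro concave_cdf_add concave_cdf_push 1 2 D)
  ultimately show ?thesis
    unfolding split_piece_def using 1 2 by blast
qed

lemma push_iter_piece:
  assumes P: "single_piece H 0 P" and H: "0 \<le> H"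
  shows "single_piece H m ((push ^^ m) P) \<or> split_piece H m ((push ^^ m) P)"
proof (induction m)
  case (Suc m)
  then show ?case
    using push_single_piece[OF _ H] push_split_piece[OF _ H] by auto
qed (use P in simp)

lemma mono_on_const_real: "mono_on A (\<lambda>s. k :: real)"
  by (simp add: mono_on_def)

lemma concave_cdf_minus_max:
  assumes "concave_cdf E" "a \<in> {0..1}"
  shows "mono_on {0..1} (\<lambda>s. E s - E (max s a))"
proof (rule mono_onI)
  fix r s :: real
  assume "r \<in> {0..1}" "s \<in> {0..1}" "r \<le> s"
  then show "E r - E (max r a) \<le> E s - E (max s a)"
    using assms concave_cdf_mono[OF assms(1), of r s] concave_cdf_mono[OF assms(1), of a s]
      concave_cdf_mono[OF assms(1), of r a]
    by (auto simp: max_def min_def)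
qed

lemma concave_cdf_minus_min:
  assumes "concave_cdf E" "a \<in> {0..1}"
  shows "mono_on {0..1} (\<lambda>s. E s - E (min s a))"
proof (rule mono_onI)
  fix r s :: real
  assume "r \<in> {0..1}" "s \<in> {0..1}" "r \<le> s"
  then show "E r - E (min r a) \<le> E s - E (min s a)"
    using assms concave_cdf_mono[OF assms(1), of r s] concave_cdf_mono[OF assms(1), of a s]
      concave_cdf_mono[OF assms(1), of r a]
    by (auto simp: max_def min_def)
qed

lemma concave_cdf_max_mono:
  assumes "concave_cdf E" "a \<in> {0..1}"
  shows "mono_on {0..1} (\<lambda>s. E (max s a))"
proof (rule mono_onI)
  fix r s :: real
  assume "r \<in> {0..1}" "s \<in> {0..1}" "r \<le> s"
  then show "E (max r a) \<le> E (max s a)"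
    using assms concave_cdf_mono[OF assms(1), of r s] concave_cdf_mono[OF assms(1), of a s]
      concave_cdf_mono[OF assms(1), of r a]
    by (auto simp: max_def min_def)
qed

lemma concave_cdf_min_mono:
  assumes "concave_cdf E" "a \<in> {0..1}"
  shows "mono_on {0..1} (\<lambda>s. E (min s a))"
proof (rule mono_onI)
  fix r s :: real
  assume "r \<in> {0..1}" "s \<in> {0..1}" "r \<le> s"
  then show "E (min r a) \<le> E (min s a)"
    using assms concave_cdf_mono[OF assms(1), of r s] concave_cdf_mono[OF assms(1), of a s]
      concave_cdf_mono[OF assms(1), of r a]
    by (auto simp: max_def min_def)
qed

(* D collects the full cylinders inside the interval, E dominates the two boundary cylinders. *)
lemma push_iter_decomposition:
  assumes P: "single_piece H 0 P" and H: "0 \<le> H"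
  shows "\<exists>D E. concave_cdf D \<and> concave_cdf E
    \<and> mono_on {0..1} (\<lambda>s. (push ^^ m) P s - D s)
    \<and> mono_on {0..1} (\<lambda>s. D s + E s - (push ^^ m) P s)
    \<and> (\<forall>s\<in>{0..1}. E s \<le> 2 * H * (\<phi> ^^ m) s)"
  using push_iter_piece[OF P H, of m]
proof
  have mono_cong: "mono_on {0..1} f" if "mono_on {0..1} g" "\<And>s. s \<in> {0..1} \<Longrightarrow> f s = g s" for f g :: "real \<Rightarrow> real"
    using that by (auto simp: mono_on_def)
  {
    assume "single_piece H m ((push ^^ m) P)"
    then obtain E a b where E: "short_cdf H m E" and ab: "0 \<le> a" "a \<le> b" "b \<le> 1"
      and Pm: "\<And>s. s \<in> {0..1} \<Longrightarrow> (push ^^ m) P s = E (min (max s a) b) - E a"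
      unfolding single_piece_def by blast
    have cE: "concave_cdf E"
      using E by (simp add: short_cdf_def)
    \<comment> \<open>This rewrites the complement of (a, b] as a part below \<open>a\<close> plus a
      part above \<open>b\<close>, each of them visibly monotone.\<close>
    have clamp: "E (min (max s a) b) + E (max s b) = E (max s a) + E b" for s
      using ab by (auto simp: min_def max_def)
    have "mono_on {0..1} (\<lambda>s. E (min (max s a) b))"
      using ab by (intro mono_onI concave_cdf_mono[OF cE]) (auto simp: min_def max_def)
    then have "mono_on {0..1} (\<lambda>s. E (min (max s a) b) + (- E a))"
      by (intro mono_on_add_real mono_on_const_real)
    then have 1: "mono_on {0..1} (\<lambda>s. (push ^^ m) P s - 0)"
      by (rule mono_cong) (simp add: Pm)
    have "mono_on {0..1} (\<lambda>s. (E s - E (max s a)) + E (max s b) + (E a - E b))"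
      using ab by (intro mono_on_const_real mono_on_add_real concave_cdf_minus_max concave_cdf_max_mono cE) auto
    then have 2: "mono_on {0..1} (\<lambda>s. 0 + E s - (push ^^ m) P s)"
    proof (rule mono_cong)
      fix s :: real
      assume "s \<in> {0..1}"
      then show "0 + E s - (push ^^ m) P s = (E s - E (max s a)) + E (max s b) + (E a - E b)"
        using clamp[of s] Pm[of s] by simp
    qed
    have "E s \<le> 2 * H * (\<phi> ^^ m) s" if "s \<in> {0..1}" for s
    proof -
      have "E s \<le> H * (\<phi> ^^ m) s"
        using E that by (simp add: short_cdf_def)
      moreover have "0 \<le> H * (\<phi> ^^ m) s"
        using H that phi_iter_range[of s m] by simp
      ultimately show ?thesis
        by simp
    qed
    then show ?thesis
      using 1 2 cE concave_cdf_zero by (intro exI[of _ "\<lambda>s. 0"] exI[of _ E]) auto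
  next
    assume "split_piece H m ((push ^^ m) P)"
    then obtain E1 E2 D a b where ab: "a \<in> {0..1}" "b \<in> {0..1}"
      and E: "short_cdf H m E1" "short_cdf H m E2" and D: "concave_cdf D"
      and Pm: "\<And>s. s \<in> {0..1} \<Longrightarrow> (push ^^ m) P s = (E1 (max s a) - E1 a) + D s + E2 (min s b)"
      unfolding split_piece_def by blast
    have cE: "concave_cdf E1" "concave_cdf E2"
      using E by (auto simp: short_cdf_def)
    have "mono_on {0..1} (\<lambda>s. E1 (max s a) + E2 (min s b) + (- E1 a))"
      using ab by (intro mono_on_const_real mono_on_add_real concave_cdf_max_mono concave_cdf_min_mono cE) auto
    then have 1: "mono_on {0..1} (\<lambda>s. (push ^^ m) P s - D s)"
      by (rule mono_cong) (simp add: Pm)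
    have "mono_on {0..1} (\<lambda>s. (E1 s - E1 (max s a)) + (E2 s - E2 (min s b)) + E1 a)"
      using ab by (intro mono_on_const_real mono_on_add_real concave_cdf_minus_max concave_cdf_minus_min cE) auto
    then have 2: "mono_on {0..1} (\<lambda>s. D s + (E1 s + E2 s) - (push ^^ m) P s)"
      by (rule mono_cong) (simp add: Pm)
    have "E1 s + E2 s \<le> 2 * H * (\<phi> ^^ m) s" if "s \<in> {0..1}" for s
    proof -
      have "E1 s \<le> H * (\<phi> ^^ m) s" "E2 s \<le> H * (\<phi> ^^ m) s"
        using E that by (auto simp: short_cdf_def)
      then show ?thesis
        by simp
    qed
    then show ?thesis
      using 1 2 D concave_cdf_add[OF cE] by (intro exI[of _ D] exI[of _ "\<lambda>s. E1 s + E2 s"]) auto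
  }
qed

text \<open>An interval has no decreasing density, so the density injected at step j is estimated
  through \<open>D\<close> and \<open>E\<close> by \<open>P 1 + 2 * H * orbit j\<close>. The first
  term keeps the factor \<open>P 1\<close>; the second produces a convolution of the orbit with
  itself, which decays in m whatever the size of the interval.\<close>

lemma push_iter_piece_tail:
  assumes P: "single_piece H 0 P" and H: "0 \<le> H"
    and P0: "P 0 = 0" and PH: "\<And>s. s \<in> {0..1} \<Longrightarrow> P s \<le> H * s"
  shows "(push ^^ m) P (orbit N)
    \<le> P 1 * orbit_tail N + H * (1 + 4 * orbit_tail 0) * orbit ((m - 1) div 2)"
proof -
  define y where "y = orbit ((m - 1) div 2)"
  have "(push ^^ j) P ((1 + s) / 2) - (push ^^ j) P (1/2) \<le> (P 1 + 2 * H * orbit j) * s"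
    if s: "0 \<le> s" "s \<le> 1" for s j
  proof -
    from push_iter_decomposition[OF P H, of j]
    obtain D E where D: "concave_cdf D" and E: "concave_cdf E"
      and m1: "mono_on {0..1} (\<lambda>s. (push ^^ j) P s - D s)"
      and m2: "mono_on {0..1} (\<lambda>s. D s + E s - (push ^^ j) P s)"
      and EH: "\<And>s. s \<in> {0..1} \<Longrightarrow> E s \<le> 2 * H * (\<phi> ^^ j) s"
      by blast
    have "D 1 \<le> P 1"
      using mono_onD[OF m1, of 0 1] push_iter_0[of P j] P0 concave_cdfD(1)[OF D] by (simp add: push_iter_1)
    moreover have "E 1 \<le> 2 * H * orbit j"
      using EH[of 1] by (simp add: orbit_def)
    ultimately have "(D 1 + E 1) * s \<le> (P 1 + 2 * H * orbit j) * s"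
      using s by (intro mult_right_mono) auto
    then show ?thesis
      using mono_onD[OF m2, of "1/2" "(1 + s) / 2"] s
        concave_cdf_right_half[OF D, of s] concave_cdf_right_half[OF E, of s]
      by (simp add: algebra_simps)
  qed
  then have "(push ^^ m) P (orbit N)
      \<le> P ((\<phi> ^^ m) (orbit N)) + (\<Sum>j<m. (P 1 + 2 * H * orbit (m - Suc j)) * (\<phi> ^^ j) (orbit N))"
    by (intro push_iter_le) auto
  also have "\<dots> = P (orbit (N + m)) + P 1 * (\<Sum>j<m. orbit (N + j))
      + 2 * H * (\<Sum>j<m. orbit (m - Suc j) * orbit (N + j))"
    by (simp add: phi_iter_orbit algebra_simps sum.distrib sum_distrib_left)
  also have "\<dots> \<le> H * y + P 1 * orbit_tail N + 2 * H * (y * (2 * orbit_tail 0))"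
  proof (intro add_mono mult_left_mono)
    have "P (orbit (N + m)) \<le> H * orbit (N + m)"
      by (intro PH) simp
    also have "\<dots> \<le> H * y"
      unfolding y_def using H by (intro mult_left_mono orbit_decseq) auto
    finally show "P (orbit (N + m)) \<le> H * y" .
    show "(\<Sum>j<m. orbit (N + j)) \<le> orbit_tail N"
      by (rule sum_orbit_le_tail)
    \<comment> \<open>One of the indices m - 1 - j and N + j is at least half of m - 1. That factor
      is bounded by \<open>y\<close>, the other one is summed.\<close>
    have "orbit (m - Suc j) * orbit (N + j) \<le> y * orbit (m - Suc j) + y * orbit j" if "j < m" for j
    proof (cases "(m - 1) div 2 \<le> j")
      case True
      then have "orbit (N + j) \<le> y"
        unfolding y_def by (intro orbit_decseq) simp
      then have "orbit (m - Suc j) * orbit (N + j) \<le> orbit (m - Suc j) * y"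
        by (intro mult_left_mono) auto
      then show ?thesis
        by (simp add: y_def mult.commute add_increasing2)
    next
      case False
      then have "orbit (m - Suc j) \<le> y"
        unfolding y_def by (intro orbit_decseq) simp
      then have "orbit (m - Suc j) * orbit (N + j) \<le> y * orbit j"
        by (intro mult_mono orbit_decseq) (auto simp: y_def)
      then show ?thesis
        by (simp add: y_def add_increasing)
    qed
    then have "(\<Sum>j<m. orbit (m - Suc j) * orbit (N + j)) \<le> (\<Sum>j<m. y * orbit (m - Suc j) + y * orbit j)"
      by (intro sum_mono) auto
    also have "\<dots> = y * ((\<Sum>j<m. orbit (m - Suc j)) + (\<Sum>j<m. orbit j))"
      by (simp add: sum.distrib sum_distrib_left distrib_left)
    also have "(\<Sum>j<m. orbit (m - Suc j)) = (\<Sum>j<m. orbit j)"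
      by (rule sum.nat_diff_reindex)
    also have "y * ((\<Sum>j<m. orbit j) + (\<Sum>j<m. orbit j)) \<le> y * (2 * orbit_tail 0)"
      using sum_orbit_le_tail[of 0 m] by (intro mult_left_mono) (auto simp: y_def)
    finally show "(\<Sum>j<m. orbit (m - Suc j) * orbit (N + j)) \<le> y * (2 * orbit_tail 0)" .
    show "0 \<le> P 1"
    proof -
      obtain E a b where "short_cdf H 0 E" "0 \<le> a" "a \<le> b" "b \<le> 1" "P 1 = E (min (max 1 a) b) - E a"
        using P unfolding single_piece_def by auto
      then show ?thesis
        using concave_cdf_mono[of E a b] by (auto simp: short_cdf_def max_def min_def)
    qed
  qed (use H in auto)
  finally show ?thesis
    by (simp add: y_def algebra_simps)
qed

subsection \<open>Decay of correlations\<close>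

text \<open>The index arises from two halvings: n steps are halved into regularisation and coupling,
  and the convolution estimate halves the first part again.\<close>

lemma summable_orbit_quarter: "summable (\<lambda>n. orbit ((n div 2 - 1) div 2))"
proof (rule summable_comparison_test_ev)
  have C: "0 \<le> C"
    using orbit_decay[of 1] orbit_nonneg[of 1] by (simp add: orbit_def)
  show "eventually (\<lambda>n. norm (orbit ((n div 2 - 1) div 2)) \<le> C * 8 powr p * real n powr -p) sequentially"
    using eventually_ge_at_top[of "16::nat"]
  proof eventually_elim
    case (elim n)
    define m where "m = (n div 2 - 1) div 2"
    have m: "1 \<le> m" "n \<le> 8 * m"
      using elim unfolding m_def by presburger+
    have "orbit m \<le> C * real m powr -p"
      using orbit_decay[OF m(1)] by (simp add: orbit_def)
    also have "real m powr -p \<le> (real n / 8) powr -p"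
      using m elim p_gt_1 by (intro powr_mono2') auto
    also have "(real n / 8) powr -p = 8 powr p * real n powr -p"
      by (simp add: powr_divide powr_minus field_simps)
    finally show ?case
      using C by (simp add: m_def mult.assoc mult_left_mono)
  qed
  show "summable (\<lambda>n. C * 8 powr p * real n powr -p)"
    using p_gt_1 by (intro summable_mult) (simp add: summable_real_powr_iff)
qed

text \<open>The n - n div 2 steps left for coupling hold N rounds of N steps each, so that both
  \<open>orbit_tail N\<close> and \<open>contraction ^ N\<close> become small. The number 9/4 in the
  proof is a square above 2.\<close>

lemma floor_sqrt_half:
  assumes n: "1 \<le> n" and N: "N = nat \<lfloor>sqrt (real (n - n div 2))\<rfloor>"
  shows "N * N \<le> n - n div 2" "1 \<le> N" "sqrt (real n) / 3 \<le> real N"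
proof -
  define l where "l = n - n div 2"
  have l: "1 \<le> l" "n \<le> 2 * l"
    using n unfolding l_def by presburger+
  have s1: "1 \<le> sqrt (real l)"
    using l by simp
  have N': "real N = of_int \<lfloor>sqrt (real l)\<rfloor>"
    using s1 by (simp add: N l_def)
  then have "real N \<le> sqrt (real l)"
    by simp
  then have "real N * real N \<le> sqrt (real l) * sqrt (real l)"
    by (intro mult_mono) auto
  then have "real (N * N) \<le> real l"
    by simp
  then show "N * N \<le> n - n div 2"
    by (simp only: of_nat_le_iff l_def)
  show "1 \<le> N"
    using s1 by (simp add: N l_def le_nat_iff le_floor_iff)
  have "sqrt (real l) / 2 \<le> real N"
    using s1 N' \<open>1 \<le> N\<close> by linarith
  moreover have "sqrt (real n) / 3 \<le> sqrt (real l) / 2"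
  proof -
    have "sqrt (real n) \<le> sqrt (9/4 * real l)"
      using l by (intro real_sqrt_le_mono) simp
    also have "\<dots> = 3 / 2 * sqrt (real l)"
    proof -
      have "sqrt (9/4) = (3/2 :: real)"
        by (rule real_sqrt_unique) (auto simp: power2_eq_square)
      then show ?thesis
        by (simp only: real_sqrt_mult)
    qed
    finally show ?thesis
      by simp
  qed
  ultimately show "sqrt (real n) / 3 \<le> real N"
    by linarith
qed

text \<open>N copies of the smallest term are at most the geometric sum. The decay is weakened to a
  power so that it can be merged with that of the orbit tails.\<close>

lemma power_le_inverse:
  fixes q :: real
  assumes q: "0 < q" "q < 1" and N: "1 \<le> N"
  shows "q ^ N \<le> 1 / (1 - q) * real N powr -1"
proof -
  have "real N * q ^ N = (\<Sum>j<N. q ^ N)"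
    by simp
  also have "\<dots> \<le> (\<Sum>j<N. q ^ j)"
    using q by (intro sum_mono power_decreasing) auto
  also have "\<dots> = (1 - q ^ N) / (1 - q)"
    using q by (simp add: sum_gp_strict)
  also have "\<dots> \<le> 1 / (1 - q)"
    using q by (intro divide_right_mono) auto
  finally have "real N * q ^ N / real N \<le> 1 / (1 - q) / real N"
    by (rule divide_right_mono) simp
  then show ?thesis
    using N by (simp add: powr_minus_divide mult.commute)
qed

text \<open>The exponent \<open>r\<close> is capped at 1 to absorb the bound N powr -1 for the
  geometric part, and halved because N is of order sqrt n.\<close>

lemma mixing_rate:
  "\<exists>K \<kappa>. 0 \<le> K \<and> 0 < \<kappa> \<and> \<kappa> \<le> 1 \<and>
    (\<forall>n\<ge>1. \<forall>N. N = nat \<lfloor>sqrt (real (n - n div 2))\<rfloor> \<longrightarrow>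
      2 * orbit_tail N + contraction ^ N \<le> K * real n powr -\<kappa>)"
proof -
  obtain K0 where K0: "0 \<le> K0" "\<And>N. 1 \<le> N \<Longrightarrow> orbit_tail N \<le> K0 * real N powr - ((p - 1) / 2)"
    using orbit_tail_bound by blast
  define r where "r = min 1 ((p - 1) / 2)"
  define K1 where "K1 = 2 * K0 + 1 / (1 - contraction)"
  have r: "0 < r" "r \<le> 1"
    using p_gt_1 by (auto simp: r_def)
  have r_le: "r \<le> (p - 1) / 2"
    unfolding r_def by (rule min.cobounded2)
  have K1: "0 \<le> K1"
    using K0 contraction by (simp add: K1_def)
  have "2 * orbit_tail N + contraction ^ N \<le> K1 * 3 powr r * real n powr - (r / 2)"
    if n: "1 \<le> n" and N: "N = nat \<lfloor>sqrt (real (n - n div 2))\<rfloor>" for n N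
  proof -
    note N' = floor_sqrt_half[OF n N]
    have "orbit_tail N \<le> K0 * real N powr - ((p - 1) / 2)"
      using K0 N' by simp
    also have "\<dots> \<le> K0 * real N powr - r"
      using K0 N' r_le by (intro mult_left_mono powr_mono) auto
    finally have 1: "orbit_tail N \<le> K0 * real N powr - r" .
    have "contraction ^ N \<le> 1 / (1 - contraction) * real N powr -1"
      using contraction N' by (intro power_le_inverse)
    also have "\<dots> \<le> 1 / (1 - contraction) * real N powr - r"
      using contraction N' r by (intro mult_left_mono powr_mono) auto
    finally have "2 * orbit_tail N + contraction ^ N \<le> K1 * real N powr - r"
      using 1 by (simp add: K1_def algebra_simps)
    also have "\<dots> \<le> K1 * (sqrt (real n) / 3) powr - r"
      using K1 N' r n by (intro mult_left_mono powr_mono2') auto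
    also have "(sqrt (real n) / 3) powr - r = 3 powr r * real n powr - (r / 2)"
      using n by (simp add: powr_divide powr_minus powr_powr field_simps flip: powr_half_sqrt)
    finally show ?thesis
      by (simp add: mult.assoc)
  qed
  then show ?thesis
    using K1 r by (intro exI[of _ "K1 * 3 powr r"] exI[of _ "r / 2"]) auto
qed

text \<open>The left side is the measure of the points of (a, b] that are in (u, v] after n steps.
  The first half of the time turns the restricted measure into a decreasing density \<open>D\<close>
  plus a small error, the second half couples \<open>D\<close> with the invariant measure scaled to
  the mass of \<open>D\<close>.\<close>

lemma correlation_bound:
  assumes G: "concave_cdf G" and G1: "G 1 = 1"
    and inv: "\<And>s. s \<in> {0..1} \<Longrightarrow> push G s = G s"
    and slope: "mono_on {0..1} (\<lambda>s. G s - lower_slope * s)"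
    and tail: "\<And>N. G (orbit N) \<le> orbit_tail N"
    and d: "0 < d" "d < 1"
  shows "\<exists>K \<kappa> y. 0 \<le> K \<and> 0 < \<kappa> \<and> \<kappa> \<le> 1 \<and> summable y \<and> (\<forall>n. 0 \<le> y n) \<and>
    (\<forall>a b u v n. d \<le> a \<longrightarrow> a \<le> b \<longrightarrow> b \<le> 1 \<longrightarrow> d \<le> u \<longrightarrow> u \<le> v \<longrightarrow> v \<le> 1 \<longrightarrow> 1 \<le> n \<longrightarrow>
      (push ^^ n) (\<lambda>s. G (min (max s a) b) - G a) v - (push ^^ n) (\<lambda>s. G (min (max s a) b) - G a) u
      \<le> (G v - G u) * ((G b - G a) + K * (G b - G a) * real n powr -\<kappa> + y n))"
proof -
  obtain K \<kappa> where K: "0 \<le> K" "0 < \<kappa>" "\<kappa> \<le> 1"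
    and rate: "\<And>n N. 1 \<le> n \<Longrightarrow> N = nat \<lfloor>sqrt (real (n - n div 2))\<rfloor> \<Longrightarrow>
      2 * orbit_tail N + contraction ^ N \<le> K * real n powr -\<kappa>"
    using mixing_rate by blast
  \<comment> \<open>The chord slope at \<open>d\<close>, which bounds the density of
    \<open>G\<close> on [d, 1].\<close>
  define H where "H = G d / d"
  have H: "0 \<le> H"
    using concave_cdf_nonneg[OF G, of d] d by (simp add: H_def)
  define C1 where "C1 = H * (1 + 4 * orbit_tail 0)"
  have C1: "0 \<le> C1"
    using H orbit_tail_nonneg by (simp add: C1_def)
  \<comment> \<open>The density of \<open>G\<close> need not be bounded near 0, whereas an initial
    piece needs E s \<le> H * s. Capping changes nothing on [d, 1], and the interval sees only that
    part.\<close>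
  define W where "W = (\<lambda>s. min (H * s) (G s))"
  have W: "concave_cdf W"
    unfolding W_def by (intro concave_cdf_min concave_cdf_cmult concave_cdf_ident G H)
  have WG: "W x = G x" if "d \<le> x" "x \<le> 1" for x
    using concave_on_chord[OF concave_cdfD(2)[OF G], of 0 d x] concave_cdfD(1)[OF G] that d
    by (simp add: W_def H_def field_simps min_def)
  have WH: "W s \<le> H * s" for s
    by (simp add: W_def)
  define c where "c = lower_slope * d"
  have c: "0 < c"
    using lower_slope(1) d by (simp add: c_def)
  define y where "y n = (2 * C1 + 2 * H) / c * orbit ((n div 2 - 1) div 2)" for n
  have invn: "(push ^^ j) G s = G s" if "s \<in> {0..1}" for j s
    using that
  proof (induction j arbitrary: s)
    case (Suc j)
    then show ?case
      using push_cong[of "(push ^^ j) G" G s] inv[of s] by simp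
  qed simp
  have "(push ^^ n) (\<lambda>s. G (min (max s a) b) - G a) v - (push ^^ n) (\<lambda>s. G (min (max s a) b) - G a) u
      \<le> (G v - G u) * ((G b - G a) + K / c * (G b - G a) * real n powr -\<kappa> + y n)"
    if ab: "d \<le> a" "a \<le> b" "b \<le> 1" and uv: "d \<le> u" "u \<le> v" "v \<le> 1" and n: "1 \<le> n" for a b u v n
  proof -
    define P where "P = (\<lambda>s. G (min (max s a) b) - G a)"
    define \<beta> where "\<beta> = G b - G a"
    have \<beta>: "0 \<le> \<beta>" "P 1 = \<beta>" "P 0 = 0"
      using concave_cdf_mono[OF G, of a b] ab d by (auto simp: \<beta>_def P_def)
    have PW: "P s = W (min (max s a) b) - W a" for s
      using ab WG[of "min (max s a) b"] WG[of a] by (simp add: P_def)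
    have P: "single_piece H 0 P"
      unfolding single_piece_def short_cdf_def using W WH ab d PW
      by (intro exI[of _ W] exI[of _ a] exI[of _ b]) auto
    have PH: "P s \<le> H * s" if s: "s \<in> {0..1}" for s
    proof (cases "s \<le> a")
      case True
      then show ?thesis
        using H s ab by (simp add: P_def)
    next
      case False
      then have "W (min (max s a) b) \<le> W s"
        using s ab d by (intro concave_cdf_mono[OF W]) auto
      moreover have "0 \<le> W a"
        using ab d by (intro concave_cdf_nonneg[OF W]) auto
      ultimately show ?thesis
        using PW[of s] WH[of s] by simp
    qed
    define k l where "k = n div 2" and "l = n - k"
    have kl: "l + k = n"
      by (simp add: k_def l_def)
    define N where "N = nat \<lfloor>sqrt (real (n - n div 2))\<rfloor>"
    note N' = floor_sqrt_half[OF n N_def]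
    define z where "z = orbit ((k - 1) div 2)"
    \<comment> \<open>A bound, at all later times, for the mass that \<open>D\<close> and
      \<open>M * G\<close> put on (0, \<open>orbit N\<close>]. The term with \<beta> joins the
      coupling rate, the other one the summable error.\<close>
    define \<tau> where "\<tau> = \<beta> * orbit_tail N + C1 * z"
    have z: "0 \<le> z"
      by (simp add: z_def)
    obtain D E where D: "concave_cdf D" and E: "concave_cdf E"
      and m1: "mono_on {0..1} (\<lambda>s. (push ^^ k) P s - D s)"
      and m2: "mono_on {0..1} (\<lambda>s. D s + E s - (push ^^ k) P s)"
      and EH: "\<And>s. s \<in> {0..1} \<Longrightarrow> E s \<le> 2 * H * (\<phi> ^^ k) s"
      using push_iter_decomposition[OF P H, of k] by blast
    define M where "M = D 1"
    have M: "0 \<le> M" "M \<le> \<beta>"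
      using concave_cdf_nonneg[OF D, of 1] mono_onD[OF m1, of 0 1] push_iter_0[of P k] \<beta>
        concave_cdfD(1)[OF D] by (auto simp: M_def push_iter_1)
    have "E 1 \<le> 2 * H * orbit k"
      using EH[of 1] by (simp add: orbit_def)
    also have "\<dots> \<le> 2 * H * z"
      unfolding z_def using H by (intro mult_left_mono orbit_decseq) auto
    finally have E1: "E 1 \<le> 2 * H * z" .
    \<comment> \<open>The images of \<open>D\<close> are dominated by those of \<open>P\<close>,
      whose tail estimate at time j + k improves with j.\<close>
    have tailD: "(push ^^ j) D (orbit N) \<le> \<tau>" for j
    proof -
      have "mono_on {0..1} (\<lambda>s. (push ^^ j) ((push ^^ k) P) s - (push ^^ j) D s)"
        using mono_on_push_iter[OF m1, of j] by (simp add: push_iter_diff)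
      from mono_onD[OF this, of 0 "orbit N"]
      have "(push ^^ j) D (orbit N) \<le> (push ^^ (j + k)) P (orbit N)"
        using push_iter_0[of P "j + k"] push_iter_0[of D j] \<beta> concave_cdfD(1)[OF D]
        by (simp add: funpow_add)
      also have "\<dots> \<le> \<beta> * orbit_tail N + C1 * orbit ((j + k - 1) div 2)"
        using push_iter_piece_tail[OF P H \<beta>(3) PH, of "j + k" N] by (simp add: C1_def \<beta>)
      also have "\<dots> \<le> \<tau>"
        unfolding \<tau>_def z_def using C1 by (intro add_left_mono mult_left_mono orbit_decseq div_le_mono) auto
      finally show ?thesis .
    qed
    have tailG: "(push ^^ j) (\<lambda>s. M * G s) (orbit N) \<le> \<tau>" for j
    proof -
      have "(push ^^ j) (\<lambda>s. M * G s) (orbit N) = M * G (orbit N)"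
        by (simp add: push_iter_cmult invn)
      also have "\<dots> \<le> \<beta> * orbit_tail N"
        using M tail[of N] concave_cdf_nonneg[OF G, of "orbit N"] by (intro mult_mono) auto
      also have "\<dots> \<le> \<tau>"
        using C1 z by (simp add: \<tau>_def)
      finally show ?thesis .
    qed
    have "\<exists>R Q. concave_cdf R \<and> concave_cdf Q
      \<and> R 1 \<le> max (2 * \<tau>) (contraction ^ N * D 1) \<and> Q 1 \<le> max (2 * \<tau>) (contraction ^ N * D 1)
      \<and> (\<forall>s. (push ^^ l) D s - (push ^^ l) (\<lambda>s. M * G s) s = R s - Q s)"
      using D concave_cdf_cmult[OF G M(1)] tailD tailG N' by (intro coupling) (auto simp: M_def G1 l_def k_def)
    then obtain R Q where R: "concave_cdf R" and Q: "concave_cdf Q"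
      and R1: "R 1 \<le> max (2 * \<tau>) (contraction ^ N * M)"
      and RQ: "\<And>s. (push ^^ l) D s - (push ^^ l) (\<lambda>s. M * G s) s = R s - Q s"
      unfolding M_def by blast
    have "contraction ^ N * M \<le> contraction ^ N * \<beta>"
      using M contraction by (intro mult_left_mono) auto
    moreover have "0 \<le> \<tau>" "0 \<le> contraction ^ N * \<beta>"
      using \<beta> C1 z orbit_tail_nonneg contraction by (auto simp: \<tau>_def)
    ultimately have R1': "R 1 \<le> 2 * \<tau> + contraction ^ N * \<beta>"
      using R1 by linarith
    define E' where "E' = (push ^^ l) E"
    have E': "concave_cdf E'" "E' 1 = E 1"
      unfolding E'_def by (auto simp: push_iter_1 intro: concave_cdf_push_iter E)
    have "mono_on {0..1} (\<lambda>s. (push ^^ l) D s + E' s - (push ^^ n) P s)"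
      using mono_on_push_iter[OF m2, of l] funpow_add[of l k push]
      by (simp add: push_iter_diff push_iter_add E'_def kl)
    from mono_onD[OF this, of u v]
    have "(push ^^ n) P v - (push ^^ n) P u
        \<le> ((push ^^ l) D v - (push ^^ l) D u) + (E' v - E' u)"
      using uv d by simp
    also have "(push ^^ l) D v - (push ^^ l) D u = M * (G v - G u) + (R v - R u) - (Q v - Q u)"
      using RQ[of u] RQ[of v] uv d by (simp add: push_iter_cmult invn algebra_simps)
    also have "M * (G v - G u) + (R v - R u) - (Q v - Q u) + (E' v - E' u)
        \<le> \<beta> * (G v - G u) + (v - u) / d * R 1 - 0 + (v - u) / d * E' 1"
    proof (intro add_mono diff_mono)
      show "M * (G v - G u) \<le> \<beta> * (G v - G u)"
        using M concave_cdf_mono[OF G, of u v] uv d by (intro mult_right_mono) auto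
      \<comment> \<open>Only an upper bound for the covariance is wanted, so the remainder on the
        side of the invariant measure is dropped.\<close>
      show "0 \<le> Q v - Q u"
        using concave_cdf_mono[OF Q, of u v] uv d by simp
      show "R v - R u \<le> (v - u) / d * R 1"
        using uv d by (intro concave_cdf_increment_le R) auto
      show "E' v - E' u \<le> (v - u) / d * E' 1"
        using uv d by (intro concave_cdf_increment_le E') auto
    qed
    also have "\<dots> = \<beta> * (G v - G u) + (v - u) / d * (R 1 + E 1)"
      by (simp add: E' distrib_left)
    \<comment> \<open>The lower slope of \<open>G\<close> converts the length v - u into G v - G u,
      so that the errors become proportional to the measure of the later interval.\<close>
    also have "(v - u) / d * (R 1 + E 1) \<le> (G v - G u) / c * (2 * \<tau> + contraction ^ N * \<beta> + 2 * H * z)"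
    proof (intro mult_mono)
      have "lower_slope * (v - u) \<le> G v - G u"
        using mono_onD[OF slope, of u v] uv d by (simp add: algebra_simps)
      then have "lower_slope * (v - u) / c \<le> (G v - G u) / c"
        using c by (intro divide_right_mono) auto
      moreover have "lower_slope * (v - u) / c = (v - u) / d"
        using lower_slope(1) by (simp add: c_def)
      ultimately show "(v - u) / d \<le> (G v - G u) / c"
        by simp
      show "R 1 + E 1 \<le> 2 * \<tau> + contraction ^ N * \<beta> + 2 * H * z"
        using R1' E1 by simp
      show "0 \<le> (G v - G u) / c"
        using concave_cdf_mono[OF G, of u v] uv d c by simp
      show "0 \<le> R 1 + E 1"
        using concave_cdf_nonneg[OF R, of 1] concave_cdf_nonneg[OF E, of 1] by simp
    qed
    also have "2 * \<tau> + contraction ^ N * \<beta> + 2 * H * z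
        = \<beta> * (2 * orbit_tail N + contraction ^ N) + (2 * C1 + 2 * H) * z"
      by (simp add: \<tau>_def algebra_simps)
    also have "(G v - G u) / c * \<dots> \<le> (G v - G u) / c * (\<beta> * (K * real n powr -\<kappa>) + (2 * C1 + 2 * H) * z)"
      using rate[OF n N_def] \<beta> c concave_cdf_mono[OF G, of u v] uv d
      by (intro mult_left_mono add_right_mono) auto
    also have "\<beta> * (G v - G u) + \<dots> = (G v - G u) * (\<beta> + K / c * \<beta> * real n powr -\<kappa> + y n)"
      using c by (simp add: y_def z_def k_def field_simps)
    finally show ?thesis
      by (simp add: P_def \<beta>_def)
  qed
  moreover have "summable y" "\<And>n. 0 \<le> y n"
    using H C1 c summable_orbit_quarter by (auto simp: y_def[abs_def] intro!: summable_mult)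
  ultimately show ?thesis
    using K c by (intro exI[of _ "K / c"] exI[of _ \<kappa>] exI[of _ y]) auto
qed

section \<open>Loss of memory for Lebesgue measure on initial intervals\<close>

lemma push_iter_cong:
  "(\<And>s. s \<in> {0..1} \<Longrightarrow> F s = G s) \<Longrightarrow> s \<in> {0..1} \<Longrightarrow> (push ^^ n) F s = (push ^^ n) G s"
proof (induction n arbitrary: s)
  case (Suc n)
  then show ?case
    by (auto intro!: push_cong)
qed simp

text \<open>\<open>min s b\<close> belongs to Lebesgue measure on (0, b], a decreasing density, and
  is coupled with \<open>b\<close> times Lebesgue measure. First N is taken large for the tails,
  then t for the number of rounds.\<close>

lemma push_iter_min_limit:
  assumes b: "0 \<le> b" "b \<le> 1" and s: "s \<in> {0..1}"
  shows "(\<lambda>n. (push ^^ n) (\<lambda>s. min s b) s - b * (push ^^ n) (\<lambda>s. s) s) \<longlonglongrightarrow> 0"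
proof (rule LIMSEQ_I)
  fix e :: real
  assume e: "0 < e"
  define F where "F = (\<lambda>s::real. min s b)"
  have "concave_cdf (\<lambda>s. min (1 * s) b)"
  proof -
    have "mono_on {0..1} (\<lambda>s. min s b)"
      by (rule mono_onI) auto
    moreover have "concave_on {0..1} (\<lambda>s. min s b)"
    proof
      fix t x y :: real
      assume t: "t > 0" "t < 1" "x \<in> {0..1}" "y \<in> {0..1}"
      have "(1 - t) * min x b + t * min y b \<le> (1 - t) * x + t * y"
        using t by (intro add_mono mult_left_mono) auto
      moreover have "(1 - t) * min x b + t * min y b \<le> (1 - t) * b + t * b"
        using t by (intro add_mono mult_left_mono) auto
      ultimately show "(1 - t) * min x b + t * min y b \<le> min ((1 - t) *\<^sub>R x + t *\<^sub>R y) b"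
        by (simp add: algebra_simps)
    qed simp
    ultimately show ?thesis
      using b by (simp add: concave_cdf_def)
  qed
  then have F: "concave_cdf F"
    by (simp add: F_def)
  have G: "concave_cdf (\<lambda>s. b * s)"
    by (intro concave_cdf_cmult concave_cdf_ident b)
  obtain N where N: "orbit_tail N < e / 2"
    using eventually_happens[OF order_tendstoD(2)[OF orbit_tail_tendsto_0, of "e / 2"]] e by auto
  have "(\<lambda>t. contraction ^ t) \<longlonglongrightarrow> 0"
    using contraction by (intro LIMSEQ_power_zero) auto
  from eventually_happens[OF order_tendstoD(2)[OF this e]]
  obtain t where t: "contraction ^ t < e"
    by auto
  have "mono_on {0..1} (\<lambda>s. s - F s)"
    by (rule mono_onI) (auto simp: F_def)
  then have m: "mono_on {0..1} (\<lambda>s. (push ^^ j) (\<lambda>s. s) s - (push ^^ j) F s)" for j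
    using mono_on_push_iter[of "\<lambda>s. s - F s" j] by (simp add: push_iter_diff)
  have "(push ^^ j) F (orbit N) \<le> (push ^^ j) (\<lambda>s. s) (orbit N)" for j
    using mono_onD[OF m[of j], of 0 "orbit N"] push_iter_0[of "\<lambda>s. s" j] push_iter_0[of F j] concave_cdfD(1)[OF F] by simp
  then have tailF: "(push ^^ j) F (orbit N) \<le> orbit_tail N" for j
    using push_iter_ident_le_tail[of j N] order_trans by blast
  have tailG: "(push ^^ j) (\<lambda>s. b * s) (orbit N) \<le> orbit_tail N" for j
  proof -
    have "b * (push ^^ j) (\<lambda>s. s) (orbit N) \<le> 1 * orbit_tail N"
      using b push_iter_ident_le_tail[of j N] orbit_tail_nonneg
        concave_cdf_nonneg[OF concave_cdf_push_iter[OF concave_cdf_ident, of j], of "orbit N"]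
      by (intro mult_mono) auto
    then show ?thesis
      by (simp add: push_iter_cmult)
  qed
  have "norm ((push ^^ n) F s - b * (push ^^ n) (\<lambda>s. s) s - 0) < e" if n: "t * N \<le> n" for n
  proof -
    have "F 1 = b * 1"
      using b by (simp add: F_def)
    from coupling[OF F G this tailF tailG n]
    obtain R Q where RQ: "concave_cdf R" "concave_cdf Q"
      "R 1 \<le> max (2 * orbit_tail N) (contraction ^ t * F 1)"
      "Q 1 \<le> max (2 * orbit_tail N) (contraction ^ t * F 1)"
      and eq: "(push ^^ n) F s - (push ^^ n) (\<lambda>s. b * s) s = R s - Q s"
      by blast
    have "contraction ^ t * F 1 \<le> contraction ^ t * 1"
      using b contraction by (intro mult_left_mono) (auto simp: F_def)
    then have "R 1 < e" "Q 1 < e"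
      using RQ(3,4) N t by auto
    moreover have "0 \<le> R s" "R s \<le> R 1" "0 \<le> Q s" "Q s \<le> Q 1"
      using s RQ(1,2) by (auto intro: concave_cdf_nonneg concave_cdf_mono)
    ultimately show ?thesis
      using eq by (simp add: push_iter_cmult)
  qed
  then show "\<exists>no. \<forall>n\<ge>no. norm ((push ^^ n) (\<lambda>s. min s b) s - b * (push ^^ n) (\<lambda>s. s) s - 0) < e"
    unfolding F_def by blast
qed

end

subsection \<open>A strong law from covariance bounds\<close>

lemma sum_sum_symmetric:
  fixes f :: "nat \<Rightarrow> nat \<Rightarrow> real"
  assumes sym: "\<And>i j. f i j = f j i"
  shows "(\<Sum>i=1..n. \<Sum>j=1..n. f i j) = (\<Sum>j=1..n. f j j + 2 * (\<Sum>i\<in>{1..<j}. f i j))"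
proof (induction n)
  case (Suc n)
  have "(\<Sum>i=1..Suc n. \<Sum>j=1..Suc n. f i j)
      = (\<Sum>i=1..n. \<Sum>j=1..n. f i j) + (\<Sum>i=1..n. f i (Suc n)) + (\<Sum>j=1..n. f (Suc n) j) + f (Suc n) (Suc n)"
    by (simp add: sum.distrib)
  also have "(\<Sum>j=1..n. f (Suc n) j) = (\<Sum>i=1..n. f i (Suc n))"
    by (subst sym) simp
  finally show ?case
    using Suc by (simp add: atLeastLessThanSuc_atLeastAtMost)
qed simp

lemma (in prob_space) second_moment_hits:
  assumes A: "\<And>k. A k \<in> events"
  defines "b \<equiv> \<lambda>k. prob (A k)"
  shows "integrable M (\<lambda>x. ((\<Sum>k=1..n. indicator (A k) x) - (\<Sum>k=1..n. b k))\<^sup>2 :: real)"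
    and "expectation (\<lambda>x. ((\<Sum>k=1..n. indicator (A k) x) - (\<Sum>k=1..n. b k))\<^sup>2)
      = (\<Sum>i=1..n. \<Sum>j=1..n. prob (A i \<inter> A j) - b i * b j)"
proof -
  define E where "E = (\<Sum>k=1..n. b k)"
  define I where "I k x = (indicator (A k) x :: real)" for k x
  have eq: "((\<Sum>k=1..n. I k x) - E)\<^sup>2
      = (\<Sum>i=1..n. \<Sum>j=1..n. indicator (A i \<inter> A j) x) - 2 * E * (\<Sum>k=1..n. I k x) + E\<^sup>2" for x
    by (simp add: power2_diff power2_eq_square sum_product I_def indicator_inter_arith algebra_simps)
  have "has_bochner_integral M (\<lambda>x. ((\<Sum>k=1..n. I k x) - E)\<^sup>2)
      ((\<Sum>i=1..n. \<Sum>j=1..n. prob (A i \<inter> A j)) - 2 * E * (\<Sum>k=1..n. b k) + E\<^sup>2 * prob (space M))"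
    unfolding eq
  proof (intro has_bochner_integral_add has_bochner_integral_diff has_bochner_integral_sum
      has_bochner_integral_mult_right)
    show "has_bochner_integral M (\<lambda>x. indicator (A i \<inter> A j) x :: real) (prob (A i \<inter> A j))" for i j
      using A by (intro has_bochner_integral_real_indicator) (auto simp: emeasure_eq_measure)
    show "has_bochner_integral M (I k) (b k)" for k
      unfolding I_def[abs_def] b_def
      using A by (intro has_bochner_integral_real_indicator) (auto simp: emeasure_eq_measure)
    show "has_bochner_integral M (\<lambda>x. E\<^sup>2) (E\<^sup>2 * prob (space M))"
      using has_bochner_integral_integrable[of M "\<lambda>x. E\<^sup>2"] by (simp add: prob_space mult.commute)
  qed
  moreover have "(\<Sum>i=1..n. \<Sum>j=1..n. prob (A i \<inter> A j)) - 2 * E * (\<Sum>k=1..n. b k) + E\<^sup>2 * prob (space M)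
      = (\<Sum>i=1..n. \<Sum>j=1..n. prob (A i \<inter> A j) - b i * b j)"
    by (simp add: E_def[symmetric] prob_space sum_subtractf sum_product[symmetric] power2_eq_square)
  ultimately have *: "has_bochner_integral M (\<lambda>x. ((\<Sum>k=1..n. I k x) - E)\<^sup>2)
      (\<Sum>i=1..n. \<Sum>j=1..n. prob (A i \<inter> A j) - b i * b j)"
    by simp
  show "integrable M (\<lambda>x. ((\<Sum>k=1..n. indicator (A k) x) - (\<Sum>k=1..n. b k))\<^sup>2 :: real)"
    using * by (simp add: I_def E_def has_bochner_integral_iff)
  show "expectation (\<lambda>x. ((\<Sum>k=1..n. indicator (A k) x) - (\<Sum>k=1..n. b k))\<^sup>2)
      = (\<Sum>i=1..n. \<Sum>j=1..n. prob (A i \<inter> A j) - b i * b j)"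
    using * by (simp add: I_def E_def has_bochner_integral_iff)
qed

(* Lags up to sqrt E are counted trivially; beyond them the weight is at most E powr (- kappa / 2). *)
lemma weighted_lag_sum:
  fixes b :: "nat \<Rightarrow> real"
  assumes b: "\<And>i. 0 \<le> b i" "\<And>i. b i \<le> 1" and \<kappa>: "0 < \<kappa>" "\<kappa> \<le> 1"
    and E: "1 \<le> E" "(\<Sum>i\<in>{1..<j}. b i) \<le> E"
  shows "(\<Sum>i\<in>{1..<j}. b i * real (j - i) powr -\<kappa>) \<le> 2 * E powr (1 - \<kappa> / 2)"
proof -
  define s where "s = sqrt E"
  have s: "1 \<le> s"
    using E by (simp add: s_def)
  have term_le: "b i * real (j - i) powr -\<kappa> \<le> of_bool (real (j - i) \<le> s) + s powr -\<kappa> * b i"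
    if i: "i \<in> {1..<j}" for i
  proof (cases "real (j - i) \<le> s")
    case True
    have "real (j - i) powr -\<kappa> \<le> 1"
      using i \<kappa> powr_mono2'[of "-\<kappa>" 1 "real (j - i)"] by simp
    then have "b i * real (j - i) powr -\<kappa> \<le> 1 * 1"
      using b by (intro mult_mono) auto
    then show ?thesis
      using True b by (simp add: add_increasing2)
  next
    case False
    have "real (j - i) powr -\<kappa> \<le> s powr -\<kappa>"
      using False s \<kappa> by (intro powr_mono2') auto
    then have "b i * real (j - i) powr -\<kappa> \<le> b i * s powr -\<kappa>"
      using b by (intro mult_left_mono)
    then show ?thesis
      using False by (simp add: mult.commute)
  qed
  have card: "(\<Sum>i\<in>{1..<j}. of_bool (real (j - i) \<le> s)) \<le> s"
  proof -
    have "(\<Sum>i\<in>{1..<j}. of_bool (real (j - i) \<le> s)) = real (card {i\<in>{1..<j}. real (j - i) \<le> s})"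
      by (simp add: of_bool_def sum.If_cases Int_def del: of_nat_diff)
    also have "card {i\<in>{1..<j}. real (j - i) \<le> s} \<le> card {1..nat \<lfloor>s\<rfloor>}"
    proof (rule card_inj_on_le)
      show "inj_on (\<lambda>i. j - i) {i\<in>{1..<j}. real (j - i) \<le> s}"
        by (auto simp: inj_on_def)
      show "(\<lambda>i. j - i) ` {i\<in>{1..<j}. real (j - i) \<le> s} \<subseteq> {1..nat \<lfloor>s\<rfloor>}"
        by (auto simp: le_nat_floor)
    qed simp
    also have "real (card {1..nat \<lfloor>s\<rfloor>}) \<le> s"
      using s by simp
    finally show ?thesis
      by simp
  qed
  have "(\<Sum>i\<in>{1..<j}. b i * real (j - i) powr -\<kappa>)
      \<le> (\<Sum>i\<in>{1..<j}. of_bool (real (j - i) \<le> s) + s powr -\<kappa> * b i)"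
    by (rule sum_mono[OF term_le])
  also have "\<dots> = (\<Sum>i\<in>{1..<j}. of_bool (real (j - i) \<le> s)) + s powr -\<kappa> * (\<Sum>i\<in>{1..<j}. b i)"
    by (simp only: sum.distrib sum_distrib_left)
  also have "\<dots> \<le> s + s powr -\<kappa> * E"
    using card E by (intro add_mono mult_left_mono) auto
  also have "s powr -\<kappa> * E = E powr (1 - \<kappa> / 2)"
  proof -
    have "s powr -\<kappa> = E powr (- \<kappa> / 2)"
      using E by (simp add: s_def powr_powr flip: powr_half_sqrt)
    then show ?thesis
      using E powr_add[of E "- \<kappa> / 2" 1] by (simp add: field_simps)
  qed
  \<comment> \<open>As \<kappa> \<le> 1, the exponent 1/2 is at most 1 - \<kappa> / 2.\<close>
  also have "s \<le> E powr (1 - \<kappa> / 2)"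
    using E \<kappa> powr_mono[of "1/2" "1 - \<kappa> / 2" E] by (simp add: s_def powr_half_sqrt)
  finally show ?thesis
    by simp
qed

text \<open>Each row keeps the factor \<open>b j\<close>, so summing over j gives E, however large n
  is compared with E. In the constant, 1 is the diagonal and 4 * K is K times 2 for symmetry and 2
  from the lag sum.\<close>

lemma (in prob_space) second_moment_hits_le:
  assumes A: "\<And>k. A k \<in> events"
  defines "b \<equiv> \<lambda>k. prob (A k)"
  assumes cov: "\<And>i j. 1 \<le> i \<Longrightarrow> i < j \<Longrightarrow>
      prob (A i \<inter> A j) \<le> b j * (b i + K * b i * real (j - i) powr -\<kappa> + c (j - i))"
    and K: "0 \<le> K" and \<kappa>: "0 < \<kappa>" "\<kappa> \<le> 1" and c: "summable c" "\<And>n. 0 \<le> c n"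
    and E: "1 \<le> (\<Sum>k=1..n. b k)"
  shows "expectation (\<lambda>x. ((\<Sum>k=1..n. indicator (A k) x) - (\<Sum>k=1..n. b k))\<^sup>2)
      \<le> (1 + 4 * K + 2 * suminf c) * (\<Sum>k=1..n. b k) powr (2 - \<kappa> / 2)"
proof -
  define E where "E = (\<Sum>k=1..n. b k)"
  define f where "f i j = prob (A i \<inter> A j) - b i * b j" for i j
  have b: "0 \<le> b k" "b k \<le> 1" for k
    by (auto simp: b_def)
  have E1: "1 \<le> E"
    using E by (simp add: E_def)
  have row: "f j j + 2 * (\<Sum>i\<in>{1..<j}. f i j) \<le> b j * (1 + 2 * (2 * K * E powr (1 - \<kappa> / 2) + suminf c))"
    if j: "j \<in> {1..n}" for j
  proof -
    have "f j j \<le> b j"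
      using b[of j] by (simp add: f_def b_def)
    moreover have "(\<Sum>i\<in>{1..<j}. f i j) \<le> b j * (2 * K * E powr (1 - \<kappa> / 2) + suminf c)"
    proof -
      have "(\<Sum>i\<in>{1..<j}. f i j) \<le> (\<Sum>i\<in>{1..<j}. b j * (K * (b i * real (j - i) powr -\<kappa>) + c (j - i)))"
        using cov by (intro sum_mono) (fastforce simp: f_def algebra_simps)
      also have "\<dots> = b j * (K * (\<Sum>i\<in>{1..<j}. b i * real (j - i) powr -\<kappa>) + (\<Sum>i\<in>{1..<j}. c (j - i)))"
        by (simp only: sum.distrib sum_distrib_left distrib_left)
      also have "\<dots> \<le> b j * (K * (2 * E powr (1 - \<kappa> / 2)) + suminf c)"
      proof (intro mult_left_mono add_mono)
        have "(\<Sum>i\<in>{1..<j}. b i) \<le> E"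
          unfolding E_def using j b by (intro sum_mono2) auto
        then show "(\<Sum>i\<in>{1..<j}. b i * real (j - i) powr -\<kappa>) \<le> 2 * E powr (1 - \<kappa> / 2)"
          using b \<kappa> E1 by (intro weighted_lag_sum)
        have "(\<Sum>i\<in>{1..<j}. c (j - i)) = (\<Sum>i\<in>{1..<j}. c i)"
          by (rule sum.reindex_bij_witness[where i = "\<lambda>i. j - i" and j = "\<lambda>i. j - i"]) auto
        also have "\<dots> \<le> suminf c"
          using c by (intro sum_le_suminf) auto
        finally show "(\<Sum>i\<in>{1..<j}. c (j - i)) \<le> suminf c" .
      qed (use K b in auto)
      finally show ?thesis
        by (simp add: mult.assoc mult.left_commute)
    qed
    ultimately show ?thesis
      by (simp add: algebra_simps)
  qed
  have "expectation (\<lambda>x. ((\<Sum>k=1..n. indicator (A k) x) - E)\<^sup>2) = (\<Sum>i=1..n. \<Sum>j=1..n. f i j)"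
    unfolding E_def b_def f_def by (rule second_moment_hits(2)[OF A])
  also have "\<dots> = (\<Sum>j=1..n. f j j + 2 * (\<Sum>i\<in>{1..<j}. f i j))"
    by (rule sum_sum_symmetric) (simp add: f_def Int_commute mult.commute)
  also have "\<dots> \<le> (\<Sum>j=1..n. b j * (1 + 2 * (2 * K * E powr (1 - \<kappa> / 2) + suminf c)))"
    by (intro sum_mono row)
  also have "\<dots> = E * (1 + 2 * (2 * K * E powr (1 - \<kappa> / 2) + suminf c))"
    by (simp only: E_def sum_distrib_right)
  also have "\<dots> = E * (1 + 2 * suminf c) + 4 * K * (E * E powr (1 - \<kappa> / 2))"
    by (simp add: algebra_simps)
  also have "E * E powr (1 - \<kappa> / 2) = E powr (2 - \<kappa> / 2)"
    using E1 powr_add[of E 1 "1 - \<kappa> / 2"] by simp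
  also have "E * (1 + 2 * suminf c) \<le> E powr (2 - \<kappa> / 2) * (1 + 2 * suminf c)"
  proof (intro mult_right_mono)
    show "E \<le> E powr (2 - \<kappa> / 2)"
      using E1 \<kappa> powr_mono[of 1 "2 - \<kappa> / 2" E] by simp
  qed (use suminf_nonneg[OF c] in simp)
  finally show ?thesis
    by (simp add: E_def algebra_simps)
qed

text \<open>\<open>N k\<close> is the first time that E reaches k ^ q. Steps of size at most 1 put E
  (N k) between k ^ q and k ^ q + 1, so consecutive values have ratio tending to 1 and monotonicity
  of S fills the gaps.\<close>

lemma ratio_tendsto_1_of_subsequence:
  fixes S E :: "nat \<Rightarrow> real" and q :: nat
  assumes S: "incseq S" "\<And>n. 0 \<le> S n"
    and E: "incseq E" "E 0 = 0" "\<And>n. E (Suc n) \<le> E n + 1" "filterlim E at_top sequentially"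
    and q: "1 \<le> q"
  defines "N \<equiv> \<lambda>k. LEAST n. real k ^ q \<le> E n"
  assumes lim: "(\<lambda>k. S (N k) / E (N k)) \<longlonglongrightarrow> 1"
  shows "(\<lambda>n. S n / E n) \<longlonglongrightarrow> 1"
proof -
  have ex: "\<exists>n. real k ^ q \<le> E n" for k
    using E(4) by (auto simp: filterlim_at_top eventually_sequentially)
  have N_ge: "real k ^ q \<le> E (N k)" for k
    unfolding N_def by (rule LeastI_ex[OF ex])
  have N_le: "E (N k) \<le> real k ^ q + 1" if "1 \<le> k" for k
  proof (cases "N k")
    case 0
    then show ?thesis
      using E(2) by simp
  next
    case (Suc m)
    have "\<not> real k ^ q \<le> E m"
      using not_less_Least[of m "\<lambda>n. real k ^ q \<le> E n"] Suc by (simp add: N_def)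
    then show ?thesis
      using E(3)[of m] Suc by simp
  qed
  \<comment> \<open>The block of n: k ^ q \<le> E n < (k + 1) ^ q, hence N k \<le> n \<le> N (k +
    1).\<close>
  define k where "k n = nat \<lfloor>root q (E n)\<rfloor>" for n
  have E_nonneg: "0 \<le> E n" for n
    using incseqD[OF E(1), of 0 n] E(2) by simp
  have k_le: "real (k n) ^ q \<le> E n" and k_gt: "E n < real (Suc (k n)) ^ q" for n
  proof -
    define r where "r = root q (E n)"
    have r: "0 \<le> r" "r ^ q = E n"
      using q E_nonneg[of n] by (auto simp: r_def real_root_pow_pos2)
    have "real (k n) \<le> r" "r < real (Suc (k n))"
      using r by (auto simp: k_def r_def[symmetric]) linarith+
    then show "real (k n) ^ q \<le> E n" "E n < real (Suc (k n)) ^ q"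
      using r q by (auto simp flip: r(2) intro!: power_mono power_strict_mono)
  qed
  have k_top: "filterlim k at_top sequentially"
    unfolding filterlim_at_top
  proof
    fix m :: nat
    have "eventually (\<lambda>n. real (Suc m) ^ q \<le> E n) sequentially"
      using E(4) by (simp add: filterlim_at_top)
    then show "eventually (\<lambda>n. m \<le> k n) sequentially"
    proof eventually_elim
      case (elim n)
      then have "real (Suc m) ^ q < real (Suc (k n)) ^ q"
        using k_gt[of n] by simp
      then show ?case
        by (auto dest: power_less_imp_less_base)
    qed
  qed
  have "(\<lambda>k. S (N k) / E (N k) * (real k / real (Suc k)) ^ q) \<longlonglongrightarrow> 1 * 1 ^ q"
    by (intro tendsto_intros lim LIMSEQ_n_over_Suc_n)
  from filterlim_compose[OF this k_top]
  have lower: "(\<lambda>n. S (N (k n)) / E (N (k n)) * (real (k n) / real (Suc (k n))) ^ q) \<longlonglongrightarrow> 1"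
    by simp
  \<comment> \<open>The summand (1 / k) ^ q accounts for the overshoot of E (N (k + 1)) beyond (k +
    1) ^ q.\<close>
  have "(\<lambda>k. S (N (Suc k)) / E (N (Suc k)) * ((real (Suc k) / real k) ^ q + (1 / real k) ^ q)) \<longlonglongrightarrow> 1 * (1 ^ q + 0 ^ q)"
    by (intro tendsto_intros LIMSEQ_Suc[OF lim] LIMSEQ_Suc_n_over_n lim_1_over_n)
  from filterlim_compose[OF this k_top]
  have upper: "(\<lambda>n. S (N (Suc (k n))) / E (N (Suc (k n)))
      * ((real (Suc (k n)) / real (k n)) ^ q + (1 / real (k n)) ^ q)) \<longlonglongrightarrow> 1"
    using q by (simp add: power_0_left)
  have ev: "eventually (\<lambda>n. 1 \<le> k n) sequentially"
    using k_top by (simp add: filterlim_at_top)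
  show ?thesis
  proof (rule tendsto_sandwich[OF _ _ lower upper])
    show "eventually (\<lambda>n. S (N (k n)) / E (N (k n)) * (real (k n) / real (Suc (k n))) ^ q \<le> S n / E n) sequentially"
      using ev
    proof eventually_elim
      case (elim n)
      have pos: "0 < real (k n) ^ q"
        using elim by simp
      have "S (N (k n)) \<le> S n"
        using k_le[of n] unfolding N_def by (intro incseqD[OF S(1)] Least_le)
      have "S (N (k n)) / E (N (k n)) * (real (k n) / real (Suc (k n))) ^ q
          = (S (N (k n)) / real (Suc (k n)) ^ q) * (real (k n) ^ q / E (N (k n)))"
        by (simp add: power_divide)
      also have "\<dots> \<le> (S (N (k n)) / real (Suc (k n)) ^ q) * 1"
        using N_ge[of "k n"] pos S(2) less_le_trans[OF pos N_ge[of "k n"]]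
        by (intro mult_left_mono) (auto simp: divide_le_eq_1)
      also have "\<dots> \<le> S n / E n"
        using \<open>S (N (k n)) \<le> S n\<close> k_gt[of n] less_le_trans[OF pos k_le[of n]] S(2)
        by (simp del: of_nat_Suc) (intro frac_le, auto)
      finally show ?case .
    qed
    show "eventually (\<lambda>n. S n / E n \<le> S (N (Suc (k n))) / E (N (Suc (k n)))
      * ((real (Suc (k n)) / real (k n)) ^ q + (1 / real (k n)) ^ q)) sequentially"
      using ev
    proof eventually_elim
      case (elim n)
      have pos: "0 < real (k n) ^ q"
        using elim by simp
      define m where "m = N (Suc (k n))"
      have m: "real (Suc (k n)) ^ q \<le> E m" "E m \<le> real (Suc (k n)) ^ q + 1"
        unfolding m_def by (rule N_ge, rule N_le) simp
      have "n \<le> m"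
      proof (rule ccontr)
        assume "\<not> n \<le> m"
        then have "E m \<le> E n"
          by (intro incseqD[OF E(1)]) simp
        then show False
          using m k_gt[of n] by simp
      qed
      then have "S n / E n \<le> S m / real (k n) ^ q"
        using pos k_le[of n] S by (intro frac_le) (auto dest: incseqD)
      also have "\<dots> = (S m / real (k n) ^ q) * 1"
        by simp
      also have "\<dots> \<le> (S m / real (k n) ^ q) * ((real (Suc (k n)) ^ q + 1) / E m)"
      proof (intro mult_left_mono)
        have "0 < E m"
          using m(1) by (rule less_le_trans[rotated]) simp
        then show "1 \<le> (real (Suc (k n)) ^ q + 1) / E m"
          using m(2) by simp
      qed (use S pos in auto)
      also have "\<dots> = S m / E m * ((real (Suc (k n)) / real (k n)) ^ q + (1 / real (k n)) ^ q)"
        by (simp add: power_divide add_divide_distrib[symmetric] mult.commute)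
      finally show ?case
        by (simp only: m_def)
    qed
  qed
qed

text \<open>The sum of the squares has finite integral, hence is finite almost everywhere and its
  terms tend to 0.\<close>

lemma (in prob_space) AE_tendsto_0_of_summable_second_moment:
  fixes Z :: "nat \<Rightarrow> 'a \<Rightarrow> real"
  assumes Z: "\<And>k. integrable M (\<lambda>x. (Z k x)\<^sup>2)" and [measurable]: "\<And>k. random_variable borel (Z k)"
    and le: "\<And>k. expectation (\<lambda>x. (Z k x)\<^sup>2) \<le> c k" and c: "summable c"
  shows "AE x in M. (\<lambda>k. Z k x) \<longlonglongrightarrow> 0"
proof -
  have c0: "0 \<le> c k" for k
    using order_trans[OF _ le] by (simp add: integral_nonneg_AE)
  have "(\<integral>\<^sup>+x. (\<Sum>k. ennreal ((Z k x)\<^sup>2)) \<partial>M) = (\<Sum>k. \<integral>\<^sup>+x. ennreal ((Z k x)\<^sup>2) \<partial>M)"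
    by (intro nn_integral_suminf) measurable
  also have "\<dots> = (\<Sum>k. ennreal (expectation (\<lambda>x. (Z k x)\<^sup>2)))"
    by (intro suminf_cong nn_integral_eq_integral Z) simp
  also have "\<dots> \<le> (\<Sum>k. ennreal (c k))"
    by (intro suminf_le ennreal_leI le) auto
  also have "\<dots> = ennreal (suminf c)"
    using c c0 by (intro suminf_ennreal2)
  finally have "(\<integral>\<^sup>+x. (\<Sum>k. ennreal ((Z k x)\<^sup>2)) \<partial>M) \<noteq> \<infinity>"
    by (auto simp: top_unique)
  then have "AE x in M. (\<Sum>k. ennreal ((Z k x)\<^sup>2)) \<noteq> \<infinity>"
    by (intro nn_integral_PInf_AE) measurable
  then show ?thesis
  proof eventually_elim
    case (elim x)
    then have "summable (\<lambda>k. (Z k x)\<^sup>2)"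
      by (intro summable_suminf_not_top) auto
    then have "(\<lambda>k. (Z k x)\<^sup>2) \<longlonglongrightarrow> 0"
      by (rule summable_LIMSEQ_zero)
    from tendsto_real_sqrt[OF this] show ?case
      by (simp add: tendsto_rabs_zero_iff)
  qed
qed

text \<open>The relative variance is at most a constant times E powr -(\<kappa> / 2), which is
  summable along times at which E grows like a high power of k; the gaps are filled by
  monotonicity.\<close>

theorem (in prob_space) strong_borel_cantelli_of_covariances:
  assumes A: "\<And>k. A k \<in> events"
  defines "b \<equiv> \<lambda>k. prob (A k)"
  assumes cov: "\<And>i j. 1 \<le> i \<Longrightarrow> i < j \<Longrightarrow>
      prob (A i \<inter> A j) \<le> b j * (b i + K * b i * real (j - i) powr -\<kappa> + c (j - i))"
    and K: "0 \<le> K" and \<kappa>: "0 < \<kappa>" "\<kappa> \<le> 1" and c: "summable c" "\<And>n. 0 \<le> c n"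
    and div: "filterlim (\<lambda>n. \<Sum>k=1..n. b k) at_top sequentially"
  shows "AE x in M. (\<lambda>n. (\<Sum>k=1..n. indicator (A k) x) / (\<Sum>k=1..n. b k)) \<longlonglongrightarrow> 1"
proof -
  define E where "E n = (\<Sum>k=1..n. b k)" for n
  define S where "S n x = (\<Sum>k=1..n. indicator (A k) x :: real)" for n x
  have [measurable]: "A k \<in> events" for k
    by (rule A)
  have b: "0 \<le> b k" "b k \<le> 1" for k
    by (auto simp: b_def)
  define C where "C = 1 + 4 * K + 2 * suminf c"
  have C: "0 \<le> C"
    using K c suminf_nonneg[of c] by (simp add: C_def)
  \<comment> \<open>Chosen so that (k ^ q) powr -(\<kappa> / 2) is at most k powr -2.\<close>
  define q where "q = nat \<lceil>4 / \<kappa>\<rceil>"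
  have "4 / \<kappa> \<le> real q"
    unfolding q_def by (rule real_nat_ceiling_ge)
  moreover have "1 \<le> 4 / \<kappa>"
    using \<kappa> by simp
  ultimately have q: "4 / \<kappa> \<le> real q" "1 \<le> q"
    by linarith+
  define N where "N k = (LEAST n. real k ^ q \<le> E n)" for k
  have E_top: "filterlim E at_top sequentially"
    using div by (simp add: E_def[abs_def])
  have N: "real k ^ q \<le> E (N k)" for k
  proof -
    have "eventually (\<lambda>n. real k ^ q \<le> E n) sequentially"
      using E_top by (simp add: filterlim_at_top)
    then have "\<exists>n. real k ^ q \<le> E n"
      using eventually_happens sequentially_bot by blast
    then show ?thesis
      unfolding N_def by (rule LeastI_ex)
  qed
  \<comment> \<open>The shift skips k = 0, for which \<open>N 0\<close> is 0 and E vanishes.\<close>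
  define Z where "Z k x = (S (N (Suc k)) x - E (N (Suc k))) / E (N (Suc k))" for k x
  have Zsq: "(Z k x)\<^sup>2 = (S (N (Suc k)) x - E (N (Suc k)))\<^sup>2 / (E (N (Suc k)))\<^sup>2" for k x
    by (simp add: Z_def power_divide)
  have E_ge: "1 \<le> E (N (Suc k))" for k
    using N[of "Suc k"] one_le_power[of "real (Suc k)" q] by linarith
  have int: "integrable M (\<lambda>x. (S n x - E n)\<^sup>2)" for n
    unfolding S_def E_def b_def by (rule second_moment_hits(1)[OF A])
  have "AE x in M. (\<lambda>k. Z k x) \<longlonglongrightarrow> 0"
  proof (rule AE_tendsto_0_of_summable_second_moment)
    show "integrable M (\<lambda>x. (Z k x)\<^sup>2)" for k
      unfolding Zsq by (intro integrable_divide int)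
    show "random_variable borel (Z k)" for k
      unfolding Z_def[abs_def] S_def by measurable
    show "expectation (\<lambda>x. (Z k x)\<^sup>2) \<le> C * (1 / real (Suc k) ^ 2)" for k
    proof -
      define e where "e = E (N (Suc k))"
      have e: "1 \<le> e" "real (Suc k) ^ q \<le> e"
        using E_ge[of k] N[of "Suc k"] by (simp_all add: e_def del: of_nat_Suc)
      have "expectation (\<lambda>x. (Z k x)\<^sup>2) = expectation (\<lambda>x. (S (N (Suc k)) x - e)\<^sup>2) / e\<^sup>2"
        unfolding Zsq e_def by simp
      also have "\<dots> \<le> (C * e powr (2 - \<kappa> / 2)) / e\<^sup>2"
      proof (intro divide_right_mono)
        show "expectation (\<lambda>x. (S (N (Suc k)) x - e)\<^sup>2) \<le> C * e powr (2 - \<kappa> / 2)"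
          unfolding C_def e_def E_def S_def b_def
          using second_moment_hits_le[where A = A and K = K and \<kappa> = \<kappa> and c = c and n = "N (Suc k)", OF A] cov K \<kappa> c E_ge[of k]
          by (simp add: b_def E_def)
      qed simp
      also have "\<dots> = C * e powr - (\<kappa> / 2)"
        using e powr_add[of e 2 "- (\<kappa> / 2)"] by simp
      also have "e powr - (\<kappa> / 2) \<le> (real (Suc k) ^ q) powr - (\<kappa> / 2)"
        using e \<kappa> by (intro powr_mono2') auto
      also have "\<dots> = real (Suc k) powr - (real q * \<kappa> / 2)"
        by (simp add: powr_powr flip: powr_realpow del: of_nat_Suc)
      also have "\<dots> \<le> real (Suc k) powr - 2"
        using q(1) \<kappa> by (intro powr_mono) (auto simp: field_simps)
      also have "\<dots> = 1 / real (Suc k) ^ 2"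
        by (simp add: powr_minus divide_inverse del: of_nat_Suc flip: powr_numeral)
      finally show ?thesis
        using C by (simp add: mult_left_mono)
    qed
    show "summable (\<lambda>k. C * (1 / real (Suc k) ^ 2))"
      using inverse_power_summable[of 2, where ?'a = real]
      by (intro summable_mult) (subst summable_Suc_iff[of "\<lambda>k. 1 / real k ^ 2"], simp add: inverse_eq_divide)
  qed
  then show ?thesis
  proof eventually_elim
    case (elim x)
    have "(\<lambda>k. Z k x + 1) \<longlonglongrightarrow> 0 + 1"
      by (intro tendsto_intros elim)
    moreover have "Z k x + 1 = S (N (Suc k)) x / E (N (Suc k))" for k
      using E_ge[of k] by (simp add: Z_def field_simps)
    ultimately have "(\<lambda>k. S (N (Suc k)) x / E (N (Suc k))) \<longlonglongrightarrow> 1"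
      by simp
    then have lim: "(\<lambda>k. S (N k) x / E (N k)) \<longlonglongrightarrow> 1"
      by (rule LIMSEQ_imp_Suc)
    have "(\<lambda>n. S n x / E n) \<longlonglongrightarrow> 1"
    proof (rule ratio_tendsto_1_of_subsequence[OF _ _ _ _ _ _ q(2)])
      show "incseq (\<lambda>n. S n x)"
        by (rule incseq_SucI) (simp add: S_def)
      show "0 \<le> S n x" for n
        by (simp add: S_def sum_nonneg)
      show "incseq E"
        by (rule incseq_SucI) (simp add: E_def b)
      show "filterlim E at_top sequentially"
        by (rule E_top)
      show "(\<lambda>k. S (LEAST n. real k ^ q \<le> E n) x / E (LEAST n. real k ^ q \<le> E n)) \<longlonglongrightarrow> 1"
        using lim by (simp add: N_def)
    qed (use b in \<open>auto simp: E_def\<close>)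
    then show ?case
      by (simp add: S_def E_def)
  qed
qed

subsection \<open>The inverse of the left branch\<close>

definition left_branch :: "real \<Rightarrow> real \<Rightarrow> real" where
  "left_branch \<alpha> y = y * (1 + 2 powr \<alpha> * y powr \<alpha>)"

definition left_inverse :: "real \<Rightarrow> real \<Rightarrow> real" where
  "left_inverse \<alpha> = the_inv_into {0..1/2} (left_branch \<alpha>)"

context
  fixes \<alpha> :: real
  assumes \<alpha>: "0 < \<alpha>" "\<alpha> < 1"
begin

lemma left_branch_0: "left_branch \<alpha> 0 = 0"
  by (simp add: left_branch_def)

lemma left_branch_half: "left_branch \<alpha> (1/2) = 1"
  by (simp add: left_branch_def powr_divide)

lemma left_branch_eq: "0 \<le> y \<Longrightarrow> left_branch \<alpha> y = y + 2 powr \<alpha> * y powr (1 + \<alpha>)"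
  by (cases "y = 0") (simp_all add: left_branch_def powr_add algebra_simps)

lemma left_branch_expand:
  assumes "0 \<le> u" "u \<le> v"
  shows "v - u \<le> left_branch \<alpha> v - left_branch \<alpha> u"
proof -
  have "u powr (1 + \<alpha>) \<le> v powr (1 + \<alpha>)"
    using assms \<alpha> by (intro powr_mono2) auto
  then show ?thesis
    using assms by (simp add: left_branch_eq)
qed

text \<open>The slope is 1 + (1 + \<alpha>) * (2 z) powr \<alpha> \<le> 1 + 2. The mean value
  theorem is applied at positive points; u = 0 is immediate from the formula.\<close>

lemma left_branch_lipschitz:
  assumes uv: "0 \<le> u" "u \<le> v" "v \<le> 1/2"
  shows "left_branch \<alpha> v - left_branch \<alpha> u \<le> 3 * (v - u)"
proof -
  have le1: "2 powr \<alpha> * z powr \<alpha> \<le> 1" if "0 \<le> z" "z \<le> 1/2" for z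
  proof -
    have "2 powr \<alpha> * z powr \<alpha> = (2 * z) powr \<alpha>"
      using that by (simp add: powr_mult)
    also have "\<dots> \<le> 1 powr \<alpha>"
      using that \<alpha> by (intro powr_mono2) auto
    finally show ?thesis
      by simp
  qed
  consider "u = v" | "u = 0" "u < v" | "0 < u" "u < v"
    using uv by linarith
  then show ?thesis
  proof cases
    case 2
    have "v * (2 powr \<alpha> * v powr \<alpha>) \<le> v * 1"
      using uv le1[of v] by (intro mult_left_mono) auto
    then show ?thesis
      using 2 by (simp add: left_branch_def algebra_simps)
  next
    case 3
    have "\<exists>z>u. z < v \<and> v powr (1 + \<alpha>) - u powr (1 + \<alpha>) = (v - u) * ((1 + \<alpha>) * z powr \<alpha>)"
      using 3 by (intro MVT2) (auto intro!: derivative_eq_intros)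
    then obtain z where z: "u < z" "z < v"
      and eq: "v powr (1 + \<alpha>) - u powr (1 + \<alpha>) = (v - u) * ((1 + \<alpha>) * z powr \<alpha>)"
      by blast
    have "2 powr \<alpha> * (v powr (1 + \<alpha>) - u powr (1 + \<alpha>)) = (v - u) * ((1 + \<alpha>) * (2 powr \<alpha> * z powr \<alpha>))"
      by (simp add: eq)
    also have "\<dots> \<le> (v - u) * (2 * 1)"
      using le1[of z] z uv \<alpha> by (intro mult_left_mono mult_mono) auto
    finally show ?thesis
      using uv by (simp add: left_branch_eq algebra_simps)
  qed (use uv in simp)
qed

lemma convex_on_left_branch: "convex_on {0..1/2} (left_branch \<alpha>)"
proof -
  have conv: "((1 - t) * x + t * y) powr (1 + \<alpha>) \<le> (1 - t) * x powr (1 + \<alpha>) + t * y powr (1 + \<alpha>)"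
    if t: "0 < t" "t < 1" "0 \<le> x" "x < y" for t x y :: real
  \<comment> \<open>At x = 0 the claim reduces to t powr (1 + \<alpha>) \<le> t; otherwise convexity
    of the power function on the positive reals applies.\<close>
  proof (cases "x = 0")
    case True
    have "t powr (1 + \<alpha>) \<le> t powr 1"
      using t \<alpha> by (intro powr_mono') auto
    then show ?thesis
      using True t by (simp add: powr_mult mult_right_mono)
  next
    case False
    then show ?thesis
      using convex_onD[OF powr_convex, of "1 + \<alpha>" t x y] t \<alpha> by simp
  qed
  show ?thesis
  proof
    fix t x y :: real
    assume t: "t > 0" "t < 1" "x \<in> {0..1/2}" "y \<in> {0..1/2}" "x < y"
    have "2 powr \<alpha> * ((1 - t) * x + t * y) powr (1 + \<alpha>)
        \<le> 2 powr \<alpha> * ((1 - t) * x powr (1 + \<alpha>) + t * y powr (1 + \<alpha>))"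
      using conv[of t x y] t by (intro mult_left_mono) auto
    moreover have "0 \<le> (1 - t) * x + t * y"
      using t by simp
    ultimately show "left_branch \<alpha> ((1 - t) *\<^sub>R x + t *\<^sub>R y) \<le> (1 - t) * left_branch \<alpha> x + t * left_branch \<alpha> y"
      using t by (simp add: left_branch_eq algebra_simps)
  qed simp
qed

lemma inj_on_left_branch: "inj_on (left_branch \<alpha>) {0..1/2}"
proof (rule linorder_inj_onI')
  fix u v :: real
  assume "u \<in> {0..1/2}" "v \<in> {0..1/2}" "u < v"
  then show "left_branch \<alpha> u \<noteq> left_branch \<alpha> v"
    using left_branch_expand[of u v] by auto
qed

lemma left_branch_onto:
  assumes "0 \<le> s" "s \<le> 1"
  shows "\<exists>y\<in>{0..1/2}. left_branch \<alpha> y = s"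
proof -
  have "continuous_on {0..1/2} (left_branch \<alpha>)"
    unfolding left_branch_def using \<alpha>
    by (intro continuous_on_mult continuous_on_add continuous_on_powr' continuous_on_const continuous_on_id) auto
  then have "\<exists>y\<ge>0. y \<le> 1/2 \<and> left_branch \<alpha> y = s"
    using assms by (intro IVT') (auto simp: left_branch_0 left_branch_half)
  then show ?thesis
    by auto
qed

lemma left_inverse:
  assumes "0 \<le> s" "s \<le> 1"
  shows "0 \<le> left_inverse \<alpha> s" "left_inverse \<alpha> s \<le> 1/2" "left_branch \<alpha> (left_inverse \<alpha> s) = s"
proof -
  have s: "s \<in> left_branch \<alpha> ` {0..1/2}"
    using left_branch_onto[OF assms] by auto
  show "left_branch \<alpha> (left_inverse \<alpha> s) = s"
    unfolding left_inverse_def by (rule f_the_inv_into_f[OF inj_on_left_branch s])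
  show "0 \<le> left_inverse \<alpha> s" "left_inverse \<alpha> s \<le> 1/2"
    using the_inv_into_into[OF inj_on_left_branch s order_refl] by (auto simp: left_inverse_def)
qed

lemma left_inverse_left_branch: "0 \<le> y \<Longrightarrow> y \<le> 1/2 \<Longrightarrow> left_inverse \<alpha> (left_branch \<alpha> y) = y"
  unfolding left_inverse_def by (rule the_inv_into_f_f[OF inj_on_left_branch]) auto

lemma left_branch_le_iff:
  assumes "0 \<le> y" "y \<le> 1/2" "0 \<le> s" "s \<le> 1"
  shows "left_branch \<alpha> y \<le> s \<longleftrightarrow> y \<le> left_inverse \<alpha> s"
  using left_branch_expand[of y "left_inverse \<alpha> s"] left_branch_expand[of "left_inverse \<alpha> s" y]
    left_inverse[OF assms(3,4)] assms by linarith

text \<open>In the coordinate x powr -\<alpha> a backward step near the neutral point is almost a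
  translation. With v = (2 x) powr \<alpha> one has s = x * (1 + v), and the gain is at least
  \<alpha> / 4 times x powr -\<alpha> * v = 2 powr \<alpha> \<ge> 1.\<close>

lemma left_inverse_powr_growth:
  assumes s: "0 < s" "s \<le> 1"
  shows "0 < left_inverse \<alpha> s" "s powr -\<alpha> + \<alpha> / 4 \<le> left_inverse \<alpha> s powr -\<alpha>"
proof -
  define x where "x = left_inverse \<alpha> s"
  have x0: "0 \<le> x" "x \<le> 1/2" "left_branch \<alpha> x = s"
    using left_inverse[of s] s by (auto simp: x_def)
  moreover have "x \<noteq> 0"
    using x0 s left_branch_0 by auto
  ultimately have x: "0 < x" "x \<le> 1/2"
    by auto
  define v where "v = 2 powr \<alpha> * x powr \<alpha>"
  have "v = (2 * x) powr \<alpha>"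
    using x by (simp add: v_def powr_mult)
  also have "\<dots> \<le> 1 powr \<alpha>"
    using x \<alpha> by (intro powr_mono2) auto
  finally have v: "0 < v" "v \<le> 1"
    using x by (auto simp: v_def)
  have sx: "s = x * (1 + v)"
    using x0(3) by (simp add: left_branch_def v_def)
  \<comment> \<open>Two crude bounds, each losing a factor 2: ln (1 + v) \<ge> v / 2 for v \<le> 1,
    and exp (- t) \<le> 1 - t / 2 for t \<le> 1.\<close>
  have "(1 + v) powr -\<alpha> \<le> 1 - \<alpha> * v / 4"
  proof -
    define t where "t = \<alpha> * v / 2"
    have t: "0 < t" "t \<le> 1"
      using \<alpha> v mult_mono[of \<alpha> 1 v 1] by (auto simp: t_def)
    have "v / 2 \<le> v / (1 + v)"
      using v by (intro divide_left_mono) auto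
    also have "v / (1 + v) = 1 - inverse (1 + v)"
      using v by (simp add: field_simps)
    also have "\<dots> \<le> ln (1 + v)"
      using ln_le_minus_one[of "inverse (1 + v)"] v by (simp add: ln_inverse)
    finally have "t \<le> \<alpha> * ln (1 + v)"
      using \<alpha> mult_left_mono[of "v / 2" "ln (1 + v)" \<alpha>] by (simp add: t_def)
    then have "(1 + v) powr -\<alpha> \<le> exp (- t)"
      using v by (simp add: powr_def)
    also have "\<dots> \<le> 1 / (1 + t)"
      using exp_ge_add_one_self[of t] t by (simp add: exp_minus field_simps)
    also have "\<dots> \<le> 1 - t / 2"
      using t mult_left_le[of t t] by (simp add: field_simps)
    finally show ?thesis
      by (simp add: t_def)
  qed
  then have "x powr -\<alpha> * (1 + v) powr -\<alpha> \<le> x powr -\<alpha> * (1 - \<alpha> * v / 4)"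
    by (intro mult_left_mono) auto
  moreover have "s powr -\<alpha> = x powr -\<alpha> * (1 + v) powr -\<alpha>"
    using x v by (simp add: sx powr_mult)
  moreover have "x powr -\<alpha> * v = 2 powr \<alpha>"
    using x by (simp add: v_def powr_minus)
  ultimately have "s powr -\<alpha> \<le> x powr -\<alpha> - \<alpha> / 4 * 2 powr \<alpha>"
    by (simp add: algebra_simps)
  moreover have "\<alpha> / 4 * 1 \<le> \<alpha> / 4 * 2 powr \<alpha>"
    using \<alpha> by (intro mult_left_mono ge_one_powr_ge_zero) auto
  ultimately have "s powr -\<alpha> + \<alpha> / 4 \<le> x powr -\<alpha>"
    by linarith
  then show "0 < left_inverse \<alpha> s" "s powr -\<alpha> + \<alpha> / 4 \<le> left_inverse \<alpha> s powr -\<alpha>"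
    using x by (auto simp: x_def)
qed

text \<open>The gain accumulates to \<alpha> / 4 * n in the coordinate x powr -\<alpha>; taking the
  power -1 / \<alpha> inverts the coordinate change.\<close>

lemma left_inverse_orbit_decay:
  assumes n: "1 \<le> n"
  shows "(left_inverse \<alpha> ^^ n) 1 \<le> (\<alpha> / 4) powr - (1 / \<alpha>) * real n powr - (1 / \<alpha>)"
proof -
  have *: "0 < (left_inverse \<alpha> ^^ n) 1 \<and> (left_inverse \<alpha> ^^ n) 1 \<le> 1
      \<and> \<alpha> / 4 * real n \<le> (left_inverse \<alpha> ^^ n) 1 powr -\<alpha>" for n
  proof (induction n)
    case (Suc n)
    then show ?case
      using left_inverse_powr_growth[of "(left_inverse \<alpha> ^^ n) 1"] left_inverse(2)[of "(left_inverse \<alpha> ^^ n) 1"]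
      by (simp add: algebra_simps)
  qed simp
  define x where "x = (left_inverse \<alpha> ^^ n) 1"
  have x: "0 < x" "\<alpha> / 4 * real n \<le> x powr -\<alpha>"
    using *[of n] by (auto simp: x_def)
  have "(x powr -\<alpha>) powr - (1 / \<alpha>) \<le> (\<alpha> / 4 * real n) powr - (1 / \<alpha>)"
    using x \<alpha> n by (intro powr_mono2') auto
  moreover have "(x powr -\<alpha>) powr - (1 / \<alpha>) = x"
    using x \<alpha> by (simp add: powr_powr)
  moreover have "(\<alpha> / 4 * real n) powr - (1 / \<alpha>) = (\<alpha> / 4) powr - (1 / \<alpha>) * real n powr - (1 / \<alpha>)"
    by (rule powr_mult)
  ultimately show ?thesis
    by (simp add: x_def)
qed

text \<open>Concavity is inherited from the convexity of the increasing left branch, and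
  \<open>phi_expand\<close> is its Lipschitz bound read backwards.\<close>

lemma concave_branch_left_inverse:
  "concave_branch (left_inverse \<alpha>) ((\<alpha> / 4) powr - (1 / \<alpha>)) (1 / \<alpha>)"
proof
  show "left_inverse \<alpha> 0 = 0" "left_inverse \<alpha> 1 = 1/2"
    using left_inverse_left_branch[of 0] left_inverse_left_branch[of "1/2"]
    by (simp_all add: left_branch_0 left_branch_half)
  have le: "y \<le> left_inverse \<alpha> s" if "left_branch \<alpha> y \<le> s" "0 \<le> y" "y \<le> 1/2" "0 \<le> s" "s \<le> 1" for y s
    using left_branch_le_iff[of y s] that by simp
  show "concave_on {0..1} (left_inverse \<alpha>)"
  proof
    fix t x y :: real
    assume t: "t > 0" "t < 1" "x \<in> {0..1}" "y \<in> {0..1}"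
    define x' y' where "x' = left_inverse \<alpha> x" and "y' = left_inverse \<alpha> y"
    have xy': "x' \<in> {0..1/2}" "y' \<in> {0..1/2}" "left_branch \<alpha> x' = x" "left_branch \<alpha> y' = y"
      using left_inverse[of x] left_inverse[of y] t by (auto simp: x'_def y'_def)
    have "(1 - t) *\<^sub>R x' + t *\<^sub>R y' \<in> {0..1/2}"
      by (rule convexD[OF convex_real_interval(5)]) (use t xy' in auto)
    moreover have "(1 - t) *\<^sub>R x + t *\<^sub>R y \<in> {0..1}"
      by (rule convexD[OF convex_real_interval(5)]) (use t in auto)
    moreover have "left_branch \<alpha> ((1 - t) *\<^sub>R x' + t *\<^sub>R y') \<le> (1 - t) * left_branch \<alpha> x' + t * left_branch \<alpha> y'"
      using t xy' by (intro convex_onD[OF convex_on_left_branch]) auto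
    ultimately show "(1 - t) * left_inverse \<alpha> x + t * left_inverse \<alpha> y \<le> left_inverse \<alpha> ((1 - t) *\<^sub>R x + t *\<^sub>R y)"
      using xy' le[of "(1 - t) *\<^sub>R x' + t *\<^sub>R y'" "(1 - t) *\<^sub>R x + t *\<^sub>R y"]
      by (simp add: x'_def[symmetric] y'_def[symmetric])
  qed simp
  show "\<exists>s\<in>{0..1}. left_inverse \<alpha> s = y" if "0 \<le> y" "y \<le> 1/2" for y
    using that left_inverse_left_branch[of y] left_branch_expand[of 0 y] left_branch_expand[of y "1/2"]
    by (intro bexI[of _ "left_branch \<alpha> y"]) (auto simp: left_branch_0 left_branch_half)
  show "(v - u) / 3 \<le> left_inverse \<alpha> v - left_inverse \<alpha> u" if uv: "0 \<le> u" "u \<le> v" "v \<le> 1" for u v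
  proof -
    have "left_inverse \<alpha> u \<le> left_inverse \<alpha> v"
      using le[of "left_inverse \<alpha> u" v] left_inverse[of u] uv by simp
    then show ?thesis
      using left_branch_lipschitz[of "left_inverse \<alpha> u" "left_inverse \<alpha> v"] left_inverse[of u] left_inverse[of v] uv
      by simp
  qed
  show "1 < 1 / \<alpha>"
    using \<alpha> by simp
  show "(left_inverse \<alpha> ^^ n) 1 \<le> (\<alpha> / 4) powr - (1 / \<alpha>) * real n powr - (1 / \<alpha>)" if "1 \<le> n" for n
    by (rule left_inverse_orbit_decay[OF that])
qed

end

subsection \<open>Invariant densities\<close>

text \<open>Since \<psi> n is bounded by 1, the integrals against it are Lipschitz in L1 uniformly
  in n. Dominated convergence makes s k close to g in L1, so the limit 0 passes to g.\<close>

lemma weak_null_limit: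
  fixes \<psi> :: "nat \<Rightarrow> 'a \<Rightarrow> real" and s :: "nat \<Rightarrow> 'a \<Rightarrow> real"
  assumes \<psi>: "\<And>n. \<psi> n \<in> borel_measurable M" "\<And>n x. x \<in> space M \<Longrightarrow> \<bar>\<psi> n x\<bar> \<le> 1"
    and s: "\<And>k. integrable M (s k)" "\<And>k. (\<lambda>n. \<integral>x. s k x * \<psi> n x \<partial>M) \<longlonglongrightarrow> 0"
    and g: "integrable M g" and w: "integrable M w" "\<And>k x. x \<in> space M \<Longrightarrow> \<bar>s k x\<bar> \<le> w x"
    and lim: "\<And>x. x \<in> space M \<Longrightarrow> (\<lambda>k. s k x) \<longlonglongrightarrow> g x"
  shows "(\<lambda>n. \<integral>x. g x * \<psi> n x \<partial>M) \<longlonglongrightarrow> 0"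
proof (rule LIMSEQ_I)
  fix e :: real
  assume e: "0 < e"
  have int: "integrable M (\<lambda>x. h x * \<psi> n x)" if h: "integrable M h" for h :: "'a \<Rightarrow> real" and n
  proof (rule Bochner_Integration.integrable_bound[OF h])
    show "AE x in M. norm (h x * \<psi> n x) \<le> norm (h x)"
      using \<psi>(2) by (intro AE_I2) (simp add: abs_mult mult_left_le)
  qed (use \<psi>(1) borel_measurable_integrable[OF h] in measurable)
  have "(\<lambda>k. \<integral>x. \<bar>g x - s k x\<bar> \<partial>M) \<longlonglongrightarrow> (\<integral>x. 0 \<partial>M)"
  proof (rule integral_dominated_convergence)
    show "integrable M (\<lambda>x. \<bar>g x\<bar> + w x)"
      using g w by auto
    show "AE x in M. (\<lambda>k. \<bar>g x - s k x\<bar>) \<longlonglongrightarrow> 0"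
    proof (intro AE_I2)
      fix x assume "x \<in> space M"
      from tendsto_rabs[OF tendsto_diff[OF tendsto_const lim[OF this], of "g x"]]
      show "(\<lambda>k. \<bar>g x - s k x\<bar>) \<longlonglongrightarrow> 0"
        by simp
    qed
    show "AE x in M. norm \<bar>g x - s k x\<bar> \<le> \<bar>g x\<bar> + w x" for k
      using w(2) by (intro AE_I2) (simp, meson abs_triangle_ineq4 add_left_mono order_trans)
  qed (use g s borel_measurable_integrable in auto)
  then obtain k where k: "(\<integral>x. \<bar>g x - s k x\<bar> \<partial>M) < e / 2"
    using e order_tendstoD(2)[of _ "0::real" sequentially "e / 2"] by (fastforce simp: eventually_sequentially)
  obtain n0 where n0: "\<And>n. n0 \<le> n \<Longrightarrow> \<bar>\<integral>x. s k x * \<psi> n x \<partial>M\<bar> < e / 2"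
    using LIMSEQ_D[OF s(2)[of k], of "e / 2"] e by auto
  show "\<exists>n0. \<forall>n\<ge>n0. norm ((\<integral>x. g x * \<psi> n x \<partial>M) - 0) < e"
  proof (intro exI allI impI)
    fix n assume n: "n0 \<le> n"
    have "(\<integral>x. g x * \<psi> n x \<partial>M) - (\<integral>x. s k x * \<psi> n x \<partial>M) = (\<integral>x. (g x - s k x) * \<psi> n x \<partial>M)"
      by (subst Bochner_Integration.integral_diff[symmetric]) (auto intro: int g s simp: left_diff_distrib)
    also have "\<bar>\<dots>\<bar> \<le> (\<integral>x. \<bar>g x - s k x\<bar> \<partial>M)"
    proof (rule order_trans[OF integral_abs_bound integral_mono])
      show "integrable M (\<lambda>x. \<bar>(g x - s k x) * \<psi> n x\<bar>)"
        using int[of "\<lambda>x. g x - s k x" n] g s by auto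
      show "\<bar>(g x - s k x) * \<psi> n x\<bar> \<le> \<bar>g x - s k x\<bar>" if "x \<in> space M" for x
        using \<psi>(2)[OF that] by (simp add: abs_mult mult_left_le)
    qed (use g s in auto)
    finally show "norm ((\<integral>x. g x * \<psi> n x \<partial>M) - 0) < e"
      using n0[OF n] k by simp
  qed
qed

(* Lebesgue sets differ from Borel sets by null sets, so half lines generate all that is needed. *)
lemma weak_null_lebesgue_on:
  fixes \<psi> :: "nat \<Rightarrow> real \<Rightarrow> real"
  defines "M \<equiv> lebesgue_on {0<..1::real}"
  assumes \<psi>: "\<And>n. \<psi> n \<in> borel_measurable M" "\<And>n x. x \<in> {0<..1} \<Longrightarrow> \<bar>\<psi> n x\<bar> \<le> 1"
    and half_line: "\<And>b. b \<in> {0..1} \<Longrightarrow> (\<lambda>n. \<integral>x. indicator {..b} x * \<psi> n x \<partial>M) \<longlonglongrightarrow> 0"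
    and g: "integrable M g"
  shows "(\<lambda>n. \<integral>x. g x * \<psi> n x \<partial>M) \<longlonglongrightarrow> 0"
proof -
  interpret M: finite_measure M
    unfolding M_def
    by (intro finite_measure_lebesgue_on bounded_set_imp_lmeasurable bounded_subset[OF bounded_closed_interval[of 0 1]]) auto
  have sp: "space M = {0<..1}"
    by (simp add: M_def)
  have \<psi>': "\<And>n x. x \<in> space M \<Longrightarrow> \<bar>\<psi> n x\<bar> \<le> 1"
    using \<psi>(2) by (simp add: sp)
  have ind_meas: "indicator A \<in> borel_measurable M" if "A \<in> sets borel" for A :: "real set"
    unfolding M_def using that by (intro measurable_restrict_space1 borel_measurable_indicator) auto
  have ind_int: "integrable M (\<lambda>x. indicator A x * c :: real)" if "A \<in> sets borel" for A c
    by (intro M.integrable_const_bound[of _ "\<bar>c\<bar>"] borel_measurable_times ind_meas that AE_I2)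
       (auto simp: indicator_def)
  have ind_int': "integrable M (indicator A :: real \<Rightarrow> real)" if "A \<in> sets borel" for A
    using ind_int[OF that, of 1] by simp
  have int: "integrable M (\<lambda>x. indicator A x * \<psi> n x)" if "A \<in> sets borel" for A n
    using \<psi>'
    by (intro M.integrable_const_bound[of _ 1] borel_measurable_times ind_meas that \<psi>(1) AE_I2)
       (auto simp: indicator_def)
  have total: "(\<lambda>n. \<integral>x. \<psi> n x \<partial>M) \<longlonglongrightarrow> 0"
  proof -
    have "(\<integral>x. indicator {..1} x * \<psi> n x \<partial>M) = (\<integral>x. \<psi> n x \<partial>M)" for n
      by (intro Bochner_Integration.integral_cong) (auto simp: sp)
    then show ?thesis
      using half_line[of 1] by simp
  qed
  have borel: "(\<lambda>n. \<integral>x. indicator A x * \<psi> n x \<partial>M) \<longlonglongrightarrow> 0" if "A \<in> sets borel" for A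
  proof -
    have eq: "sets (borel :: real measure) = sigma_sets UNIV (range (\<lambda>b. {..b}))"
      by (subst borel_eq_atMost) (simp add: sets_measure_of)
    have "Int_stable (range (\<lambda>b::real. {..b}))"
      by (auto simp: Int_stable_def)
    moreover have "range (\<lambda>b::real. {..b}) \<subseteq> Pow UNIV"
      by simp
    moreover have "A \<in> sigma_sets UNIV (range (\<lambda>b. {..b}))"
      using that eq by simp
    ultimately show ?thesis
    proof (induction rule: sigma_sets_induct_disjoint)
      case (basic A)
      then obtain b where A: "A = {..b}"
        by auto
      \<comment> \<open>The hypothesis speaks of b in [0, 1] only; on (0, 1] clamping b does not
        change the indicator.\<close>
      define c where "c = max 0 (min b 1)"
      have "(\<integral>x. indicator A x * \<psi> n x \<partial>M) = (\<integral>x. indicator {..c} x * \<psi> n x \<partial>M)" for n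
        by (intro Bochner_Integration.integral_cong) (auto simp: sp A c_def indicator_def)
      then show ?case
        using half_line[of c] by (simp add: c_def)
    next
      case (compl A)
      then have A: "A \<in> sets borel"
        using eq by simp
      have "(\<integral>x. indicator (UNIV - A) x * \<psi> n x \<partial>M)
          = (\<integral>x. indicator UNIV x * \<psi> n x - indicator A x * \<psi> n x \<partial>M)" for n
        by (intro Bochner_Integration.integral_cong) (auto simp: indicator_def)
      moreover have "(\<integral>x. indicator UNIV x * \<psi> n x - indicator A x * \<psi> n x \<partial>M) = (\<integral>x. indicator UNIV x * \<psi> n x \<partial>M) - (\<integral>x. indicator A x * \<psi> n x \<partial>M)" for n
        by (intro Bochner_Integration.integral_diff int A) simp
      ultimately have "(\<integral>x. indicator (UNIV - A) x * \<psi> n x \<partial>M)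
          = (\<integral>x. indicator UNIV x * \<psi> n x \<partial>M) - (\<integral>x. indicator A x * \<psi> n x \<partial>M)" for n
        by simp
      then show ?case
        using tendsto_diff[OF total compl.IH] by simp
    next
      case (union A)
      then have A: "A i \<in> sets borel" for i
        using eq by auto
      show ?case
      proof (rule weak_null_limit[OF \<psi>(1) \<psi>'])
        have dis: "indicator (\<Union>i<k. A i) x = (\<Sum>i<k. indicator (A i) x :: real)" for k x
          using union(1) by (intro indicator_UN_disjoint) (auto simp: disjoint_family_on_def)
        show "integrable M (indicator (\<Union>i<k. A i) :: real \<Rightarrow> real)" for k
          using A by (intro ind_int') auto
        show "(\<lambda>n. \<integral>x. indicator (\<Union>i<k. A i) x * \<psi> n x \<partial>M) \<longlonglongrightarrow> 0" for k
        proof -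
          have "(\<integral>x. indicator (\<Union>i<k. A i) x * \<psi> n x \<partial>M) = (\<Sum>i<k. \<integral>x. indicator (A i) x * \<psi> n x \<partial>M)" for n
            unfolding dis sum_distrib_right by (intro Bochner_Integration.integral_sum int A)
          then show ?thesis
            using tendsto_sum[of "{..<k}" "\<lambda>i n. \<integral>x. indicator (A i) x * \<psi> n x \<partial>M" "\<lambda>_. 0"] union.IH by simp
        qed
        show "integrable M (indicator (\<Union>i. A i) :: real \<Rightarrow> real)"
          using A by (intro ind_int') auto
        show "integrable M (\<lambda>x. 1 :: real)"
          by simp
        show "(\<lambda>k. indicator (\<Union>i<k. A i) x :: real) \<longlonglongrightarrow> indicator (\<Union>i. A i) x" for x
          by (rule LIMSEQ_indicator_UN)
      qed (auto simp: indicator_def)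
    qed simp
  qed
  from g show ?thesis
  proof (induction rule: integrable_induct)
    case (base A c)
    then have "A \<in> sets lebesgue" "A \<subseteq> {0<..1}"
      by (auto simp: M_def sets_restrict_space)
    then obtain S N N' where A: "A = S \<union> N" "N \<subseteq> N'" "N' \<in> null_sets lborel" "S \<in> sets lborel"
      by (auto elim: sets_completionE)
    have "N' \<in> null_sets lebesgue"
      using A(3) by (intro null_sets_completionI)
    then have "AE x in lebesgue. x \<notin> N'"
      by (rule AE_not_in)
    then have ae: "AE x in M. x \<notin> N'"
      unfolding M_def by (subst AE_restrict_space_iff) auto
    have "(\<integral>x. indicator A x *\<^sub>R c * \<psi> n x \<partial>M) = c * (\<integral>x. indicator S x * \<psi> n x \<partial>M)" for n
    proof -
      have "(\<integral>x. indicator A x *\<^sub>R c * \<psi> n x \<partial>M) = (\<integral>x. c * (indicator S x * \<psi> n x) \<partial>M)"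
      proof (rule integral_cong_AE)
        show "AE x in M. indicator A x *\<^sub>R c * \<psi> n x = c * (indicator S x * \<psi> n x)"
          using ae by eventually_elim (use A in \<open>auto simp: indicator_def\<close>)
        show "(\<lambda>x. indicator A x *\<^sub>R c * \<psi> n x) \<in> borel_measurable M"
          using base by (intro borel_measurable_times borel_measurable_scaleR borel_measurable_indicator
              borel_measurable_const \<psi>(1))
        show "(\<lambda>x. c * (indicator S x * \<psi> n x)) \<in> borel_measurable M"
          using A(4) by (intro borel_measurable_times borel_measurable_const ind_meas \<psi>(1)) simp
      qed
      then show ?thesis
        by simp
    qed
    then show ?case
      using tendsto_mult_left[OF borel[of S], of c] A by simp
  next
    case (add f h)
    have "integrable M (\<lambda>x. u x * \<psi> n x)" if u: "integrable M u" for u :: "real \<Rightarrow> real" and n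
    proof (rule Bochner_Integration.integrable_bound[OF u])
      show "AE x in M. norm (u x * \<psi> n x) \<le> norm (u x)"
        using \<psi>' by (intro AE_I2) (simp add: abs_mult mult_left_le)
    qed (use \<psi>(1) borel_measurable_integrable[OF u] in measurable)
    then show ?case
      using tendsto_add[OF add.IH] add.hyps by (simp add: distrib_right)
  next
    case (lim f s)
    show ?case
      by (rule weak_null_limit[OF \<psi>(1) \<psi>' lim(1) lim(5), where w = "\<lambda>x. 2 * \<bar>f x\<bar>"])
         (use lim in auto)
  qed
qed

section \<open>From the map to its action on distribution functions\<close>

lemma invariant_under_measure:
  assumes inv: "invariant_under M T" and A: "A \<in> sets M"
  shows "measure M {x \<in> space M. (T ^^ n) x \<in> A} = measure M A"
proof -
  have T: "T \<in> measurable M M" and d: "distr M M T = M"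
    using inv by (auto simp: invariant_under_def)
  have "distr M M (T ^^ n) = M"
  proof (induction n)
    case 0
    then show ?case
      by (simp add: distr_id id_def)
  next
    case (Suc n)
    have "distr M M (T \<circ> T ^^ n) = distr (distr M M (T ^^ n)) M T"
      by (intro distr_distr[symmetric] T measurable_compose_n)
    also have "\<dots> = M"
      by (simp only: Suc d)
    finally show ?case
      by (simp only: funpow.simps)
  qed
  then have "measure M A = measure (distr M M (T ^^ n)) A"
    by simp
  also have "\<dots> = measure M ((T ^^ n) -` A \<inter> space M)"
    by (intro measure_distr measurable_compose_n T A)
  also have "(T ^^ n) -` A \<inter> space M = {x \<in> space M. (T ^^ n) x \<in> A}"
    by auto
  finally show ?thesis
    by simp
qed

context
  fixes \<alpha> :: real
  assumes \<alpha>: "0 < \<alpha>" "\<alpha> < 1"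
begin

interpretation concave_branch "left_inverse \<alpha>" "(\<alpha> / 4) powr - (1 / \<alpha>)" "1 / \<alpha>"
  by (rule concave_branch_left_inverse[OF \<alpha>])

lemma intermittent_map_le_iff:
  assumes "x \<in> {0<..1}" "s \<in> {0..1}"
  shows "intermittent_map \<alpha> x \<le> s \<longleftrightarrow> x \<le> left_inverse \<alpha> s \<or> (1/2 < x \<and> x \<le> (1 + s) / 2)"
proof (cases "x \<le> 1/2")
  case True
  then show ?thesis
    using left_branch_le_iff[OF \<alpha>, of x s] assms by (simp add: intermittent_map_def left_branch_def)
next
  case False
  then show ?thesis
    using left_inverse(2)[OF \<alpha>, of s] assms by (auto simp: intermittent_map_def field_simps)
qed

text \<open>Identifies \<open>push\<close> with the image of the measure restricted to
  \<open>S\<close>. It is applied both to Lebesgue measure, to reach the limit, and to \<mu>, for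
  the fixed point equation and the covariances.\<close>

lemma pushforward_cdf:
  assumes fin: "finite_measure M" and sp: "space M = {0<..1}"
    and T: "intermittent_map \<alpha> \<in> measurable M M"
    and ivl: "\<And>s. s \<in> {0..1} \<Longrightarrow> {0<..s} \<in> sets M" and S: "S \<in> sets M" and s: "s \<in> {0..1}"
  shows "measure M {x \<in> S. (intermittent_map \<alpha> ^^ n) x \<le> s} = (push ^^ n) (\<lambda>s. measure M {x \<in> S. x \<le> s}) s"
  using s
proof (induction n arbitrary: s)
  case (Suc n)
  interpret finite_measure M
    by (rule fin)
  let ?T = "intermittent_map \<alpha>"
  have SM: "S \<subseteq> space M"
    using S by (rule sets.sets_into_space)
  have Tn: "(?T ^^ n) x \<in> {0<..1}" if "x \<in> S" for x
    using measurable_space[OF measurable_compose_n[OF T, of n], of x] that SM sp by auto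
  have sets: "{x \<in> S. (?T ^^ n) x \<le> t} \<in> sets M" if "t \<in> {0..1}" for t
  proof -
    have "{x \<in> S. (?T ^^ n) x \<le> t} = S \<inter> ((?T ^^ n) -` {0<..t} \<inter> space M)"
      using Tn SM by auto
    then show ?thesis
      using S measurable_sets[OF measurable_compose_n[OF T, of n] ivl[OF that]] by simp
  qed
  define t where "t = left_inverse \<alpha> s"
  have t: "t \<in> {0..1/2}"
    using phi_range[of s] Suc.prems by (auto simp: t_def)
  have s': "s \<in> {0..1}" "t \<in> {0..1}" "(1 + s) / 2 \<in> {0..1}" "1/2 \<in> {0..1::real}"
    using Suc.prems t by auto
  define X where "X t = {x \<in> S. (?T ^^ n) x \<le> t}" for t
  have X: "X t \<in> sets M" "X (1/2) \<in> sets M" "X ((1 + s) / 2) \<in> sets M"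
    unfolding X_def by (rule sets, rule s')+
  have sub: "X t \<inter> (X ((1 + s) / 2) - X (1/2)) = {}" "X (1/2) \<subseteq> X ((1 + s) / 2)"
    using t Suc.prems by (auto simp: X_def)
  have "{x \<in> S. (?T ^^ Suc n) x \<le> s} = X t \<union> (X ((1 + s) / 2) - X (1/2))"
    using intermittent_map_le_iff[OF Tn s'(1)] by (auto simp: t_def X_def not_le)
  also have "measure M \<dots> = measure M (X t) + measure M (X ((1 + s) / 2) - X (1/2))"
    using X sub by (intro finite_measure_Union sets.Diff)
  also have "measure M (X ((1 + s) / 2) - X (1/2)) = measure M (X ((1 + s) / 2)) - measure M (X (1/2))"
    using X sub by (intro finite_measure_Diff)
  finally show ?case
    using Suc.IH[OF s'(2)] Suc.IH[OF s'(3)] Suc.IH[OF s'(4)] by (simp add: push_def t_def X_def)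
qed simp

(* Fix s and test against psi n = 1{T^n x <= s} - m {T^n <= s}: by coupling this tends to 0 weakly on
   half lines, hence against the density of mu. *)
lemma acip_cdf_limit:
  assumes acip: "acip (intermittent_map \<alpha>) \<mu>" and s: "s \<in> {0..1}"
  shows "(\<lambda>n. (push ^^ n) (\<lambda>s. s) s) \<longlonglongrightarrow> measure \<mu> {0<..s}"
proof -
  let ?T = "intermittent_map \<alpha>"
  define M where "M = lebesgue_on {0<..1::real}"
  interpret \<mu>: prob_space \<mu>
    using acip by (simp add: acip_def)
  have sets_eq: "sets \<mu> = sets M"
    using acip by (simp add: acip_def M_def)
  have inv: "invariant_under \<mu> ?T"
    using acip by (simp add: acip_def)
  \<comment> \<open>Both measures live on the same sigma-field, so measurability with respect to
    Lebesgue measure is read off from the invariance of \<mu>.\<close>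
  have TM: "?T \<in> measurable M M"
    using inv by (simp add: invariant_under_def sets_eq cong: measurable_cong_sets)
  have sp: "space M = {0<..1}" "space \<mu> = {0<..1}"
    using sets_eq_imp_space_eq[OF sets_eq] by (auto simp: M_def)
  have fin: "finite_measure M"
    unfolding M_def
    by (intro finite_measure_lebesgue_on bounded_set_imp_lmeasurable bounded_subset[OF bounded_closed_interval[of 0 1]]) auto
  interpret M: finite_measure M
    by (rule fin)
  have ivl: "{0<..t} \<in> sets M" if "t \<in> {0..1}" for t
    using that by (auto simp: M_def sets_restrict_space_iff)
  have length: "measure M {0<..t} = t" if "t \<in> {0..1}" for t
  proof -
    have "measure M {0<..t} = measure lebesgue {0<..t}"
      unfolding M_def using that by (intro measure_restrict_space) auto
    then show ?thesis
      using that by simp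
  qed
  define V where "V n = {x \<in> {0<..1}. (?T ^^ n) x \<le> s}" for n
  define l where "l n = (push ^^ n) (\<lambda>s. s) s" for n
  have cdf: "concave_cdf ((push ^^ n) (\<lambda>s. s))" for n
    by (rule concave_cdf_push_iter[OF concave_cdf_ident])
  have l: "0 \<le> l n" "l n \<le> 1" for n
    using concave_cdf_nonneg[OF cdf[of n], of s] concave_cdf_mono[OF cdf[of n], of s 1] s
    by (auto simp: l_def push_iter_1)
  have V_eq: "V n = {x \<in> space M. (?T ^^ n) x \<in> {0<..s}}" for n
    using measurable_space[OF measurable_compose_n[OF TM, of n]] by (auto simp: V_def sp)
  have V: "V n \<in> sets M" for n
    using measurable_sets[OF measurable_compose_n[OF TM, of n] ivl[OF s]]
    by (simp add: V_eq vimage_def Int_def conj_commute)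
  \<comment> \<open>\<open>l n\<close> is the Lebesgue measure of \<open>V n\<close>. Integrated
    over (0, b], this is the difference of two coupled distribution functions at s.\<close>
  define \<psi> where "\<psi> n x = indicator (V n) x - l n" for n x
  have \<psi>_meas: "\<psi> n \<in> borel_measurable M" for n
    unfolding \<psi>_def[abs_def] using V by (intro borel_measurable_diff borel_measurable_indicator) auto
  have \<psi>_le: "\<bar>\<psi> n x\<bar> \<le> 1" for n x
    using l[of n] by (auto simp: \<psi>_def indicator_def)
  have half_line: "(\<lambda>n. \<integral>x. indicator {..b} x * \<psi> n x \<partial>M) \<longlonglongrightarrow> 0" if b: "b \<in> {0..1}" for b
  proof -
    have "(\<integral>x. indicator {..b} x * \<psi> n x \<partial>M) = (push ^^ n) (\<lambda>s. min s b) s - b * (push ^^ n) (\<lambda>s. s) s" for n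
    proof -
      have "(\<integral>x. indicator {..b} x * \<psi> n x \<partial>M)
          = (\<integral>x. indicator ({0<..b} \<inter> V n) x - l n * indicator {0<..b} x \<partial>M)"
        by (intro Bochner_Integration.integral_cong) (auto simp: \<psi>_def sp indicator_def)
      also have "\<dots> = (\<integral>x. indicator ({0<..b} \<inter> V n) x \<partial>M) - (\<integral>x. l n * indicator {0<..b} x \<partial>M)"
        using V[of n] ivl[OF b]
        by (intro Bochner_Integration.integral_diff integrable_mult_right integrable_real_indicator)
           (auto simp: M.emeasure_eq_measure)
      also have "\<dots> = measure M ({0<..b} \<inter> V n) - l n * b"
        using ivl[OF b] V[of n] by (simp add: length[OF b] sets.Int_space_eq2)
      also have "{0<..b} \<inter> V n = {x \<in> {0<..b}. (?T ^^ n) x \<le> s}"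
        using b by (auto simp: V_def)
      also have "measure M \<dots> = (push ^^ n) (\<lambda>s. measure M {x \<in> {0<..b}. x \<le> s}) s"
        by (intro pushforward_cdf fin TM ivl b s) (auto simp: sp)
      also have "\<dots> = (push ^^ n) (\<lambda>s. min s b) s"
      proof (rule push_iter_cong[OF _ s])
        fix t :: real
        assume t: "t \<in> {0..1}"
        have "{x \<in> {0<..b}. x \<le> t} = {0<..min t b}"
          by auto
        moreover have "min t b \<in> {0..1}"
          using t b by (auto simp: min_def)
        ultimately show "measure M {x \<in> {0<..b}. x \<le> t} = min t b"
          using length by simp
      qed
      finally show ?thesis
        by (simp add: l_def mult.commute)
    qed
    then show ?thesis
      using push_iter_min_limit[of b s] b s by simp
  qed
  have "sigma_finite_measure M"
    by (rule M.sigma_finite_measure_axioms)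
  then obtain f where f: "f \<in> borel_measurable M" "density M f = \<mu>"
    using sigma_finite_measure.Radon_Nikodym[of M \<mu>] acip sets_eq by (auto simp: acip_def M_def)
  have "(\<integral>\<^sup>+x. f x \<partial>M) = emeasure (density M f) (space M)"
    using f(1) by (subst emeasure_density) (auto intro!: nn_integral_cong)
  also have "\<dots> = 1"
    using f(2) \<mu>.emeasure_space_1 sp by simp
  finally have "AE x in M. f x \<noteq> \<infinity>"
    using f(1) by (intro nn_integral_PInf_AE) auto
  then have ae: "AE x in M. f x = ennreal (enn2real (f x))"
    by eventually_elim (simp add: top.not_eq_extremum)
  define g where "g x = enn2real (f x)" for x
  have g: "g \<in> borel_measurable M" "\<And>x. 0 \<le> g x"
    unfolding g_def[abs_def] using f(1) by measurable
  have \<mu>_eq: "\<mu> = density M (\<lambda>x. ennreal (g x))"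
    using f ae unfolding g_def by (subst f(2)[symmetric], intro density_cong) auto
  have g_ind: "integrable M (\<lambda>x. g x * indicator A x)" "(\<integral>x. g x * indicator A x \<partial>M) = measure \<mu> A"
    if A: "A \<in> sets M" for A
  proof -
    have "integrable \<mu> (indicator A :: real \<Rightarrow> real)"
      using A sets_eq by (intro integrable_real_indicator) (auto simp: \<mu>.emeasure_eq_measure)
    then show "integrable M (\<lambda>x. g x * indicator A x)"
      using A g integrable_density[of "indicator A :: real \<Rightarrow> real" M g] by (simp add: \<mu>_eq)
    have "(\<integral>x. indicator A x \<partial>\<mu>) = (\<integral>x. g x *\<^sub>R indicator A x \<partial>M :: real)"
      unfolding \<mu>_eq by (rule integral_density) (use A g in auto)
    moreover have "A \<inter> space \<mu> = A"
      using A sets_eq by (intro sets.Int_space_eq2) simp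
    ultimately show "(\<integral>x. g x * indicator A x \<partial>M) = measure \<mu> A"
      by simp
  qed
  have g_int: "integrable M g" "(\<integral>x. g x \<partial>M) = 1"
  proof -
    have "integrable M (\<lambda>x. g x * indicator (space M) x) \<longleftrightarrow> integrable M g"
      "(\<integral>x. g x * indicator (space M) x \<partial>M) = (\<integral>x. g x \<partial>M)"
      by (rule Bochner_Integration.integrable_cong Bochner_Integration.integral_cong; simp)+
    moreover have "space M = space \<mu>"
      by (simp only: sp)
    ultimately show "integrable M g" "(\<integral>x. g x \<partial>M) = 1"
      using g_ind[OF sets.top] \<mu>.prob_space by simp_all
  qed
  have "(\<lambda>n. \<integral>x. g x * \<psi> n x \<partial>M) \<longlonglongrightarrow> 0"
    by (rule weak_null_lebesgue_on[folded M_def, OF \<psi>_meas \<psi>_le half_line g_int(1)])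
  \<comment> \<open>Invariance makes the measure of \<open>V n\<close> under \<mu> independent of n,
    so the weak limit forces \<open>l n\<close> to converge to it.\<close>
  moreover have "(\<integral>x. g x * \<psi> n x \<partial>M) = measure \<mu> {0<..s} - l n" for n
  proof -
    have "(\<integral>x. g x * \<psi> n x \<partial>M) = (\<integral>x. g x * indicator (V n) x - l n * g x \<partial>M)"
      by (simp add: \<psi>_def algebra_simps)
    also have "\<dots> = measure \<mu> (V n) - l n"
      using g_ind[OF V] g_int by (subst Bochner_Integration.integral_diff) auto
    also have "measure \<mu> (V n) = measure \<mu> {0<..s}"
      using invariant_under_measure[OF inv, of "{0<..s}" n] ivl[OF s] sets_eq by (simp add: V_eq sp)
    finally show ?thesis .
  qed
  ultimately have "(\<lambda>n. measure \<mu> {0<..s} - l n) \<longlonglongrightarrow> 0"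
    by simp
  from tendsto_diff[OF tendsto_const[of "measure \<mu> {0<..s}"] this] show ?thesis
    by (simp add: l_def)
qed

text \<open>Concavity, lower slope and tail bound hold for all images of Lebesgue measure and
  persist under pointwise limits; the total mass and the fixed point equation come from \<mu>
  itself.\<close>

lemma acip_cdf:
  assumes acip: "acip (intermittent_map \<alpha>) \<mu>"
  defines "G \<equiv> \<lambda>s. measure \<mu> {0<..s}"
  shows "concave_cdf G" "G 1 = 1" "\<And>s. s \<in> {0..1} \<Longrightarrow> push G s = G s"
    "mono_on {0..1} (\<lambda>s. G s - lower_slope * s)" "\<And>N. G (orbit N) \<le> orbit_tail N"
proof -
  interpret \<mu>: prob_space \<mu>
    using acip by (simp add: acip_def)
  have inv: "invariant_under \<mu> (intermittent_map \<alpha>)"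
    using acip by (simp add: acip_def)
  have sets_eq: "sets \<mu> = sets (lebesgue_on {0<..1})"
    using acip by (simp add: acip_def)
  have sp: "space \<mu> = {0<..1}"
    using sets_eq_imp_space_eq[OF sets_eq] by simp
  have ivl: "{0<..t} \<in> sets \<mu>" if "t \<in> {0..1}" for t
    using that by (auto simp: sets_eq sets_restrict_space_iff)
  have lim: "(\<lambda>n. (push ^^ n) (\<lambda>s. s) s) \<longlonglongrightarrow> G s" if "s \<in> {0..1}" for s
    unfolding G_def by (rule acip_cdf_limit[OF acip that])
  show "concave_cdf G"
    by (rule concave_cdf_limit[OF _ lim]) (rule concave_cdf_push_iter[OF concave_cdf_ident])
  show "G 1 = 1"
    using \<mu>.prob_space by (simp add: G_def sp)
  show "push G s = G s" if s: "s \<in> {0..1}" for s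
  proof -
    let ?T = "intermittent_map \<alpha>"
    have T: "?T \<in> measurable \<mu> \<mu>"
      using inv by (simp add: invariant_under_def)
    have G_eq: "G t = measure \<mu> {x \<in> space \<mu>. x \<le> t}" if "t \<in> {0..1}" for t
    proof -
      have "{x \<in> space \<mu>. x \<le> t} = {0<..t}"
        using that by (auto simp: sp)
      then show ?thesis
        by (simp add: G_def)
    qed
    have "push G s = push (\<lambda>t. measure \<mu> {x \<in> space \<mu>. x \<le> t}) s"
      using G_eq s by (intro push_cong)
    also have "\<dots> = measure \<mu> {x \<in> space \<mu>. (?T ^^ 1) x \<le> s}"
      using pushforward_cdf[OF \<mu>.finite_measure_axioms sp T ivl sets.top s, of 1] by simp
    also have "{x \<in> space \<mu>. (?T ^^ 1) x \<le> s} = {x \<in> space \<mu>. (?T ^^ 1) x \<in> {0<..s}}"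
      using measurable_space[OF T] by (auto simp: sp)
    also have "measure \<mu> \<dots> = G s"
      unfolding G_def by (rule invariant_under_measure[OF inv ivl[OF s]])
    finally show ?thesis .
  qed
  show "mono_on {0..1} (\<lambda>s. G s - lower_slope * s)"
  proof (rule mono_onI)
    fix r s :: real
    assume rs: "r \<in> {0..1}" "s \<in> {0..1}" "r \<le> s"
    show "G r - lower_slope * r \<le> G s - lower_slope * s"
      by (rule LIMSEQ_le[OF tendsto_diff[OF lim tendsto_const] tendsto_diff[OF lim tendsto_const]])
         (use rs mono_onD[OF lower_slope(3)] in auto)
  qed
  show "G (orbit N) \<le> orbit_tail N" for N
    by (rule LIMSEQ_le_const2[OF lim]) (auto intro: push_iter_ident_le_tail)
qed

end

section \<open>Hits of intervals and their covariances\<close>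

theorem corollary2:
  fixes \<alpha> d :: real and \<mu> :: "real measure" and B :: "nat \<Rightarrow> real set"
  assumes "0 < \<alpha>" and "\<alpha> < 1"
    and "acip (intermittent_map \<alpha>) \<mu>"
    and "\<And>n. n \<ge> 1 \<Longrightarrow> is_interval (B n)"
    and "(\<Sum>n. emeasure \<mu> (B (Suc n))) = \<infinity>"
    and "d > 0"
    and "\<And>n. n \<ge> 1 \<Longrightarrow> B n \<subseteq> {d<..1}"
  shows "strong_borel_cantelli \<mu> (intermittent_map \<alpha>) B"
proof -
  note \<alpha> = assms(1,2) and acip = assms(3) and B_ivl = assms(4) and div = assms(5)
    and d = assms(6) and B_sub = assms(7)
  interpret concave_branch "left_inverse \<alpha>" "(\<alpha> / 4) powr - (1 / \<alpha>)" "1 / \<alpha>"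
    by (rule concave_branch_left_inverse[OF \<alpha>])
  interpret \<mu>: prob_space \<mu>
    using acip by (simp add: acip_def)
  let ?T = "intermittent_map \<alpha>"
  have inv: "invariant_under \<mu> ?T"
    using acip by (simp add: acip_def)
  then have T: "?T \<in> measurable \<mu> \<mu>"
    by (simp add: invariant_under_def)
  have sets_eq: "sets \<mu> = sets (lebesgue_on {0<..1})"
    using acip by (simp add: acip_def)
  have sp: "space \<mu> = {0<..1}"
    using sets_eq_imp_space_eq[OF sets_eq] by simp
  have borel: "A \<in> sets \<mu>" if "A \<in> sets borel" "A \<subseteq> {0<..1}" for A
    using that by (auto simp: sets_eq sets_restrict_space_iff)
  have ivl: "{0<..t} \<in> sets \<mu>" if "t \<in> {0..1}" for t
    using that by (intro borel) auto
  \<comment> \<open>Points are null sets for \<mu>, and by invariance so are their preimages. Hence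
    each interval may be replaced by the half-open one with the same ends at any time.\<close>
  have null: "AE x in \<mu>. (?T ^^ n) x \<noteq> a" for a n
  proof (cases "a \<in> {0<..1}")
    case True
    have "{a} \<in> null_sets (lebesgue_on {0<..1})"
      using True by (subst null_sets_restrict_space) (auto intro: null_sets_completionI)
    then have "{a} \<in> null_sets \<mu>"
      using acip by (auto simp: acip_def absolutely_continuous_def)
    then have "measure \<mu> {a} = 0" "{a} \<in> sets \<mu>"
      by (auto simp: measure_def)
    then have "measure \<mu> {x \<in> space \<mu>. (?T ^^ n) x \<in> {a}} = 0"
      using invariant_under_measure[OF inv, of "{a}" n] by simp
    moreover have "{x \<in> space \<mu>. (?T ^^ n) x \<in> {a}} \<in> sets \<mu>"
      using measurable_sets[OF measurable_compose_n[OF T] \<open>{a} \<in> sets \<mu>\<close>, of n]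
      by (simp add: vimage_def Int_def conj_commute)
    ultimately have "{x \<in> space \<mu>. (?T ^^ n) x \<in> {a}} \<in> null_sets \<mu>"
      by (simp add: null_sets_def \<mu>.emeasure_eq_measure)
    from AE_not_in[OF this] AE_space show ?thesis
      by eventually_elim simp
  next
    case False
    show ?thesis
    proof (rule AE_I2)
      fix x
      assume "x \<in> space \<mu>"
      then have "(?T ^^ n) x \<in> space \<mu>"
        by (rule measurable_space[OF measurable_compose_n[OF T]])
      then show "(?T ^^ n) x \<noteq> a"
        using False sp by auto
    qed
  qed
  define G where "G s = measure \<mu> {0<..s}" for s
  note G = acip_cdf[OF \<alpha> acip, folded G_def]
  have G_diff: "measure \<mu> {a<..b} = G b - G a" if "0 \<le> a" "a \<le> b" "b \<le> 1" for a b
  proof -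
    have "{a<..b} = {0<..b} - {0<..a}"
      using that by auto
    moreover have "measure \<mu> ({0<..b} - {0<..a}) = measure \<mu> {0<..b} - measure \<mu> {0<..a}"
      using that by (intro \<mu>.finite_measure_Diff ivl) auto
    ultimately show ?thesis
      by (simp add: G_def)
  qed
  have B_sets: "B k \<in> sets \<mu>" if "1 \<le> k" for k
    using real_interval_borel_measurable[OF B_ivl[OF that]] B_sub[OF that] d by (intro borel) auto
  \<comment> \<open>Otherwise all intervals would be empty, against the divergence of the
    series.\<close>
  have d1: "d < 1"
  proof (rule ccontr)
    assume "\<not> d < 1"
    then have "B (Suc n) = {}" for n
      using B_sub[of "Suc n"] by auto
    then show False
      using div by simp
  qed
  \<comment> \<open>Ends in [d, 1] are assigned to the empty interval too, namely a = b = 1.\<close>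
  have "\<exists>a b. d \<le> a \<and> a \<le> b \<and> b \<le> 1 \<and> B k \<subseteq> {a..b} \<and> {a<..<b} \<subseteq> B k" if k: "1 \<le> k" for k
  proof (cases "B k = {}")
    case True
    then show ?thesis
      using d1 by (intro exI[of _ 1]) auto
  next
    case False
    have bdd: "bdd_below (B k)" "bdd_above (B k)"
      using B_sub[OF k] by (auto intro!: bdd_belowI[of _ d] bdd_aboveI[of _ 1])
    have "{Inf (B k)<..<Sup (B k)} \<subseteq> B k"
    proof
      fix x assume x: "x \<in> {Inf (B k)<..<Sup (B k)}"
      then obtain u v where "u \<in> B k" "u < x" "v \<in> B k" "x < v"
        using False bdd by (auto simp: cInf_less_iff less_cSup_iff)
      then show "x \<in> B k"
        using mem_is_interval_1_I[OF B_ivl[OF k], of u v x] by simp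
    qed
    moreover have "B k \<subseteq> {Inf (B k)..Sup (B k)}"
      using bdd by (auto intro: cInf_lower cSup_upper)
    moreover have "d \<le> Inf (B k)" "Sup (B k) \<le> 1"
      using False B_sub[OF k] by (fastforce intro!: cInf_greatest cSup_least)+
    moreover have "Inf (B k) \<le> Sup (B k)"
      using False bdd by (intro cInf_le_cSup)
    ultimately show ?thesis
      by blast
  qed
  then obtain a b where ab: "\<And>k. 1 \<le> k \<Longrightarrow> d \<le> a k" "\<And>k. 1 \<le> k \<Longrightarrow> a k \<le> b k" "\<And>k. 1 \<le> k \<Longrightarrow> b k \<le> 1"
    "\<And>k. 1 \<le> k \<Longrightarrow> B k \<subseteq> {a k..b k}" "\<And>k. 1 \<le> k \<Longrightarrow> {a k<..<b k} \<subseteq> B k"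
    by metis
  have B_iff: "y \<in> B k \<longleftrightarrow> y \<in> {a k<..b k}" if "1 \<le> k" "y \<noteq> a k" "y \<noteq> b k" for k y
    using ab(4,5)[OF that(1)] that(2,3) by force
  have B_Ioc: "AE x in \<mu>. (?T ^^ n) x \<in> B k \<longleftrightarrow> (?T ^^ n) x \<in> {a k<..b k}" if "1 \<le> k" for k n
    using null[of n "a k"] null[of n "b k"] by eventually_elim (rule B_iff[OF that])
  have Ioc_sets: "{a k<..b k} \<in> sets \<mu>" if "1 \<le> k" for k
    using ab(1,3)[OF that] d by (intro borel) auto
  have pre_sets: "{x \<in> space \<mu>. (?T ^^ n) x \<in> A} \<in> sets \<mu>" if "A \<in> sets \<mu>" for A n
    using measurable_sets[OF measurable_compose_n[OF T] that, of n]
    by (simp add: vimage_def Int_def conj_commute)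
  \<comment> \<open>\<open>B 0\<close> is arbitrary and perhaps not measurable, while the abstract
    strong law asks for events at every index; index 0 gets the empty set.\<close>
  define A where "A k = (if k = 0 then {} else hit_event \<mu> ?T B k)" for k
  have A_eq: "A k = {x \<in> space \<mu>. (?T ^^ k) x \<in> B k}" if "1 \<le> k" for k
    using that by (simp add: A_def hit_event_def)
  have A_sets: "A k \<in> \<mu>.events" for k
    using pre_sets[OF B_sets, of k k] A_eq[of k] by (cases "k = 0") (auto simp: A_def)
  have B_prob: "measure \<mu> (B k) = G (b k) - G (a k)" if k: "1 \<le> k" for k
  proof -
    have "measure \<mu> (B k) = measure \<mu> {a k<..b k}"
      using B_Ioc[OF k, of 0] B_sets[OF k] Ioc_sets[OF k] by (intro measure_eq_AE) auto
    then show ?thesis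
      using G_diff[of "a k" "b k"] ab(1-3)[OF k] d by simp
  qed
  have A_measure: "\<mu>.prob (A k) = measure \<mu> (B k)" if k: "1 \<le> k" for k
    using invariant_under_measure[OF inv B_sets[OF k], of k] by (simp add: A_eq[OF k])
  obtain K \<kappa> y where K: "0 \<le> K" "0 < \<kappa>" "\<kappa> \<le> 1" "summable y" "\<And>n. 0 \<le> y n"
    and bound: "\<And>a b u v n. d \<le> a \<Longrightarrow> a \<le> b \<Longrightarrow> b \<le> 1 \<Longrightarrow> d \<le> u \<Longrightarrow> u \<le> v \<Longrightarrow> v \<le> 1 \<Longrightarrow> 1 \<le> n \<Longrightarrow>
      (push ^^ n) (\<lambda>s. G (min (max s a) b) - G a) v - (push ^^ n) (\<lambda>s. G (min (max s a) b) - G a) u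
      \<le> (G v - G u) * ((G b - G a) + K * (G b - G a) * real n powr -\<kappa> + y n)"
    using correlation_bound[OF G d d1] by metis
  have cov: "\<mu>.prob (A i \<inter> A j) \<le> \<mu>.prob (A j) *
      (\<mu>.prob (A i) + K * \<mu>.prob (A i) * real (j - i) powr -\<kappa> + y (j - i))" if ij: "1 \<le> i" "i < j" for i j
  proof -
    have j: "1 \<le> j"
      using ij by simp
    define n where "n = j - i"
    have n: "1 \<le> n" "j = n + i"
      using ij by (auto simp: n_def)
    define S where "S = {a i<..b i}"
    have S: "S \<in> sets \<mu>"
      unfolding S_def by (rule Ioc_sets[OF ij(1)])
    have S_space: "x \<in> {0<..1}" if "x \<in> S" for x
      using that ab(1,3)[OF ij(1)] d by (auto simp: S_def)
    have BB: "{x \<in> B i. (?T ^^ n) x \<in> B j} = B i \<inter> {x \<in> space \<mu>. (?T ^^ n) x \<in> B j}"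
      using B_sets[OF ij(1)] by (auto dest: sets.sets_into_space)
    have BB_sets: "{x \<in> B i. (?T ^^ n) x \<in> B j} \<in> sets \<mu>"
      unfolding BB by (intro sets.Int B_sets pre_sets ij j)
    have le_sets: "{x \<in> S. (?T ^^ n) x \<le> t} \<in> sets \<mu>" if "t \<in> {0..1}" for t
    proof -
      have "{x \<in> S. (?T ^^ n) x \<le> t} = S \<inter> {x \<in> space \<mu>. (?T ^^ n) x \<in> {0<..t}}"
        using S_space measurable_space[OF measurable_compose_n[OF T, of n]] by (auto simp: sp)
      then show ?thesis
        using S pre_sets[OF ivl[OF that], of n] by simp
    qed
    have uv: "a j \<in> {0..1}" "b j \<in> {0..1}"
      using ab(1-3)[OF j] d by auto
    \<comment> \<open>Invariance moves the times i and j to 0 and n, so the joint probability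
      depends on the lag.\<close>
    have "A i \<inter> A j = {x \<in> space \<mu>. (?T ^^ i) x \<in> {x \<in> B i. (?T ^^ n) x \<in> B j}}"
      unfolding A_eq[OF ij(1)] A_eq[OF j] using n(2) by (auto simp: funpow_add)
    then have "\<mu>.prob (A i \<inter> A j) = measure \<mu> {x \<in> B i. (?T ^^ n) x \<in> B j}"
      using invariant_under_measure[OF inv BB_sets, of i] by simp
    also have "\<dots> = measure \<mu> ({x \<in> S. (?T ^^ n) x \<le> b j} - {x \<in> S. (?T ^^ n) x \<le> a j})"
    proof (rule measure_eq_AE)
      show "AE x in \<mu>. x \<in> {x \<in> B i. (?T ^^ n) x \<in> B j}
          \<longleftrightarrow> x \<in> {x \<in> S. (?T ^^ n) x \<le> b j} - {x \<in> S. (?T ^^ n) x \<le> a j}"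
        using B_Ioc[OF ij(1), of 0] B_Ioc[OF j, of n] by eventually_elim (auto simp: S_def)
    qed (use BB_sets le_sets uv in auto)
    also have "\<dots> = measure \<mu> {x \<in> S. (?T ^^ n) x \<le> b j} - measure \<mu> {x \<in> S. (?T ^^ n) x \<le> a j}"
      using le_sets uv ab(2)[OF j] by (intro \<mu>.finite_measure_Diff) auto
    also have "\<dots> = (push ^^ n) (\<lambda>s. measure \<mu> {x \<in> S. x \<le> s}) (b j)
        - (push ^^ n) (\<lambda>s. measure \<mu> {x \<in> S. x \<le> s}) (a j)"
      using pushforward_cdf[OF \<alpha> \<mu>.finite_measure_axioms sp T ivl S] uv by simp
    also have "\<dots> = (push ^^ n) (\<lambda>s. G (min (max s (a i)) (b i)) - G (a i)) (b j)
        - (push ^^ n) (\<lambda>s. G (min (max s (a i)) (b i)) - G (a i)) (a j)"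
    proof -
      have cdf: "measure \<mu> {x \<in> S. x \<le> s} = G (min (max s (a i)) (b i)) - G (a i)" if "s \<in> {0..1}" for s
      proof -
        have "{x \<in> S. x \<le> s} = {a i<..min (max s (a i)) (b i)}"
          by (auto simp: S_def)
        then show ?thesis
          using G_diff[of "a i" "min (max s (a i)) (b i)"] ab(1-3)[OF ij(1)] d by simp
      qed
      show ?thesis
        by (simp only: push_iter_cong[OF cdf uv(1)] push_iter_cong[OF cdf uv(2)])
    qed
    also have "\<dots> \<le> (G (b j) - G (a j)) * ((G (b i) - G (a i)) + K * (G (b i) - G (a i)) * real n powr -\<kappa> + y n)"
      using ab(1-3)[OF ij(1)] ab(1-3)[OF j] n(1) by (intro bound)
    finally show ?thesis
      using A_measure B_prob ij(1) j by (simp add: n_def)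
  qed
  have "filterlim (\<lambda>n. \<Sum>k=1..n. \<mu>.prob (A k)) at_top sequentially"
  proof -
    define c where "c k = measure \<mu> (B (Suc k))" for k
    have sum_eq: "(\<Sum>k=1..n. \<mu>.prob (A k)) = (\<Sum>k<n. c k)" for n
      unfolding c_def using A_measure
      by (simp add: sum.atLeast1_atMost_eq)
    have "\<not> summable c"
    proof
      \<comment> \<open>A convergent real series would have a finite sum in the extended reals,
        contradicting the divergence hypothesis.\<close>
      assume "summable c"
      have "(\<Sum>k. ennreal (c k)) = ennreal (suminf c)"
        by (rule suminf_ennreal2[OF _ \<open>summable c\<close>]) (simp add: c_def)
      then show False
        using div by (simp add: c_def \<mu>.emeasure_eq_measure)
    qed
    moreover have c: "0 \<le> c k" for k
      by (simp add: c_def)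
    ultimately have unb: "\<exists>n. Z < (\<Sum>k<n. c k)" for Z
      using summableI_nonneg_bounded[of c Z] not_le by blast
    show ?thesis
      unfolding sum_eq filterlim_at_top
    proof
      fix Z
      obtain n where n: "Z < (\<Sum>k<n. c k)"
        using unb by blast
      have "Z \<le> (\<Sum>k<m. c k)" if "n \<le> m" for m
        using n that sum_mono2[of "{..<m}" "{..<n}" c] c by simp
      then show "eventually (\<lambda>n. Z \<le> (\<Sum>k<n. c k)) sequentially"
        by (auto simp: eventually_sequentially)
    qed
  qed
  from \<mu>.strong_borel_cantelli_of_covariances[OF A_sets cov K(1-5) this]
  have "AE x in \<mu>. (\<lambda>n. (\<Sum>k=1..n. indicator (A k) x) / (\<Sum>k=1..n. \<mu>.prob (A k))) \<longlonglongrightarrow> 1" .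
  moreover have "(\<Sum>k=1..n. indicator (A k) x) = hit_count \<mu> ?T B n x" for n x
    unfolding hit_count_def by (intro sum.cong) (auto simp: A_def)
  moreover have "(\<Sum>k=1..n. \<mu>.prob (A k)) = expected_hits \<mu> ?T B n" for n
    unfolding expected_hits_def by (intro sum.cong) (auto simp: A_def)
  ultimately show ?thesis
    unfolding strong_borel_cantelli_def by simp
qed

end
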